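(* Let $p$ be a prime, $p>3$, and let $c\in D_p$ with $c^2\not\equiv -3\pmod p$. Then \[ \left(\frac{3(c^2+3)}{p}\right)\sum_{k=0}^{p-1}S_k\left(\frac{c^2}{108(c^2+3)}\right)^k\equiv \begin{cases} 1/2 \pmod{p}, & c\in C_0(p);\\ \frac{9-2c}{8c} \pmod{p}, & c\in C_1(p);\\ -\frac{9+2c}{8c} \pmod{p}, & c\in C_2(p), \end{cases} \] and \[ \left(\frac{c^2+3}{p}\right)\sum_{k=0}^{p-1}\frac{(2k+1)S_k}{36^k(3+c^2)^k}\equiv \begin{cases} 1/2 \pmod{p}, & c\in C_0(p);\\ \frac{2-c}{4c} \pmod{p}, & c\in C_1(p);\\ -\frac{2+c}{4c} \pmod{p}, & c\in C_2(p). \end{cases} \]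
   Context: $S_n=\frac{\binom{6n}{3n}\binom{3n}{n}}{2\binom{2n}{n}(2n+1)}$. $D_p$ is the set of rationals whose denominator is not divisible by $p$; for $c=a/b\in D_p$ in lowest terms, $\left(\frac{c}{p}\right)=\left(\frac{ab}{p}\right)$ (Legendre symbol). Let $\omega=e^{2\pi i/3}$, $\mathbb{Z}[\omega]$ the Eisenstein integers, $N(a+b\omega)=a^2-ab+b^2$. For a prime $\pi$ of $\mathbb{Z}[\omega]$ with $N(\pi)\neq 3$ and $\alpha\in\mathbb{Z}[\omega]$, $\left(\frac{\alpha}{\pi}\right)_3$ is $0$ if $\pi\mid\alpha$, otherwise the unique $\omega^j$ with $\alpha^{(N(\pi)-1)/3}\equiv\omega^j\pmod{\pi}$. For a rational prime $p\equiv 2\pmod 3$, $p$ is prime in $\mathbb{Z}[\omega]$ and $\left(\frac{\alpha}{p}\right)_3$ is this character; for $p\equiv 1\pmod 3$, write $p=\pi\bar\pi$ with $\pi\equiv 2\pmod 3$ and set $\left(\frac{\alpha}{p}\right)_3=\left(\frac{\alpha}{\pi}\right)_3\left(\frac{\alpha}{\bar\pi}\right)_3$. Elements of $D_p$ are reduced modulo these primes naturally. For $j\in\{0,1,2\}$, $C_j(p)=\{c\in D_p : \left(\frac{c+1+2\omega}{p}\right)_3=\omega^j\}$.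
   Formalization: In the case c in C_0(p) of the second congruence the condition c not congruent to 0 mod p is added; as printed it fails there (p = 7, c = 0 gives 1, not 1/2 = 4 mod 7; in general the value is 2/9). *)

theory Defs
  imports Complex_Main "HOL-Number_Theory.Number_Theory"
begin

definition S :: "nat \<Rightarrow> rat" where
  "S n = of_nat (((6 * n) choose (3 * n)) * ((3 * n) choose n)) /
         (2 * of_nat ((2 * n) choose n) * of_nat (2 * n + 1))"

definition D :: "nat \<Rightarrow> rat set" where
  "D p = {c. \<not> int p dvd snd (quotient_of c)}"

definition rat_cong :: "nat \<Rightarrow> rat \<Rightarrow> rat \<Rightarrow> bool" where
  "rat_cong p x y \<longleftrightarrow> (\<exists>z\<in>D p. x - y = of_nat p * z)"

definition rat_Legendre :: "rat \<Rightarrow> nat \<Rightarrow> int" where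
  "rat_Legendre c p = (case quotient_of c of (a, b) \<Rightarrow> Legendre (a * b) (int p))"

definition complex_omega :: complex where
  "complex_omega = exp (2 * of_real pi * \<i> / 3)"

lemma complex_omega_Complex: "complex_omega = Complex (- 1 / 2) (sqrt 3 / 2)"
proof -
  have "complex_omega = cis (2 * pi / 3)"
    by (simp add: complex_omega_def cis_conv_exp mult_ac)
  then show ?thesis
    by (simp add: complex_eq_iff cos_120 sin_120)
qed

lemma complex_omega_square: "complex_omega * complex_omega = - 1 - complex_omega"
  by (simp add: complex_omega_Complex complex_eq_iff)

lemma cnj_complex_omega: "cnj complex_omega = - 1 - complex_omega"
  by (simp add: complex_omega_Complex complex_eq_iff)

typedef eisenstein =
  "{z :: complex. \<exists>a b :: int. z = of_int a + of_int b * complex_omega}"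
  morphisms complex_of_eisenstein Abs_eisenstein
  by blast

setup_lifting type_definition_eisenstein

instantiation eisenstein :: comm_ring_1
begin

lift_definition zero_eisenstein :: eisenstein is 0
  by (intro exI[of _ 0]) simp

lift_definition one_eisenstein :: eisenstein is 1
  by (rule exI[of _ 1], rule exI[of _ 0]) simp

lift_definition uminus_eisenstein :: "eisenstein \<Rightarrow> eisenstein" is uminus
proof -
  fix z :: complex
  assume "\<exists>a b :: int. z = of_int a + of_int b * complex_omega"
  then obtain a b :: int where "z = of_int a + of_int b * complex_omega" by blast
  then have "- z = of_int (- a) + of_int (- b) * complex_omega" by simp
  then show "\<exists>a b :: int. - z = of_int a + of_int b * complex_omega" by blast
qed

lift_definition plus_eisenstein :: "eisenstein \<Rightarrow> eisenstein \<Rightarrow> eisenstein" is plus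
proof -
  fix z w :: complex
  assume "\<exists>a b :: int. z = of_int a + of_int b * complex_omega"
    and "\<exists>a b :: int. w = of_int a + of_int b * complex_omega"
  then obtain a b c d :: int where "z = of_int a + of_int b * complex_omega"
    and "w = of_int c + of_int d * complex_omega" by blast
  then have "z + w = of_int (a + c) + of_int (b + d) * complex_omega"
    by (simp add: algebra_simps)
  then show "\<exists>a b :: int. z + w = of_int a + of_int b * complex_omega" by blast
qed

lift_definition minus_eisenstein :: "eisenstein \<Rightarrow> eisenstein \<Rightarrow> eisenstein" is minus
proof -
  fix z w :: complex
  assume "\<exists>a b :: int. z = of_int a + of_int b * complex_omega"
    and "\<exists>a b :: int. w = of_int a + of_int b * complex_omega"
  then obtain a b c d :: int where "z = of_int a + of_int b * complex_omega"
    and "w = of_int c + of_int d * complex_omega" by blast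
  then have "z - w = of_int (a - c) + of_int (b - d) * complex_omega"
    by (simp add: algebra_simps)
  then show "\<exists>a b :: int. z - w = of_int a + of_int b * complex_omega" by blast
qed

lift_definition times_eisenstein :: "eisenstein \<Rightarrow> eisenstein \<Rightarrow> eisenstein" is times
proof -
  fix z w :: complex
  assume "\<exists>a b :: int. z = of_int a + of_int b * complex_omega"
    and "\<exists>a b :: int. w = of_int a + of_int b * complex_omega"
  then obtain a b c d :: int where zw: "z = of_int a + of_int b * complex_omega"
    "w = of_int c + of_int d * complex_omega" by blast
  have "z * w = of_int (a * c) + of_int (a * d + b * c) * complex_omega
      + of_int (b * d) * (complex_omega * complex_omega)"
    unfolding zw by (simp add: algebra_simps)
  also have "\<dots> = of_int (a * c - b * d) + of_int (a * d + b * c - b * d) * complex_omega"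
    by (simp add: complex_omega_square algebra_simps)
  finally show "\<exists>a b :: int. z * w = of_int a + of_int b * complex_omega" by blast
qed

instance
  by standard (transfer; simp add: algebra_simps)+

end

lift_definition omega :: eisenstein is complex_omega
  by (rule exI[of _ 0], rule exI[of _ 1]) simp

lift_definition eis_cnj :: "eisenstein \<Rightarrow> eisenstein" is cnj
proof -
  fix z :: complex
  assume "\<exists>a b :: int. z = of_int a + of_int b * complex_omega"
  then obtain a b :: int where "z = of_int a + of_int b * complex_omega" by blast
  then have "cnj z = of_int (a - b) + of_int (- b) * complex_omega"
    by (simp add: cnj_complex_omega algebra_simps)
  then show "\<exists>a b :: int. cnj z = of_int a + of_int b * complex_omega" by blast
qed

definition eis_norm :: "eisenstein \<Rightarrow> int" where
  "eis_norm z = (THE n. \<exists>a b :: int. z = of_int a + of_int b * omega \<and> n = a\<^sup>2 - a * b + b\<^sup>2)"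

text \<open>Only meaningful when \<open>\<pi>\<close> is prime with norm different from 3; the powers of \<open>omega\<close>
  are then pairwise incongruent modulo \<open>\<pi>\<close>.\<close>

definition cubic_char :: "eisenstein \<Rightarrow> eisenstein \<Rightarrow> eisenstein" where
  "cubic_char \<alpha> \<pi> =
    (if \<pi> dvd \<alpha> then 0
     else (THE z. z \<in> {1, omega, omega\<^sup>2} \<and> \<pi> dvd \<alpha> ^ nat ((eis_norm \<pi> - 1) div 3) - z))"

text \<open>Only meaningful for primes \<open>p > 3\<close>. For \<open>p mod 3 = 1\<close> the factor \<open>\<pi>\<close> is determined up to
  conjugation, which does not affect the product.\<close>

definition cubic_symbol :: "eisenstein \<Rightarrow> nat \<Rightarrow> eisenstein" where
  "cubic_symbol \<alpha> p =
    (if p mod 3 = 2 then cubic_char \<alpha> (of_nat p)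
     else (let \<pi> = (SOME \<pi>. prime_elem \<pi> \<and> of_nat p = \<pi> * eis_cnj \<pi> \<and> 3 dvd \<pi> - 2)
           in cubic_char \<alpha> \<pi> * cubic_char \<alpha> (eis_cnj \<pi>)))"

text \<open>An element \<open>c\<close> of \<open>D p\<close> is reduced modulo a prime above \<open>p\<close> by passing to an integer
  \<open>m\<close> congruent to \<open>c\<close> modulo \<open>p\<close>; the symbol does not depend on the choice of \<open>m\<close>.\<close>

definition C :: "nat \<Rightarrow> nat \<Rightarrow> rat set" where
  "C j p = {c \<in> D p. \<exists>m :: int. rat_cong p c (of_int m) \<and>
              cubic_symbol (of_int m + 1 + 2 * omega) p = omega ^ j}"

end

theory Submission
  imports Defs
begin

text \<open>
  Put \<open>h = (p - 1) / 2\<close>. Modulo \<open>p\<close> the hypergeometric ratio of consecutive \<open>S k\<close> is that of a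
  terminating series: for \<open>k < h\<close> one has \<open>2 (2 k + 1) S k = binomial (n + k) (2 k) (-432)^k\<close>, where
  \<open>p = 6 n + 1\<close> or \<open>p = 6 n + 5\<close>, and for \<open>k = h + j\<close> one has
  \<open>-8 S k = (binomial (N + j) (2 j) + binomial (N - 1 + j) (2 j)) (-432)^j\<close> with \<open>N = (p \<mp> 1) / 3\<close>.
  Both halves of each sum are therefore Chebyshev-type polynomials in \<open>y = u + 1 / u - 2\<close>, that is,
  Laurent polynomials in \<open>u\<close>. With \<open>s = 1 + 2 \<omega> = sqrt (-3)\<close> and \<open>v = (c + s) / (c - s)\<close>, the
  argument of the first sum is \<open>u = -v\<close> and that of the second is \<open>u = v\<close>. The Frobenius congruence
  \<open>\<alpha>^p = \<alpha>\<close> or \<open>\<alpha>^p = cnj \<alpha>\<close> modulo \<open>p\<close> in the Eisenstein integers shows that the cubic symbol of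
  \<open>c + s\<close> is \<open>v^N\<close> or \<open>v^(-N)\<close>, and that the quadratic symbol of \<open>c\<^sup>2 + 3\<close> is a power of \<open>v\<close> as well,
  so everything can be expressed through \<open>v\<close> and the cube root of unity \<open>\<omega>^j\<close>. The computations take place
  inside the complex numbers, modulo \<open>p\<close> in the ring of all \<open>a + b \<omega>\<close> with \<open>a\<close>, \<open>b\<close> in \<open>D p\<close>.
\<close>


text \<open>The ratio 6 (6 k + 5) (6 k + 1) / ((k + 1) (2 k + 3)) of consecutive \<open>S k\<close>
  vanishes modulo \<open>p\<close> at k = -1/6 and k = -5/6, and \<open>n\<close> and -n - 1 are
  integers in these two classes; this is why the series terminates. Comparing leading coefficients
  gives the factor -432 = -12 * 36. Residue fields would differ with \<open>p\<close>: two copies of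
  the field with p elements if p = 1 mod 3, one with p^2 elements if p = 2 mod 3. Localizing at
  \<open>p\<close> inside the complex numbers serves both: relations between c, s and v are exact
  identities there, and only the invertibility of denominators needs care. The denominator that can
  fail to be a unit is v + 1 = 2 c / (c - s), so c = 0 mod p is treated apart. Split and inert
  primes give different powers of v at every stage, but the differences cancel: with W = \<omega>^j
  both lead to (v W^2 + W) / (v + 1) for the lower half and to W + W^2 or W^2 - W for the upper
  half, up to common factors.\<close>

section \<open>Coordinates, norm and conjugation of Eisenstein integers\<close>

lemmas eis_rep = zero_eisenstein.rep_eq one_eisenstein.rep_eq uminus_eisenstein.rep_eq
  plus_eisenstein.rep_eq minus_eisenstein.rep_eq times_eisenstein.rep_eq omega.rep_eq eis_cnj.rep_eq

lemma complex_of_eisenstein_of_nat [simp]: "complex_of_eisenstein (of_nat n) = of_nat n"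
  by (induction n) (simp_all add: eis_rep)

lemma complex_of_eisenstein_of_int [simp]: "complex_of_eisenstein (of_int n) = of_int n"
  by (cases n rule: int_cases2) (simp_all add: eis_rep)

lemma complex_of_eisenstein_numeral [simp]: "complex_of_eisenstein (numeral n) = numeral n"
  using complex_of_eisenstein_of_nat[of "numeral n"] by simp

lemma complex_of_eisenstein_power [simp]:
  "complex_of_eisenstein (x ^ n) = complex_of_eisenstein x ^ n"
  by (induction n) (simp_all add: eis_rep)

lemma eis_eqI: "complex_of_eisenstein x = complex_of_eisenstein y \<Longrightarrow> x = y"
  by (simp add: complex_of_eisenstein_inject)

lemma omega_square: "omega\<^sup>2 = - 1 - omega"
  by (rule eis_eqI) (simp add: eis_rep power2_eq_square complex_omega_square)

lemma omega_cube: "omega ^ 3 = 1"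
proof -
  have "omega ^ 3 = omega\<^sup>2 * omega" by (simp add: power3_eq_cube power2_eq_square)
  also have "\<dots> = - omega - omega\<^sup>2" by (simp add: omega_square algebra_simps power2_eq_square[symmetric])
  also have "\<dots> = 1" by (simp add: omega_square)
  finally show ?thesis .
qed

lemma eis_cnj_simps [simp]:
  "eis_cnj (x + y) = eis_cnj x + eis_cnj y"
  "eis_cnj (x - y) = eis_cnj x - eis_cnj y"
  "eis_cnj (x * y) = eis_cnj x * eis_cnj y"
  "eis_cnj (- x) = - eis_cnj x"
  "eis_cnj (x ^ k) = eis_cnj x ^ k"
  "eis_cnj (of_int i) = of_int i"
  "eis_cnj (of_nat m) = of_nat m"
  "eis_cnj (numeral w) = numeral w"
  "eis_cnj 1 = 1"
  "eis_cnj 0 = 0"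
  "eis_cnj (eis_cnj x) = x"
  by (rule eis_eqI; simp add: eis_rep)+

lemma eis_cnj_omega: "eis_cnj omega = omega\<^sup>2"
  unfolding omega_square by (rule eis_eqI) (simp add: eis_rep cnj_complex_omega)

lemma eis_coords:
  obtains a b :: int where "z = of_int a + of_int b * omega"
proof -
  obtain a b :: int where "complex_of_eisenstein z = of_int a + of_int b * complex_omega"
    using complex_of_eisenstein[of z] by auto
  then have "z = of_int a + of_int b * omega"
    by (intro eis_eqI) (simp add: eis_rep)
  then show ?thesis by (rule that)
qed

lemma Re_Im_complex_omega [simp]: "Re complex_omega = - 1 / 2" "Im complex_omega = sqrt 3 / 2"
  by (simp_all add: complex_omega_Complex)

lemma eis_coords_eq_iff:
  "(of_int a + of_int b * omega = of_int a' + of_int b' * omega) \<longleftrightarrow> a = a' \<and> b = b'"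
proof
  assume "of_int a + of_int b * omega = of_int a' + of_int b' * omega"
  then have "complex_of_eisenstein (of_int a + of_int b * omega)
      = complex_of_eisenstein (of_int a' + of_int b' * omega)" by simp
  then show "a = a' \<and> b = b'"
    by (simp add: eis_rep complex_eq_iff)
qed simp

lemma eis_norm_coords: "eis_norm (of_int a + of_int b * omega) = a\<^sup>2 - a * b + b\<^sup>2"
  unfolding eis_norm_def by (rule the_equality) (auto simp: eis_coords_eq_iff)

lemma eis_mult_cnj: "z * eis_cnj z = of_int (eis_norm z)"
proof -
  obtain a b :: int where z: "z = of_int a + of_int b * omega" by (rule eis_coords)
  show ?thesis
    unfolding z eis_norm_coords
    by (rule eis_eqI)
       (simp add: eis_rep complex_eq_iff power2_eq_square algebra_simps)
qed

lemma of_int_eis_eq_iff [simp]: "(of_int a :: eisenstein) = of_int b \<longleftrightarrow> a = b"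
  using eis_coords_eq_iff[of a 0 b 0] by simp

lemma eis_norm_mult: "eis_norm (x * y) = eis_norm x * eis_norm y"
proof -
  have "(of_int (eis_norm (x * y)) :: eisenstein) = of_int (eis_norm x * eis_norm y)"
    by (simp flip: eis_mult_cnj add: mult_ac)
  then show ?thesis by (simp only: of_int_eis_eq_iff)
qed

lemma eis_norm_dvd: "x dvd y \<Longrightarrow> eis_norm x dvd eis_norm y"
  by (auto simp: dvd_def eis_norm_mult)

lemma eis_norm_of_int: "eis_norm (of_int a) = a\<^sup>2"
  using eis_norm_coords[of a 0] by simp

lemma eis_norm_of_nat: "eis_norm (of_nat a) = (int a)\<^sup>2"
  using eis_norm_of_int[of "int a"] by simp

lemma eis_norm_cnj: "eis_norm (eis_cnj z) = eis_norm z"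
proof -
  have "(of_int (eis_norm (eis_cnj z)) :: eisenstein) = of_int (eis_norm z)"
    by (simp flip: eis_mult_cnj add: mult_ac)
  then show ?thesis by simp
qed

text \<open>The type is only an instance of \<open>comm_ring_1\<close>; the absence of zero divisors
  is borrowed from the complex numbers.\<close>

lemma eis_mult_left_cancel:
  assumes "x * y = x * z" and "x \<noteq> (0 :: eisenstein)"
  shows "y = z"
proof (rule eis_eqI)
  have "complex_of_eisenstein x \<noteq> 0"
    using assms(2) by (metis eis_eqI zero_eisenstein.rep_eq)
  moreover have "complex_of_eisenstein x * complex_of_eisenstein y
      = complex_of_eisenstein x * complex_of_eisenstein z"
    using assms(1) by (metis times_eisenstein.rep_eq)
  ultimately show "complex_of_eisenstein y = complex_of_eisenstein z" by simp
qed

lemma of_int_dvd_coords_iff: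
  "(of_int d :: eisenstein) dvd of_int a + of_int b * omega \<longleftrightarrow> d dvd a \<and> d dvd b"
proof
  assume "(of_int d :: eisenstein) dvd of_int a + of_int b * omega"
  then obtain z where z: "of_int a + of_int b * omega = of_int d * z" by (auto simp: dvd_def)
  obtain a' b' :: int where "z = of_int a' + of_int b' * omega" by (rule eis_coords)
  with z have "of_int a + of_int b * omega = of_int (d * a') + of_int (d * b') * omega"
    by (simp add: algebra_simps)
  then show "d dvd a \<and> d dvd b" unfolding eis_coords_eq_iff by simp
next
  assume "d dvd a \<and> d dvd b"
  then obtain a' b' where "a = d * a'" "b = d * b'" by (auto simp: dvd_def)
  then have "of_int a + of_int b * omega = of_int d * (of_int a' + of_int b' * omega)"
    by (simp add: algebra_simps)
  then show "(of_int d :: eisenstein) dvd of_int a + of_int b * omega" by simp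
qed

lemma of_int_dvd_of_int_eis: "(of_int d :: eisenstein) dvd of_int a \<longleftrightarrow> d dvd a"
  using of_int_dvd_coords_iff[of d a 0] by simp

lemma of_nat_dvd_of_int_eis: "(of_nat d :: eisenstein) dvd of_int a \<longleftrightarrow> int d dvd a"
  using of_int_dvd_of_int_eis[of "int d" a] by simp

lemma eis_cnj_dvd: "x dvd y \<Longrightarrow> eis_cnj x dvd eis_cnj y"
  by (auto simp: dvd_def)

section \<open>The Frobenius congruence\<close>

text \<open>The inner binomial coefficients of the p-th row are divisible by p.\<close>

lemma prime_dvd_power_add_diff:
  fixes x y :: "'a :: comm_ring_1"
  assumes p: "prime p"
  shows "of_nat p dvd (x + y) ^ p - (x ^ p + y ^ p)"
proof -
  have p1: "p > 1" using p prime_gt_1_nat by blast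
  have "(x + y) ^ p = (\<Sum>k\<le>p. of_nat (p choose k) * x ^ k * y ^ (p - k))"
    by (rule binomial_ring)
  also have "{..p} = insert 0 (insert p {1..<p})" using p1 by auto
  finally have "(x + y) ^ p - (x ^ p + y ^ p)
      = (\<Sum>k = 1..<p. of_nat (p choose k) * x ^ k * y ^ (p - k))"
    using p1 by (simp add: algebra_simps)
  moreover have "of_nat p dvd (of_nat (p choose k) * x ^ k * y ^ (p - k) :: 'a)"
    if "k \<in> {1..<p}" for k
  proof -
    have "p dvd (p choose k)" using that p by (intro dvd_choose_prime) auto
    then have "(of_nat p :: 'a) dvd of_nat (p choose k)" by (auto simp: dvd_def)
    then show ?thesis by (simp add: mult.assoc)
  qed
  ultimately show ?thesis by (metis (no_types, lifting) dvd_sum)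
qed

lemma fermat_int:
  assumes "prime p" shows "int p dvd a ^ p - a"
proof (cases "int p dvd a")
  case True
  moreover have "a dvd a ^ p" using prime_gt_0_nat[OF assms] by (simp add: dvd_power)
  ultimately show ?thesis by (meson dvd_diff dvd_trans)
next
  case False
  interpret residues_prime p "residue_ring (int p)"
    by (rule residues_prime.intro) (use assms in auto)
  have "coprime a (int p)" using False assms
    by (metis coprime_commute prime_imp_coprime prime_nat_int_transfer)
  then have "[a ^ totient (nat (int p)) = 1] (mod int p)"
    by (rule euler_theorem)
  then have "[a ^ (p - 1) * a = 1 * a] (mod int p)"
    using assms by (intro cong_mult) (simp_all add: totient_prime)
  moreover have "a ^ (p - 1) * a = a ^ p"
    using prime_gt_0_nat[OF assms] by (metis power_minus_mult)
  ultimately show ?thesis by (simp add: cong_iff_dvd_diff)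
qed

lemma dvd_power_diff:
  fixes x y :: "'a :: comm_ring_1"
  assumes "d dvd x - y" shows "d dvd x ^ n - y ^ n"
proof (induction n)
  case (Suc n)
  have "x ^ Suc n - y ^ Suc n = x * (x ^ n - y ^ n) + (x - y) * y ^ n"
    by (simp add: algebra_simps)
  with Suc assms show ?case by simp
qed simp

lemma dvd_diff_trans:
  fixes x y z :: "'a :: comm_ring_1"
  assumes "d dvd x - y" "d dvd y - z" shows "d dvd x - z"
  using dvd_add[OF assms] by simp

text \<open>Additivity of the p-th power and Fermat on the integer coordinates leave only
  \<open>omega ^ p\<close> undetermined; it is \<open>omega\<close> or its conjugate according to p
  mod 3.\<close>

lemma eis_frobenius:
  assumes p: "prime p"
  shows "of_nat p dvd (of_int a + of_int b * omega) ^ p - (of_int a + of_int b * omega ^ p)"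
proof -
  let ?z = "of_int a + of_int b * omega"
  have 1: "of_nat p dvd ?z ^ p - (of_int a ^ p + (of_int b * omega) ^ p)"
    by (rule prime_dvd_power_add_diff[OF p])
  have "(of_nat p :: eisenstein) dvd of_int (a ^ p - a)" "(of_nat p :: eisenstein) dvd of_int (b ^ p - b)"
    unfolding of_nat_dvd_of_int_eis using fermat_int[OF p] by blast+
  then have "of_nat p dvd of_int (a ^ p - a) + of_int (b ^ p - b) * omega ^ p"
    by simp
  also have "of_int (a ^ p - a) + of_int (b ^ p - b) * omega ^ p
    = (of_int a ^ p + (of_int b * omega) ^ p) - (of_int a + of_int b * omega ^ p)"
    by (simp add: algebra_simps)
  finally show ?thesis using 1 by (rule dvd_diff_trans[rotated])
qed

lemma omega_power_mod: "omega ^ k = omega ^ (k mod 3)"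
proof -
  have "omega ^ k = omega ^ (3 * (k div 3) + k mod 3)" by simp
  also have "\<dots> = omega ^ (k mod 3)" unfolding power_add power_mult omega_cube by simp
  finally show ?thesis .
qed

lemma eis_frobenius_split:
  assumes "prime p" "p mod 3 = 1"
  shows "of_nat p dvd z ^ p - (z :: eisenstein)"
proof -
  obtain a b :: int where z: "z = of_int a + of_int b * omega" by (rule eis_coords)
  show ?thesis unfolding z
    using eis_frobenius[OF assms(1), of a b] omega_power_mod[of p] assms(2) by simp
qed

lemma eis_frobenius_inert:
  assumes "prime p" "p mod 3 = 2"
  shows "of_nat p dvd z ^ p - eis_cnj z"
proof -
  obtain a b :: int where z: "z = of_int a + of_int b * omega" by (rule eis_coords)
  show ?thesis unfolding z
    using eis_frobenius[OF assms(1), of a b] omega_power_mod[of p] assms(2)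
    by (simp add: eis_cnj_omega)
qed

section \<open>Eisenstein primes and the cubic symbol\<close>

lemma of_nat_eis_eq_0_iff [simp]: "(of_nat m :: eisenstein) = 0 \<longleftrightarrow> m = 0"
  using of_int_eis_eq_iff[of "int m" 0] by simp

text \<open>No factorization theory is used. If p divides the norm z * cnj z, Frobenius replaces cnj
  z by z^p, so p divides z^(p + 1) and hence z^(p^2); but applying Frobenius twice conjugates twice,
  so z^(p^2) = z mod p. Primality thus reduces to that of p among integer norms.\<close>

lemma prime_elem_eis_inert:
  assumes p: "prime p" "p mod 3 = 2"
  shows "prime_elem (of_nat p :: eisenstein)"
proof (rule prime_elemI)
  show "(of_nat p :: eisenstein) \<noteq> 0" using p prime_gt_0_nat by auto
  show "\<not> (of_nat p :: eisenstein) dvd 1"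
    using of_nat_dvd_of_int_eis[of p 1] prime_gt_1_nat[OF p(1)] by simp
  have *: "of_nat p dvd z" if "int p dvd eis_norm z" for z
  proof -
    have 1: "of_nat p dvd z * eis_cnj z"
      using that by (simp add: eis_mult_cnj of_nat_dvd_of_int_eis)
    have "of_nat p dvd z * (z ^ p - eis_cnj z)"
      using eis_frobenius_inert[OF p] by simp
    with 1 have "of_nat p dvd z * (z ^ p - eis_cnj z) + z * eis_cnj z" by (rule dvd_add[rotated])
    then have 2: "of_nat p dvd z ^ Suc p" by (simp add: algebra_simps)
    have "Suc p \<le> 2 * p" "2 * p \<le> p * p" using prime_ge_2_nat[OF p(1)] by simp_all
    then have "Suc p \<le> p * p" by linarith
    then have "z ^ Suc p dvd z ^ (p * p)" by (rule le_imp_power_dvd)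
    with 2 have 3: "of_nat p dvd z ^ (p * p)" by (rule dvd_trans)
    have "of_nat p dvd (z ^ p) ^ p - (eis_cnj z) ^ p"
      by (rule dvd_power_diff) (rule eis_frobenius_inert[OF p])
    moreover have "of_nat p dvd (eis_cnj z) ^ p - z"
      using eis_frobenius_inert[OF p, of "eis_cnj z"] by simp
    ultimately have "of_nat p dvd (z ^ p) ^ p - z" by (rule dvd_diff_trans)
    with 3 have "of_nat p dvd z ^ (p * p) - ((z ^ p) ^ p - z)" by (rule dvd_diff)
    then show ?thesis by (simp add: power_mult)
  qed
  fix x y :: eisenstein
  assume "of_nat p dvd x * y"
  then have "eis_norm (of_nat p) dvd eis_norm (x * y)" by (rule eis_norm_dvd)
  then have "int p dvd eis_norm x * eis_norm y"
    by (simp add: eis_norm_of_nat eis_norm_mult power2_eq_square dvd_mult_left)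
  then have "int p dvd eis_norm x \<or> int p dvd eis_norm y"
    using p(1) by (simp add: prime_dvd_mult_iff)
  then show "of_nat p dvd x \<or> of_nat p dvd y" using * by blast
qed

text \<open>Modulo z every Eisenstein integer is congruent to a rational integer, because
  \<open>omega\<close> is; divisibility of integers by z is divisibility by p, so the quotient is
  the field with p elements.\<close>

lemma prime_elem_eis_norm_prime:
  assumes p: "prime p" and N: "eis_norm z = int p"
  shows "prime_elem z"
proof -
  obtain a b :: int where z: "z = of_int a + of_int b * omega" by (rule eis_coords)
  have ab: "a\<^sup>2 - a * b + b\<^sup>2 = int p" using N by (simp add: z eis_norm_coords)
  have z0: "z \<noteq> 0"
  proof
    assume "z = 0"
    then have "eis_norm z = 0" using eis_norm_of_int[of 0] by simp
    with N p prime_gt_0_nat[of p] show False by simp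
  qed
  have zz: "z * eis_cnj z = of_nat p" using eis_mult_cnj[of z] N by simp
  \<comment> \<open>Otherwise p would divide a as well, and p^2 would divide the norm p.\<close>
  have nb: "\<not> int p dvd b"
  proof
    assume b: "int p dvd b"
    then have "int p dvd int p - b\<^sup>2 + a * b" by (simp add: power2_eq_square)
    moreover have "int p - b\<^sup>2 + a * b = a\<^sup>2" using ab by simp
    ultimately have "int p dvd a" using p by (metis prime_dvd_power prime_nat_int_transfer)
    with b have "(int p)\<^sup>2 dvd a\<^sup>2 - a * b + b\<^sup>2"
      by (auto simp: power2_eq_square intro!: dvd_add dvd_diff mult_dvd_mono)
    then have "int p * int p dvd int p * 1" unfolding ab by (simp add: power2_eq_square)
    then have "int p dvd 1" using p prime_gt_0_nat[of p] by (subst (asm) dvd_mult_cancel_left) auto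
    then show False using p prime_gt_1_nat[of p] by simp
  qed
  then have "coprime b (int p)" using p
    by (metis coprime_commute prime_imp_coprime prime_nat_int_transfer)
  then obtain b' where b': "[b * b' = 1] (mod int p)" using cong_solve_coprime_int by blast
  \<comment> \<open>The root of a + b X modulo p, that is, the integer to which \<open>omega\<close>
    is congruent modulo z.\<close>
  define r where "r = - a * b'"
  have pr: "int p dvd a + r * b"
  proof -
    have "int p dvd 1 - b * b'" using b' by (simp add: cong_iff_dvd_diff dvd_diff_commute)
    then have "int p dvd a * (1 - b * b')" by simp
    then show ?thesis by (simp add: r_def algebra_simps)
  qed
  have pr2: "int p dvd b - r * a + r * b"
  proof -
    have "int p dvd b * (b - r * a + r * b)"
    proof -
      have "b * (b - r * a + r * b) = (a\<^sup>2 - a * b + b\<^sup>2) - (a + r * b) * a + (a + r * b) * b"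
        by (simp add: algebra_simps power2_eq_square)
      then show ?thesis using pr ab by simp
    qed
    then show ?thesis using nb p by (metis prime_dvd_mult_iff prime_nat_int_transfer)
  qed
  \<comment> \<open>Multiplying by cnj z turns divisibility by z into divisibility of both
    coordinates by z * cnj z = p.\<close>
  have zr: "z dvd omega - of_int r"
  proof -
    have e: "(omega - of_int r) * eis_cnj z
        = of_int (b - r * a + r * b) + of_int (a + r * b) * omega"
      by (rule eis_eqI)
         (simp add: z eis_rep complex_eq_iff cnj_complex_omega algebra_simps)
    have "of_int (int p) dvd (omega - of_int r) * eis_cnj z"
      unfolding e of_int_dvd_coords_iff using pr pr2 by blast
    then obtain k where "(omega - of_int r) * eis_cnj z = z * eis_cnj z * k"
      using zz by (auto simp: dvd_def)
    then have "eis_cnj z * (omega - of_int r) = eis_cnj z * (z * k)" by (simp add: mult_ac)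
    moreover have "eis_cnj z \<noteq> 0" using z0 by (metis eis_cnj_simps(10) eis_cnj_simps(11))
    ultimately have "omega - of_int r = z * k" by (rule eis_mult_left_cancel)
    then show ?thesis by simp
  qed
  have zint: "z dvd of_int i \<longleftrightarrow> int p dvd i" for i
  proof
    assume "z dvd of_int i"
    then have "eis_norm z dvd eis_norm (of_int i)" by (rule eis_norm_dvd)
    then show "int p dvd i" using N p by (simp add: eis_norm_of_int prime_dvd_power_iff)
  next
    assume "int p dvd i"
    then have "(of_nat p :: eisenstein) dvd of_int i" by (simp add: of_nat_dvd_of_int_eis)
    then show "z dvd of_int i" using zz by (metis dvd_mult_left)
  qed
  have red: "\<exists>i :: int. z dvd x - of_int i" for x
  proof -
    obtain u v :: int where x: "x = of_int u + of_int v * omega" by (rule eis_coords)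
    have "x - of_int (u + v * r) = of_int v * (omega - of_int r)" by (simp add: x algebra_simps)
    then show ?thesis using zr by (metis dvd_mult)
  qed
  show ?thesis
  proof (rule prime_elemI)
    show "z \<noteq> 0" by (rule z0)
    show "\<not> z dvd 1" using zint[of 1] p prime_gt_1_nat[of p] by simp
    fix x y assume xy: "z dvd x * y"
    obtain i j :: int where i: "z dvd x - of_int i" and j: "z dvd y - of_int j" using red by blast
    have "z dvd x * y - (x - of_int i) * y - of_int i * (y - of_int j)"
      using i j xy by simp
    also have "x * y - (x - of_int i) * y - of_int i * (y - of_int j) = of_int (i * j)"
      by (simp add: algebra_simps)
    finally have "int p dvd i * j" by (simp only: zint)
    then have "z dvd of_int i \<or> z dvd of_int j" using p by (simp add: zint prime_dvd_mult_iff)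
    then show "z dvd x \<or> z dvd y"
      using i j by (metis diff_add_cancel dvd_add)
  qed
qed

text \<open>All differences of distinct cube roots of unity are associates of 1 -
  \<open>omega\<close> and have norm 3.\<close>

lemma omega_powers_incongruent:
  assumes "z \<in> {1, omega, omega\<^sup>2}" "w \<in> {1, omega, omega\<^sup>2}" "q dvd z - w" "\<not> eis_norm q dvd 3"
  shows "z = w"
proof (rule ccontr)
  assume "z \<noteq> w"
  have "eis_norm (1 - omega) = 3" "eis_norm (omega - 1) = 3"
      "eis_norm (1 - omega\<^sup>2) = 3" "eis_norm (omega\<^sup>2 - 1) = 3"
      "eis_norm (omega - omega\<^sup>2) = 3" "eis_norm (omega\<^sup>2 - omega) = 3"
    using eis_norm_coords[of 1 "- 1"] eis_norm_coords[of "- 1" 1] eis_norm_coords[of 2 1]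
      eis_norm_coords[of "- 2" "- 1"] eis_norm_coords[of 1 2] eis_norm_coords[of "- 1" "- 2"]
    by (simp_all add: omega_square algebra_simps)
  with \<open>z \<noteq> w\<close> have "eis_norm (z - w) = 3" using assms(1,2) by auto
  with eis_norm_dvd[OF assms(3)] assms(4) show False by simp
qed

text \<open>Here x^e is a root of X^3 - 1 = (X - 1)(X - \<omega>)(X - \<omega>^2) modulo the prime
  q, so q divides one of the factors, and only one. This discharges the definite description in
  \<open>cubic_char\<close>.\<close>

lemma cubic_char_cong:
  assumes q: "prime_elem q" "\<not> eis_norm q dvd 3" and nd: "\<not> q dvd x"
    and e: "nat ((eis_norm q - 1) div 3) = e" and x1: "q dvd x ^ (3 * e) - 1"
  shows "cubic_char x q \<in> {1, omega, omega\<^sup>2}" "q dvd x ^ e - cubic_char x q"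
proof -
  let ?b = "x ^ e"
  have "x ^ (3 * e) - 1 = ?b ^ 3 - 1" by (simp add: mult.commute flip: power_mult)
  also have "\<dots> = (?b - 1) * (?b * ?b - ?b * (omega + omega\<^sup>2) + omega ^ 3)"
    unfolding omega_cube by (simp add: omega_square power3_eq_cube algebra_simps)
  also have "?b * ?b - ?b * (omega + omega\<^sup>2) + omega ^ 3 = (?b - omega) * (?b - omega\<^sup>2)"
    by (simp add: algebra_simps power2_eq_square power3_eq_cube)
  finally have "q dvd (?b - 1) * ((?b - omega) * (?b - omega\<^sup>2))" using x1 by simp
  then have "\<exists>z. z \<in> {1, omega, omega\<^sup>2} \<and> q dvd ?b - z"
    using q(1) by (auto simp: prime_elem_dvd_mult_iff)
  then have "\<exists>!z. z \<in> {1, omega, omega\<^sup>2} \<and> q dvd ?b - z"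
  proof (rule ex_ex1I)
    fix z w
    assume z: "z \<in> {1, omega, omega\<^sup>2} \<and> q dvd ?b - z" and w: "w \<in> {1, omega, omega\<^sup>2} \<and> q dvd ?b - w"
    then have "q dvd (?b - w) - (?b - z)" by (meson dvd_diff)
    then have "q dvd z - w" by simp
    then show "z = w" using omega_powers_incongruent z w q(2) by blast
  qed
  from theI'[OF this] nd show "cubic_char x q \<in> {1, omega, omega\<^sup>2}" "q dvd x ^ e - cubic_char x q"
    by (simp_all add: cubic_char_def e)
qed

lemma omega_power_nonzero: "omega ^ j \<noteq> 0"
proof
  assume "omega ^ j = 0"
  then have "(omega ^ j) ^ 3 = 0" by simp
  moreover have "(omega ^ j) ^ 3 = (omega ^ 3) ^ j" by (simp add: mult.commute flip: power_mult)
  ultimately have "(1 :: eisenstein) = 0" by (simp add: omega_cube)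
  then show False using of_int_eis_eq_iff[of 1 0] by simp
qed

text \<open>The exponent (p^2 - 1) / 3 is kept as a product so that x^(p - 1) can later be replaced
  by cnj x / x.\<close>

lemma cubic_symbol_inert:
  assumes p: "prime p" "p mod 3 = 2" "p > 3"
    and sym: "cubic_symbol x p = omega ^ j"
  shows "of_nat p dvd x ^ ((p - 1) * ((p + 1) div 3)) - omega ^ j"
proof -
  define e where "e = (p - 1) * ((p + 1) div 3)"
  have 3: "3 * ((p + 1) div 3) = p + 1" using p(2) by presburger
  then have e3: "3 * e = (p - 1) * (p + 1)" unfolding e_def by (metis mult.left_commute)
  have "int (3 * e) = (int p)\<^sup>2 - 1" unfolding e3 using p(3)
    by (simp add: power2_eq_square algebra_simps of_nat_diff)
  then have ee: "nat (((int p)\<^sup>2 - 1) div 3) = e" by (metis nat_int nonzero_mult_div_cancel_left of_nat_mult of_nat_numeral zero_neq_numeral)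
  have cc: "cubic_char x (of_nat p) = omega ^ j" using sym p by (simp add: cubic_symbol_def)
  have nd: "\<not> of_nat p dvd x" using cc omega_power_nonzero by (auto simp: cubic_char_def)
  have pe: "prime_elem (of_nat p :: eisenstein)" using p by (intro prime_elem_eis_inert)
  have "of_nat p dvd (x ^ p) ^ p - (eis_cnj x) ^ p"
    using p by (intro dvd_power_diff eis_frobenius_inert)
  moreover have "of_nat p dvd (eis_cnj x) ^ p - x"
    using eis_frobenius_inert[of p "eis_cnj x"] p by simp
  ultimately have "of_nat p dvd (x ^ p) ^ p - x" by (rule dvd_diff_trans)
  moreover have "(x ^ p) ^ p - x = x * (x ^ (3 * e) - 1)"
  proof -
    have "p * p = Suc (3 * e)" unfolding e3 using p(3) by (cases p) (simp_all add: algebra_simps)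
    then show ?thesis by (simp add: algebra_simps flip: power_mult)
  qed
  ultimately have "of_nat p dvd x ^ (3 * e) - 1" using pe nd by (simp add: prime_elem_dvd_mult_iff)
  moreover have "\<not> eis_norm (of_nat p) dvd 3"
  proof
    assume "eis_norm (of_nat p) dvd 3"
    then have "(int p)\<^sup>2 \<le> 3" by (intro zdvd_imp_le) (simp_all add: eis_norm_of_nat)
    moreover have "int p * 1 \<le> int p * int p" using p(3) by (intro mult_left_mono) auto
    ultimately show False using p(3) by (simp add: power2_eq_square)
  qed
  ultimately have "of_nat p dvd x ^ e - cubic_char x (of_nat p)"
    using pe nd ee by (intro cubic_char_cong(2)) (auto simp: eis_norm_of_nat)
  then show ?thesis by (simp add: cc e_def)
qed

lemma eis_cnj_omega_power:
  assumes "z \<in> {1, omega, omega\<^sup>2}" shows "z * eis_cnj z = 1"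
  using assms omega_cube
  by (auto simp: eis_cnj_omega power2_eq_square power3_eq_cube mult_ac)

text \<open>The two characters are values of x^e modulo q and modulo cnj q; conjugating the second
  congruence gives cnj x^e modulo q. Hence the product of the characters compares x^e with cnj x^e
  modulo both factors, and so modulo p.\<close>

lemma cubic_symbol_split_aux:
  assumes p: "prime p" "p mod 3 = 1"
    and q: "prime_elem q" "of_nat p = q * eis_cnj q"
    and nd: "\<not> q dvd x" "\<not> eis_cnj q dvd x"
  shows "of_nat p dvd x ^ ((p - 1) div 3)
      - cubic_char x q * cubic_char x (eis_cnj q) * eis_cnj x ^ ((p - 1) div 3)"
proof -
  define e where "e = (p - 1) div 3"
  have p3: "p > 3" using p prime_ge_2_nat[of p] by (cases "p = 2"; cases "p = 3") auto
  have pe: "p = Suc (3 * e)" using p(2) p3 unfolding e_def by presburger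
  have "(of_int (eis_norm q) :: eisenstein) = of_int (int p)"
    unfolding eis_mult_cnj[symmetric] of_int_of_nat_eq q(2) ..
  then have N: "eis_norm q = int p" by (simp only: of_int_eis_eq_iff)
  have "q dvd x ^ (3 * e) - 1 \<and> \<not> eis_norm q dvd 3 \<and> nat ((eis_norm q - 1) div 3) = e"
    if "prime_elem q" "of_nat p = q * eis_cnj q" "\<not> q dvd x" "eis_norm q = int p" for q
  proof -
    have "q dvd of_nat p" using that(2) by simp
    then have "q dvd x ^ p - x" using eis_frobenius_split[OF p, of x] dvd_trans by blast
    then have "q dvd x * (x ^ (3 * e) - 1)" by (simp add: pe algebra_simps)
    moreover have "\<not> int p dvd 3" using p3 zdvd_imp_le[of "int p" 3] by auto
    ultimately show ?thesis using that pe by (auto simp: prime_elem_dvd_mult_iff)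
  qed
  note aux = this
  have qc: "prime_elem (eis_cnj q)" using p N by (intro prime_elem_eis_norm_prime) (simp_all add: eis_norm_cnj)
  define z1 z2 where "z1 = cubic_char x q" and "z2 = cubic_char x (eis_cnj q)"
  note a1 = aux[OF q nd(1) N]
  have "of_nat p = eis_cnj q * eis_cnj (eis_cnj q)" using q(2) by (simp add: mult.commute)
  moreover have "eis_norm (eis_cnj q) = int p" using N by (simp add: eis_norm_cnj)
  ultimately have a2: "eis_cnj q dvd x ^ (3 * e) - 1 \<and> \<not> eis_norm (eis_cnj q) dvd 3
      \<and> nat ((eis_norm (eis_cnj q) - 1) div 3) = e"
    using aux[OF qc _ nd(2)] by blast
  have 1: "z1 \<in> {1, omega, omega\<^sup>2}" "q dvd x ^ e - z1"
    unfolding z1_def by (rule cubic_char_cong[OF q(1) _ nd(1)]; use a1 in blast)+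
  have 2: "z2 \<in> {1, omega, omega\<^sup>2}" "eis_cnj q dvd x ^ e - z2"
    unfolding z2_def by (rule cubic_char_cong[OF qc _ nd(2)]; use a2 in blast)+
  define X where "X = x ^ e - z1 * z2 * eis_cnj x ^ e"
  have q1: "q dvd X"
  proof -
    have "q dvd eis_cnj x ^ e - eis_cnj z2" using eis_cnj_dvd[OF 2(2)] by simp
    then have "q dvd (x ^ e - z1) - z1 * z2 * (eis_cnj x ^ e - eis_cnj z2)"
      using 1(2) by simp
    also have "\<dots> = X - z1 * (1 - z2 * eis_cnj z2)" by (simp add: X_def algebra_simps)
    finally show ?thesis using eis_cnj_omega_power[OF 2(1)] by simp
  qed
  have q2: "eis_cnj q dvd X"
  proof -
    have "eis_cnj q dvd eis_cnj x ^ e - eis_cnj z1" using eis_cnj_dvd[OF 1(2)] by simp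
    then have "eis_cnj q dvd (x ^ e - z2) - z1 * z2 * (eis_cnj x ^ e - eis_cnj z1)"
      using 2(2) by simp
    also have "\<dots> = X - z2 * (1 - z1 * eis_cnj z1)" by (simp add: X_def algebra_simps)
    finally show ?thesis using eis_cnj_omega_power[OF 1(1)] by simp
  qed
  obtain a b :: int where z: "q = of_int a + of_int b * omega" by (rule eis_coords)
  have ab: "a\<^sup>2 - a * b + b\<^sup>2 = int p" using N by (simp add: z eis_norm_coords)
  define t where "t = 2 * a - b"
  have qt: "q + eis_cnj q = of_int t"
    by (simp add: z t_def eis_cnj_omega omega_square algebra_simps)
  have t4: "t\<^sup>2 + 3 * b\<^sup>2 = 4 * int p" unfolding ab[symmetric] t_def by (simp add: power2_eq_square algebra_simps)
  \<comment> \<open>A nonzero multiple t of p would have p^2 <= t^2 <= 4 p, too small for p >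
    3.\<close>
  have nt: "\<not> int p dvd t"
  proof
    assume pt: "int p dvd t"
    show False
    proof (cases "t = 0")
      case True
      then have "3 * b\<^sup>2 = 4 * int p" using t4 by simp
      then show False using p(2) by presburger
    next
      case False
      then have "int p \<le> \<bar>t\<bar>" using pt dvd_imp_le_int[of t "int p"] by simp
      then have "int p * int p \<le> t\<^sup>2" by (metis abs_of_nat abs_le_square_iff power2_eq_square)
      also have "\<dots> \<le> 4 * int p" using t4 zero_le_power2[of b] by linarith
      finally have "p \<le> 4" using p3 by simp
      then have "p = 4" using p3 by simp
      then have "2 * 2 = p" by simp
      then show False using p(1) by (metis numeral_eq_one_iff prime_product semiring_norm(85))
    qed
  qed
  \<comment> \<open>Both factors divide X, so p divides X cnj q + q X = t X, with t the trace of q.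
    As t is prime to p, this replaces an argument with coprime elements.\<close>
  have "q * eis_cnj q dvd X * eis_cnj q" "q * eis_cnj q dvd q * X" using q1 q2 by (simp_all add: mult_dvd_mono)
  then have "of_nat p dvd X * eis_cnj q + q * X" unfolding q(2) by (rule dvd_add)
  also have "X * eis_cnj q + q * X = of_int t * X" by (simp add: algebra_simps flip: qt)
  finally have ptX: "of_nat p dvd of_int t * X" .
  have "of_nat p dvd X"
  proof -
    obtain u v :: int where X: "X = of_int u + of_int v * omega" by (rule eis_coords)
    have "of_int (int p) dvd of_int (t * u) + of_int (t * v) * omega"
      using ptX by (simp add: X algebra_simps)
    then have "int p dvd t * u" "int p dvd t * v" unfolding of_int_dvd_coords_iff by auto
    then have "int p dvd u \<and> int p dvd v" using nt p(1) by (simp add: prime_dvd_mult_iff)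
    then show ?thesis unfolding X using of_int_dvd_coords_iff[of "int p" u v] by simp
  qed
  then show ?thesis by (simp add: X_def z1_def z2_def e_def)
qed

lemma one_plus_two_omega_square: "(1 + 2 * omega)\<^sup>2 = - 3"
proof -
  have "(1 + 2 * omega)\<^sup>2 = 1 + 4 * omega + 4 * omega\<^sup>2" by (simp add: power2_eq_square algebra_simps)
  then show ?thesis by (simp add: omega_square)
qed

lemma eis_cnj_one_plus_two_omega: "eis_cnj (1 + 2 * omega) = - (1 + 2 * omega)"
  by (simp add: eis_cnj_omega omega_square algebra_simps)

text \<open>Frobenius on s = sqrt (-3) gives s^p = s or cnj s = -s. Multiplying by s makes both
  sides rational integers, which yields the quadratic character of -3 without reciprocity.\<close>

lemma minus_three_power:
  assumes p: "prime p" "p > 3"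
  shows "int p dvd (- 3) ^ ((p - 1) div 2) - (if p mod 3 = 1 then 1 else - 1)"
proof -
  define h where "h = (p - 1) div 2"
  have "odd p" using p by (simp add: prime_odd_nat)
  then have ph: "p = Suc (2 * h)" unfolding h_def by presburger
  have "\<not> 3 dvd p" using p primes_dvd_imp_eq[of 3 p] by auto
  then have p3: "p mod 3 = 1 \<or> p mod 3 = 2" by presburger
  define d :: int where "d = (if p mod 3 = 1 then 1 else - 1)"
  define s where "s = 1 + 2 * omega"
  have s2: "s * s = of_int (- 3)" using one_plus_two_omega_square by (simp add: s_def power2_eq_square)
  have "of_nat p dvd s ^ p - of_int d * s"
    using eis_frobenius_split[OF p(1), of s] eis_frobenius_inert[OF p(1), of s] p3
      eis_cnj_one_plus_two_omega
    by (auto simp: d_def s_def simp del: eis_cnj_simps)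
  then have "of_nat p dvd s * (s ^ p - of_int d * s)" by (rule dvd_mult)
  also have "s * (s ^ p - of_int d * s) = (s * s) * ((s * s) ^ h - of_int d)"
    by (simp add: ph power_mult power2_eq_square algebra_simps)
  also have "\<dots> = of_int (- 3 * ((- 3) ^ h - d))" unfolding s2 by simp
  finally have "int p dvd - 3 * ((- 3) ^ h - d)" by (simp only: of_nat_dvd_of_int_eis)
  then have "int p dvd - 3 \<or> int p dvd (- 3) ^ h - d" using p(1) by (simp only: prime_dvd_mult_iff prime_nat_int_transfer)
  moreover have "\<not> int p dvd - 3" using p(2) zdvd_imp_le[of "int p" 3] by auto
  ultimately show ?thesis by (simp add: h_def d_def)
qed

lemma split_prime_root:
  assumes p: "prime p" "p mod 3 = 1"
  obtains r :: int where "int p dvd r\<^sup>2 + r + 1"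
proof -
  have p3: "p > 3" using p prime_ge_2_nat[of p] by (cases "p = 2"; cases "p = 3") auto
  have "[(- 3) ^ ((p - 1) div 2) = 1] (mod int p)"
    using minus_three_power[OF p(1) p3] p(2) by (simp add: cong_iff_dvd_diff)
  moreover have "[Legendre (- 3) (int p) = (- 3) ^ ((p - 1) div 2)] (mod int p)"
    using p p3 by (intro euler_criterion) auto
  ultimately have "[Legendre (- 3) (int p) = 1] (mod int p)" using cong_trans by blast
  then have "int p dvd Legendre (- 3) (int p) - 1" by (simp add: cong_iff_dvd_diff)
  moreover have "\<not> int p dvd - 1" "\<not> int p dvd - 2"
    using p3 zdvd_imp_le[of "int p" 1] zdvd_imp_le[of "int p" 2] by auto
  ultimately have "QuadRes (int p) (- 3)"
    by (auto simp: Legendre_def split: if_splits)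
  then obtain y where y: "int p dvd y\<^sup>2 + 3" by (auto simp: QuadRes_def cong_iff_dvd_diff)
  \<comment> \<open>An odd root y' = 2 r + 1 is wanted, since then y'^2 + 3 = 4 (r^2 + r +
    1).\<close>
  obtain y' where y': "odd y'" "int p dvd y'\<^sup>2 + 3"
  proof (cases "odd y")
    case True then show ?thesis using y that by blast
  next
    case False
    have "odd p" using p p3 by (simp add: prime_odd_nat)
    have "(y + int p)\<^sup>2 + 3 = (y\<^sup>2 + 3) + int p * (2 * y + int p)" by (simp add: power2_eq_square algebra_simps)
    then have "int p dvd (y + int p)\<^sup>2 + 3" using y by (metis dvd_add dvd_triv_left)
    then show ?thesis using that[of "y + int p"] False \<open>odd p\<close> by simp
  qed
  then obtain r where r: "y' = 2 * r + 1" by (elim oddE)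
  have "int p dvd 4 * (r\<^sup>2 + r + 1)" using y'(2) unfolding r by (simp add: power2_eq_square algebra_simps)
  moreover have "\<not> int p dvd 4"
  proof
    assume "int p dvd 4"
    then have "int p dvd 2 ^ 2" by simp
    moreover have "prime (int p)" using p(1) by simp
    ultimately have "int p dvd 2" by (rule prime_dvd_power[rotated])
    then show False using p3 zdvd_imp_le[of "int p" 2] by auto
  qed
  ultimately have "int p dvd r\<^sup>2 + r + 1"
    using p(1) by (simp only: prime_dvd_mult_iff prime_nat_int_transfer simp_thms)
  then show ?thesis by (rule that)
qed

text \<open>Thue's pigeonhole argument, applied to a primitive cube root of unity modulo \<open>p\<close>.\<close>

lemma split_prime_norm_form:
  assumes p: "prime p" "p mod 3 = 1"
  obtains a b :: int where "a\<^sup>2 - a * b + b\<^sup>2 = int p"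
proof -
  obtain r :: int where r: "int p dvd r\<^sup>2 + r + 1" using split_prime_root[OF p] .
  define t where "t = nat \<lfloor>sqrt p\<rfloor>"
  have t0: "real t \<le> sqrt p" "sqrt p < real t + 1"
    unfolding t_def by (simp_all add: of_nat_nat of_int_floor_le)
  have "(real t)\<^sup>2 \<le> (sqrt p)\<^sup>2" using t0 by (intro power_mono) auto
  then have "real (t\<^sup>2) \<le> real p" by simp
  then have t1: "t\<^sup>2 \<le> p" by (simp only: of_nat_le_iff)
  have "(sqrt p)\<^sup>2 < (real t + 1)\<^sup>2" using t0 by (intro power_strict_mono) auto
  then have "real p < real ((t + 1)\<^sup>2)" by (simp add: add.commute)
  then have t2: "p < (t + 1)\<^sup>2" by (simp only: of_nat_less_iff)
  have "t\<^sup>2 \<noteq> p"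
  proof
    assume tp: "t\<^sup>2 = p"
    then have "t dvd p" by (auto simp: power2_eq_square)
    then have "t = 1 \<or> t = p" using p(1) by (simp add: prime_nat_iff)
    then have "p = 1" using tp p prime_gt_0_nat[of p] by (auto simp: power2_eq_square)
    then show False using p(1) by simp
  qed
  with t1 have t1: "t\<^sup>2 < p" by simp
  \<comment> \<open>There are (t + 1)^2 > p pairs, so two of them collide modulo p; their difference
    (a, b) is short and satisfies a + r b = 0 mod p.\<close>
  define f where "f = (\<lambda>(x, y). (int x + r * int y) mod int p)"
  have "f ` ({..t} \<times> {..t}) \<subseteq> {0..<int p}" using p prime_gt_0_nat[of p] by (auto simp: f_def)
  then have "card (f ` ({..t} \<times> {..t})) \<le> card {0..<int p}" by (intro card_mono) auto
  also have "\<dots> < card ({..t} \<times> {..t})" using t2 by (simp add: card_cartesian_product power2_eq_square)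
  finally have "\<not> inj_on f ({..t} \<times> {..t})" using pigeonhole by blast
  then obtain x1 y1 x2 y2 where xy: "x1 \<le> t" "y1 \<le> t" "x2 \<le> t" "y2 \<le> t" "(x1, y1) \<noteq> (x2, y2)" "f (x1, y1) = f (x2, y2)"
    unfolding inj_on_def by auto
  define a b where "a = int x1 - int x2" and "b = int y1 - int y2"
  have ab0: "a \<noteq> 0 \<or> b \<noteq> 0" using xy by (auto simp: a_def b_def)
  have abt: "\<bar>a\<bar> \<le> int t" "\<bar>b\<bar> \<le> int t" using xy by (auto simp: a_def b_def)
  have "int p dvd (int x1 + r * int y1) - (int x2 + r * int y2)"
    using xy(6) by (simp add: f_def mod_eq_dvd_iff)
  then have pab: "int p dvd a + r * b" by (simp add: a_def b_def algebra_simps)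
  define M where "M = a\<^sup>2 - a * b + b\<^sup>2"
  have "M = (a + r * b) * (a - (r + 1) * b) + b\<^sup>2 * (r\<^sup>2 + r + 1)"
    by (simp add: M_def power2_eq_square algebra_simps)
  then have "int p dvd M" using pab r by simp
  then obtain k where k: "M = int p * k" by (auto simp: dvd_def)
  have M4: "4 * M = (2 * a - b)\<^sup>2 + 3 * b\<^sup>2" by (simp add: M_def power2_eq_square algebra_simps)
  have Mpos: "M > 0"
  proof (cases "b = 0")
    case True then show ?thesis using ab0 by (simp add: M_def)
  next
    case False then have "b\<^sup>2 > 0" by simp
    then show ?thesis using M4 zero_le_power2[of "2 * a - b"] by linarith
  qed
  have a2: "a\<^sup>2 \<le> (int t)\<^sup>2" "b\<^sup>2 \<le> (int t)\<^sup>2"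
    using abt abs_le_square_iff[of a "int t"] abs_le_square_iff[of b "int t"] by simp_all
  \<comment> \<open>The bound M < 3 p leaves M = p or M = 2 p, and the latter fails because an even
    norm has even coordinates and is divisible by 4.\<close>
  have "2 * M = 3 * a\<^sup>2 + 3 * b\<^sup>2 - (a + b)\<^sup>2" by (simp add: M_def power2_eq_square algebra_simps)
  then have "2 * M \<le> 6 * (int t)\<^sup>2" using a2 zero_le_power2[of "a + b"] by linarith
  also have "(int t)\<^sup>2 < int p" using t1 by (metis of_nat_less_iff of_nat_power)
  finally have "M < 3 * int p" by simp
  then have k3: "k < 3" "k > 0" using Mpos p prime_gt_0_nat[of p] unfolding k by (auto simp: zero_less_mult_iff)
  have "k \<noteq> 2"
  proof
    assume k2: "k = 2"
    then have "even M" by (simp add: k)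
    then have "even a" "even b" by (auto simp: M_def)
    then obtain a' b' where "a = 2 * a'" "b = 2 * b'" by (auto simp: dvd_def)
    then have "M = 4 * (a'\<^sup>2 - a' * b' + b'\<^sup>2)" by (simp add: M_def power2_eq_square)
    then have "int p = 2 * (a'\<^sup>2 - a' * b' + b'\<^sup>2)" using k k2 by simp
    then have "even (int p)" by (metis dvd_triv_left)
    then have "p = 2" using primes_dvd_imp_eq[of 2 p] p(1) by simp
    then show False using p(2) by simp
  qed
  then have "M = int p" using k3 k by simp
  then show ?thesis using that by (simp add: M_def)
qed

lemma split_prime_factor:
  assumes p: "prime p" "p mod 3 = 1"
  obtains q where "prime_elem q" "of_nat p = q * eis_cnj q" "3 dvd q - 2"
proof -
  obtain a b :: int where ab: "a\<^sup>2 - a * b + b\<^sup>2 = int p" using split_prime_norm_form[OF p] .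
  have "\<exists>a' b' :: int. a'\<^sup>2 - a' * b' + b'\<^sup>2 = int p \<and> 3 dvd b' \<and> 3 dvd a' - 2"
  proof -
    have s: "(a + b)\<^sup>2 = int p + 3 * (a * b)" by (simp add: power2_eq_square algebra_simps flip: ab)
    have n3: "\<not> 3 dvd a + b"
    proof
      assume "3 dvd a + b"
      then have "3 dvd (a + b)\<^sup>2" by (simp add: power2_eq_square)
      then show False unfolding s using p(2) by presburger
    qed
    \<comment> \<open>These are the other five associates of a + b \<open>omega\<close>, under the
      units -1, \<open>omega\<close> and their products. As 3 does not divide the norm, one of the
      six is congruent to 2 modulo 3.\<close>
    have E: "(- a)\<^sup>2 - (- a) * (- b) + (- b)\<^sup>2 = int p" "(b - a)\<^sup>2 - (b - a) * (- a) + (- a)\<^sup>2 = int p"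
      "(a - b)\<^sup>2 - (a - b) * a + a\<^sup>2 = int p" "(- b)\<^sup>2 - (- b) * (a - b) + (a - b)\<^sup>2 = int p"
      "b\<^sup>2 - b * (b - a) + (b - a)\<^sup>2 = int p"
      using ab by (simp_all add: power2_eq_square algebra_simps)
    have "3 dvd b \<and> 3 dvd a - 2 \<or> 3 dvd - b \<and> 3 dvd - a - 2 \<or> 3 dvd - a \<and> 3 dvd (b - a) - 2
      \<or> 3 dvd a \<and> 3 dvd (a - b) - 2 \<or> 3 dvd a - b \<and> 3 dvd - b - 2 \<or> 3 dvd b - a \<and> 3 dvd b - 2"
      using n3 by presburger
    then show ?thesis using ab E by blast
  qed
  then obtain a' b' :: int where ab': "a'\<^sup>2 - a' * b' + b'\<^sup>2 = int p" "3 dvd b'" "3 dvd a' - 2" by blast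
  define q where "q = of_int a' + of_int b' * omega"
  have N: "eis_norm q = int p" using ab' by (simp add: q_def eis_norm_coords)
  have "3 dvd q - 2" using of_int_dvd_coords_iff[of 3 "a' - 2" b'] ab' by (simp add: q_def algebra_simps)
  moreover have "of_nat p = q * eis_cnj q" using eis_mult_cnj[of q] N by simp
  ultimately show ?thesis using that prime_elem_eis_norm_prime[OF p(1) N] by blast
qed

text \<open>The choice in \<open>cubic_symbol\<close> is realized by
  \<open>split_prime_factor\<close>; since the symbol is a power of \<open>omega\<close>, neither
  character vanishes, so neither factor divides x.\<close>

lemma cubic_symbol_split:
  assumes p: "prime p" "p mod 3 = 1"
    and sym: "cubic_symbol x p = omega ^ j"
  shows "of_nat p dvd x ^ ((p - 1) div 3) - omega ^ j * eis_cnj x ^ ((p - 1) div 3)"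
proof -
  define q where "q = (SOME q. prime_elem q \<and> of_nat p = q * eis_cnj q \<and> 3 dvd q - 2)"
  have q: "prime_elem q \<and> of_nat p = q * eis_cnj q \<and> 3 dvd q - 2"
    unfolding q_def by (rule someI_ex) (use split_prime_factor[OF p] in blast)
  have s: "cubic_char x q * cubic_char x (eis_cnj q) = omega ^ j"
    using sym p(2) by (simp add: cubic_symbol_def Let_def q_def)
  have "cubic_char x q \<noteq> 0" "cubic_char x (eis_cnj q) \<noteq> 0"
    using s omega_power_nonzero[of j] by auto
  then have "\<not> q dvd x" "\<not> eis_cnj q dvd x" by (auto simp: cubic_char_def)
  then show ?thesis using cubic_symbol_split_aux[OF p, of q x] q unfolding s by blast
qed

section \<open>Congruences modulo p in the localization of the Eisenstein integers\<close>

text \<open>Frees the closure properties from lowest terms: any fraction with denominator prime to p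
  will do.\<close>

lemma D_iff: "x \<in> D p \<longleftrightarrow> (\<exists>a b. \<not> int p dvd b \<and> x = of_int a / of_int b)"
proof
  assume x: "x \<in> D p"
  obtain a b where ab: "quotient_of x = (a, b)" by (cases "quotient_of x")
  then have "x = of_int a / of_int b" by (rule quotient_of_div)
  with x ab show "\<exists>a b. \<not> int p dvd b \<and> x = of_int a / of_int b" by (auto simp: D_def)
next
  assume "\<exists>a b. \<not> int p dvd b \<and> x = of_int a / of_int b"
  then obtain a b where ab: "\<not> int p dvd b" "x = of_int a / of_int b" by blast
  obtain a' b' where q: "quotient_of x = (a', b')" by (cases "quotient_of x")
  have x: "x = of_int a' / of_int b'" and b': "b' > 0" and c: "coprime a' b'"
    using q quotient_of_div quotient_of_denom_pos quotient_of_coprime by blast+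
  have "b \<noteq> 0" using ab(1) by auto
  then have "(of_int (a * b') :: rat) = of_int (a' * b)" using x ab(2) b' by (simp add: field_simps)
  then have "a * b' = a' * b" by (simp only: of_int_eq_iff)
  then have "b' dvd a' * b" by (metis dvd_triv_right)
  then have "b' dvd b" using c by (simp add: coprime_commute coprime_dvd_mult_right_iff)
  then have "\<not> int p dvd b'" using ab(1) dvd_trans by blast
  then show "x \<in> D p" using q by (simp add: D_def)
qed

lemma of_int_in_D:
  assumes "prime p" shows "of_int a \<in> D p"
  unfolding D_iff by (rule exI[of _ a], rule exI[of _ 1]) (use assms prime_gt_1_nat[of p] in auto)

lemma D_add:
  assumes "prime p" "x \<in> D p" "y \<in> D p" shows "x + y \<in> D p"
proof -
  obtain a b a' b' where "\<not> int p dvd b" "x = of_int a / of_int b" "\<not> int p dvd b'" "y = of_int a' / of_int b'"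
    using assms unfolding D_iff by blast
  moreover from this have "b \<noteq> 0" "b' \<noteq> 0" by auto
  ultimately have "\<not> int p dvd b * b'" "x + y = of_int (a * b' + a' * b) / of_int (b * b')"
    using assms(1) by (auto simp: prime_dvd_mult_iff field_simps)
  then show ?thesis unfolding D_iff by blast
qed

lemma D_mult:
  assumes "prime p" "x \<in> D p" "y \<in> D p" shows "x * y \<in> D p"
proof -
  obtain a b a' b' where "\<not> int p dvd b" "x = of_int a / of_int b" "\<not> int p dvd b'" "y = of_int a' / of_int b'"
    using assms unfolding D_iff by blast
  then have "\<not> int p dvd b * b'" "x * y = of_int (a * a') / of_int (b * b')"
    using assms(1) by (auto simp: prime_dvd_mult_iff field_simps)
  then show ?thesis unfolding D_iff by blast
qed

lemma D_uminus:
  assumes "prime p" "x \<in> D p" shows "- x \<in> D p"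
  using D_mult[OF assms(1) of_int_in_D[OF assms(1), of "- 1"] assms(2)] by simp

lemma D_inverse:
  assumes p: "prime p" "x \<in> D p" "\<not> rat_cong p x 0" shows "inverse x \<in> D p"
proof -
  obtain a b where ab: "\<not> int p dvd b" "x = of_int a / of_int b" using p(2) unfolding D_iff by blast
  have "\<not> int p dvd a"
  proof
    assume "int p dvd a"
    then obtain a' where "a = int p * a'" by (auto simp: dvd_def)
    then have "x - 0 = of_nat p * (of_int a' / of_int b)" using ab(2) by simp
    moreover have "of_int a' / of_int b \<in> D p" using ab(1) unfolding D_iff by blast
    ultimately show False using p(3) unfolding rat_cong_def by blast
  qed
  moreover have "inverse x = of_int b / of_int a" by (simp add: ab(2))
  ultimately show ?thesis unfolding D_iff by blast
qed

definition local_eis :: "nat \<Rightarrow> complex set" where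
  "local_eis p = {of_rat a + of_rat b * complex_omega | a b. a \<in> D p \<and> b \<in> D p}"

locale eis_localization =
  fixes p :: nat
  assumes prime_p: "prime p" and p_gt_3: "p > 3"
begin

abbreviation "R \<equiv> local_eis p"

text \<open>Neither side is required to lie in \<open>R\<close>, only the difference is constrained.
  Sums and transitivity therefore need no side conditions; membership enters with products.\<close>

definition econg :: "complex \<Rightarrow> complex \<Rightarrow> bool" (infix "\<approx>" 50) where
  "x \<approx> y \<longleftrightarrow> (\<exists>z\<in>R. x - y = of_nat p * z)"

lemma R_of_rat: "a \<in> D p \<Longrightarrow> of_rat a \<in> R"
  unfolding local_eis_def using of_int_in_D[OF prime_p, of 0] by force

lemma R_of_int [simp, intro]: "of_int a \<in> R"
  using R_of_rat[OF of_int_in_D[OF prime_p, of a]] by simp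

lemma R_of_nat [simp, intro]: "of_nat a \<in> R" using R_of_int[of "int a"] by simp
lemma R_numeral [simp, intro]: "numeral a \<in> R" using R_of_int[of "numeral a"] by simp
lemma R_0 [simp, intro]: "0 \<in> R" using R_of_int[of 0] by simp
lemma R_1 [simp, intro]: "1 \<in> R" using R_of_int[of 1] by simp

lemma R_minus_1 [simp, intro]: "- 1 \<in> R" using R_of_int[of "- 1"] by simp
lemma R_minus_numeral [simp, intro]: "- numeral a \<in> R" using R_of_int[of "- numeral a"] by simp

lemma R_omega [simp, intro]: "complex_omega \<in> R"
  unfolding local_eis_def using of_int_in_D[OF prime_p, of 0] of_int_in_D[OF prime_p, of 1] by force

lemma R_add [intro]:
  assumes "x \<in> R" "y \<in> R" shows "x + y \<in> R"
proof -
  obtain a b a' b' where *: "x = of_rat a + of_rat b * complex_omega" "a \<in> D p" "b \<in> D p"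
    "y = of_rat a' + of_rat b' * complex_omega" "a' \<in> D p" "b' \<in> D p"
    using assms by (auto simp: local_eis_def)
  then have "x + y = of_rat (a + a') + of_rat (b + b') * complex_omega"
    by (simp add: of_rat_add algebra_simps)
  then show ?thesis unfolding local_eis_def using * D_add[OF prime_p] by blast
qed

lemma R_mult [intro]:
  assumes "x \<in> R" "y \<in> R" shows "x * y \<in> R"
proof -
  obtain a b a' b' where *: "x = of_rat a + of_rat b * complex_omega" "a \<in> D p" "b \<in> D p"
    "y = of_rat a' + of_rat b' * complex_omega" "a' \<in> D p" "b' \<in> D p"
    using assms by (auto simp: local_eis_def)
  have "x * y = of_rat (a * a') + of_rat (a * b' + b * a') * complex_omega
      + of_rat (b * b') * (complex_omega * complex_omega)"
    unfolding * by (simp add: of_rat_add of_rat_mult algebra_simps)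
  also have "\<dots> = of_rat (a * a' + - (b * b')) + of_rat (a * b' + b * a' + - (b * b')) * complex_omega"
    unfolding complex_omega_square by (simp add: of_rat_add of_rat_mult of_rat_diff algebra_simps)
  finally have e: "x * y = of_rat (a * a' + - (b * b'))
      + of_rat (a * b' + b * a' + - (b * b')) * complex_omega" .
  have "a * a' + - (b * b') \<in> D p"
    by (intro D_add[OF prime_p] D_mult[OF prime_p] D_uminus[OF prime_p] *)
  moreover have "a * b' + b * a' + - (b * b') \<in> D p"
    by (intro D_add[OF prime_p] D_mult[OF prime_p] D_uminus[OF prime_p] *)
  ultimately show ?thesis using e unfolding local_eis_def by blast
qed

lemma R_uminus [intro]: "x \<in> R \<Longrightarrow> - x \<in> R"
  using R_mult[OF R_of_int[of "- 1"]] by simp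

lemma R_diff [intro]: "x \<in> R \<Longrightarrow> y \<in> R \<Longrightarrow> x - y \<in> R"
  using R_add[OF _ R_uminus] by (metis diff_conv_add_uminus)

lemma R_power [intro]: "x \<in> R \<Longrightarrow> x ^ n \<in> R"
  by (induction n) auto

lemma R_divide [intro]: "x \<in> R \<Longrightarrow> inverse y \<in> R \<Longrightarrow> x / y \<in> R"
  by (simp add: divide_inverse R_mult)

lemma R_inverse_mult [intro]: "inverse x \<in> R \<Longrightarrow> inverse y \<in> R \<Longrightarrow> inverse (x * y) \<in> R"
  by (simp add: R_mult)

lemma R_inverse_power [intro]: "inverse x \<in> R \<Longrightarrow> inverse (x ^ n) \<in> R"
  using R_power[of "inverse x" n] by (simp add: power_inverse)

lemma R_complex_of_eisenstein [simp, intro]: "complex_of_eisenstein x \<in> R"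
proof -
  obtain a b :: int where "x = of_int a + of_int b * omega" by (rule eis_coords)
  then show ?thesis by (auto simp: eis_rep)
qed

lemmas R_rules = R_add R_diff R_mult R_uminus R_power R_divide R_inverse_mult R_inverse_power
  R_numeral R_1 R_0 R_of_nat R_of_int R_minus_1 R_minus_numeral R_omega

lemma econg_refl [simp, intro]: "x \<approx> x"
  unfolding econg_def by (auto intro!: bexI[of _ 0])

lemma econgI: "x - y = of_nat p * z \<Longrightarrow> z \<in> R \<Longrightarrow> x \<approx> y"
  unfolding econg_def by blast

lemma econg_sym: "x \<approx> y \<Longrightarrow> y \<approx> x"
  unfolding econg_def by (metis R_uminus minus_diff_eq mult_minus_right)

lemma econg_trans [trans]:
  assumes "x \<approx> y" "y \<approx> z" shows "x \<approx> z"
proof -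
  obtain u w where "u \<in> R" "x - y = of_nat p * u" "w \<in> R" "y - z = of_nat p * w"
    using assms unfolding econg_def by blast
  then show ?thesis by (intro econgI[of _ _ "u + w"]) (auto simp: algebra_simps)
qed

lemma econg_add:
  assumes "x \<approx> x'" "y \<approx> y'" shows "x + y \<approx> x' + y'"
proof -
  obtain u w where "u \<in> R" "x - x' = of_nat p * u" "w \<in> R" "y - y' = of_nat p * w"
    using assms unfolding econg_def by blast
  then show ?thesis by (intro econgI[of _ _ "u + w"]) (auto simp: algebra_simps)
qed

lemma econg_mult_left:
  assumes "y \<approx> y'" "x \<in> R" shows "x * y \<approx> x * y'"
proof -
  obtain w where "w \<in> R" "y - y' = of_nat p * w"
    using assms unfolding econg_def by blast
  then show ?thesis using assms by (intro econgI[of _ _ "x * w"]) (auto simp flip: right_diff_distrib)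
qed

lemma econg_mult_right: "y \<approx> y' \<Longrightarrow> x \<in> R \<Longrightarrow> y * x \<approx> y' * x"
  by (metis econg_mult_left mult.commute)

lemma econg_uminus: "x \<approx> y \<Longrightarrow> - x \<approx> - y"
  using econg_mult_left[of x y "- 1"] R_of_int[of "- 1"] by simp

lemma econg_diff: "x \<approx> x' \<Longrightarrow> y \<approx> y' \<Longrightarrow> x - y \<approx> x' - y'"
  using econg_add[of x x' "- y" "- y'"] econg_uminus by simp

lemma econg_in_R: "x \<approx> y \<Longrightarrow> y \<in> R \<Longrightarrow> x \<in> R"
  unfolding econg_def by (metis R_add R_mult R_of_nat diff_add_cancel)

lemma econg_mult:
  assumes "x \<approx> x'" "y \<approx> y'" "x' \<in> R" "y' \<in> R" shows "x * y \<approx> x' * y'"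
  using econg_mult_left[OF assms(2) econg_in_R[OF assms(1,3)]] econg_mult_right[OF assms(1,4)]
  by (rule econg_trans)

lemma econg_power: "x \<approx> y \<Longrightarrow> y \<in> R \<Longrightarrow> x ^ n \<approx> y ^ n"
  by (induction n) (auto intro: econg_mult)

lemma econg_sum: "(\<And>i. i \<in> I \<Longrightarrow> f i \<approx> g i) \<Longrightarrow> sum f I \<approx> sum g I"
  by (induction I rule: infinite_finite_induct) (auto intro: econg_add)

lemma econg_divide: "x \<approx> y \<Longrightarrow> inverse d \<in> R \<Longrightarrow> x / d \<approx> y / d"
  by (simp add: divide_inverse econg_mult_right)

lemma econg_cancel: "d * x \<approx> d * y \<Longrightarrow> inverse d \<in> R \<Longrightarrow> d \<noteq> 0 \<Longrightarrow> x \<approx> y"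
  using econg_mult_left[of "d * x" "d * y" "inverse d"] by (simp flip: mult.assoc)

lemma econg_of_int: "int p dvd a - b \<Longrightarrow> of_int a \<approx> of_int b"
proof -
  assume "int p dvd a - b"
  then obtain k where "a - b = int p * k" by (auto simp: dvd_def)
  then have "(of_int (a - b) :: complex) = of_int (int p * k)" by simp
  then show ?thesis by (intro econgI[of _ _ "of_int k"]) simp_all
qed

lemma econg_eisenstein:
  assumes "of_nat p dvd x - y" shows "complex_of_eisenstein x \<approx> complex_of_eisenstein y"
proof -
  obtain k where "x - y = of_nat p * k" using assms by (auto simp: dvd_def)
  then have "complex_of_eisenstein (x - y) = complex_of_eisenstein (of_nat p * k)" by simp
  then show ?thesis by (intro econgI[of _ _ "complex_of_eisenstein k"]) (simp_all add: eis_rep)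
qed

text \<open>The way back to the rationals: comparing imaginary parts removes the
  \<open>omega\<close> coordinate of the cofactor, so no congruences between rationals are gained in
  the larger ring.\<close>

lemma econg_of_rat_iff: "of_rat x \<approx> of_rat y \<longleftrightarrow> rat_cong p x y"
proof
  assume "rat_cong p x y"
  then obtain z where "z \<in> D p" "x - y = of_nat p * z" unfolding rat_cong_def by blast
  then show "of_rat x \<approx> of_rat y"
    by (intro econgI[of _ _ "of_rat z"]) (auto intro: R_of_rat simp flip: of_rat_diff simp: of_rat_mult)
next
  assume "of_rat x \<approx> of_rat y"
  then obtain a b where a: "a \<in> D p" "b \<in> D p"
    and e: "(of_rat x - of_rat y :: complex) = of_nat p * (of_rat a + of_rat b * complex_omega)"
    unfolding econg_def local_eis_def by blast
  have re: "of_rat q = complex_of_real (of_rat q)" for q :: rat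
    by (cases q) (simp add: of_rat_rat)
  have p0: "real p \<noteq> 0" using p_gt_3 by simp
  from e have "complex_of_real (of_rat x) - complex_of_real (of_rat y)
     = of_nat p * (complex_of_real (of_rat a) + complex_of_real (of_rat b) * complex_omega)"
    unfolding re .
  then have i: "real p * (of_rat b * (sqrt 3 / 2)) = 0"
    and r: "of_rat x - of_rat y = real p * (of_rat a - of_rat b / 2 :: real)"
    by (simp_all add: complex_eq_iff)
  from i p0 have "b = 0" by simp
  with r have "(of_rat (x - y) :: real) = of_rat (of_nat p * a)"
    by (simp add: of_rat_diff of_rat_mult)
  then have "x - y = of_nat p * a" by (simp only: of_rat_eq_iff)
  with a show "rat_cong p x y" unfolding rat_cong_def by blast
qed

lemma R_inverse_of_int: "\<not> int p dvd d \<Longrightarrow> inverse (of_int d) \<in> R"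
proof -
  assume "\<not> int p dvd d"
  then have "of_int 1 / of_int d \<in> D p" unfolding D_iff by blast
  then have "of_rat (of_int 1 / of_int d) \<in> R" by (rule R_of_rat)
  then show ?thesis by (simp add: of_rat_divide inverse_eq_divide)
qed

lemma R_inverse_of_nat: "0 < d \<Longrightarrow> d < p \<Longrightarrow> inverse (of_nat d) \<in> R"
  using R_inverse_of_int[of "int d"] by (auto dest: nat_dvd_not_less)

lemma R_inverse_2 [simp]: "inverse 2 \<in> R" using R_inverse_of_nat[of 2] p_gt_3 by simp
lemma R_inverse_3 [simp]: "inverse 3 \<in> R" using R_inverse_of_nat[of 3] p_gt_3 by simp

lemma R_inverse_of_rat: "x \<in> D p \<Longrightarrow> \<not> rat_cong p x 0 \<Longrightarrow> inverse (of_rat x) \<in> R"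
  using R_of_rat[OF D_inverse[OF prime_p]] by (simp add: of_rat_inverse)

end

section \<open>The numbers S modulo p\<close>

lemma S_fact: "S n = fact (6 * n) * fact n / (2 * fact (3 * n) * fact (2 * n) * fact (2 * n + 1))"
proof -
  have "(of_nat (6 * n choose (3 * n)) :: rat) = fact (6 * n) / (fact (3 * n) * fact (3 * n))"
    "(of_nat (3 * n choose n) :: rat) = fact (3 * n) / (fact n * fact (2 * n))"
    "(of_nat (2 * n choose n) :: rat) = fact (2 * n) / (fact n * fact n)"
    using binomial_fact[of "3 * n" "6 * n", where 'a = rat] binomial_fact[of n "3 * n", where 'a = rat]
      binomial_fact[of n "2 * n", where 'a = rat] by (simp_all add: mult_2 flip: mult_2_right)
  moreover have "(fact (2 * n + 1) :: rat) = of_nat (2 * n + 1) * fact (2 * n)" by simp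
  moreover have "(x6 / (x3 * x3)) * (x3 / (x1 * x2)) / (2 * (x2 / (x1 * x1)) * d)
      = x6 * x1 / (2 * x3 * x2 * (d * x2))" if "x3 \<noteq> 0" "x2 \<noteq> 0" "x1 \<noteq> 0" for x1 x2 x3 x6 d :: rat
    using that by (simp add: divide_simps)
  ultimately show ?thesis unfolding S_def of_nat_mult[of "_ choose _"] by (simp only: fact_nonzero simp_thms)
qed

text \<open>The hypergeometric ratio against which both binomial expressions modulo p are
  checked.\<close>

lemma S_Suc: "S (Suc k) * (of_nat (k + 1) * of_nat (2 * k + 3))
    = 6 * of_nat (6 * k + 5) * of_nat (6 * k + 1) * S k"
proof -
  define a :: rat where "a = of_nat k"
  have k0: "a \<ge> 0" by (simp add: a_def)
  have 6: "fact (6 * Suc k) = (6 * a + 6) * (6 * a + 5) * (6 * a + 4) * (6 * a + 3) * (6 * a + 2) * (6 * a + 1) * (fact (6 * k) :: rat)"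
  proof -
    have "6 * Suc k = Suc (Suc (Suc (Suc (Suc (Suc (6 * k))))))" by simp
    then show ?thesis unfolding a_def by (simp only: fact_Suc) (simp add: algebra_simps)
  qed
  have 3: "fact (3 * Suc k) = (3 * a + 3) * (3 * a + 2) * (3 * a + 1) * (fact (3 * k) :: rat)"
  proof -
    have "3 * Suc k = Suc (Suc (Suc (3 * k)))" by simp
    then show ?thesis unfolding a_def by (simp only: fact_Suc) (simp add: algebra_simps)
  qed
  have 2: "fact (2 * Suc k) = (2 * a + 2) * (2 * a + 1) * (fact (2 * k) :: rat)"
  proof -
    have "2 * Suc k = Suc (Suc (2 * k))" by simp
    then show ?thesis unfolding a_def by (simp only: fact_Suc) (simp add: algebra_simps)
  qed
  have 21: "fact (2 * Suc k + 1) = (2 * a + 3) * (2 * a + 2) * (fact (2 * k + 1) :: rat)"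
  proof -
    have "2 * Suc k + 1 = Suc (Suc (2 * k + 1))" by simp
    then show ?thesis unfolding a_def by (simp only: fact_Suc) (simp add: algebra_simps)
  qed
  have 1: "fact (Suc k) = (a + 1) * (fact k :: rat)" by (simp add: a_def)
  define F :: rat where "F = fact (3 * k) * fact (2 * k) * fact (2 * k + 1)"
  define G :: rat where "G = fact (6 * k) * fact k"
  have F0: "F \<noteq> 0" by (simp add: F_def)
  have SS: "S (Suc k) = ((6 * a + 6) * (6 * a + 5) * (6 * a + 4) * (6 * a + 3) * (6 * a + 2) * (6 * a + 1) * (a + 1) * G)
    / (2 * ((3 * a + 3) * (3 * a + 2) * (3 * a + 1) * (2 * a + 2) * (2 * a + 1) * (2 * a + 3) * (2 * a + 2)) * F)"
    unfolding S_fact 6 3 2 21 1 F_def G_def by (simp only: mult_ac)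
  have S: "S k = G / (2 * F)" unfolding S_fact F_def G_def by (simp only: mult_ac)
  have e: "(6 * a + 6) = 2 * (3 * a + 3)" "(6 * a + 4) = 2 * (3 * a + 2)" "(6 * a + 2) = 2 * (3 * a + 1)"
    "6 * a + 3 = 3 * (2 * a + 1)" "2 * a + 2 = 2 * (a + 1)" by simp_all
  have nz: "3 * a + 3 \<noteq> 0" "3 * a + 2 \<noteq> 0" "3 * a + 1 \<noteq> 0" "2 * a + 1 \<noteq> 0" "a + 1 \<noteq> 0" "2 * a + 3 \<noteq> 0"
    using k0 by linarith+
  have nat: "(of_nat (k + 1) :: rat) = a + 1" "(of_nat (2 * k + 3) :: rat) = 2 * a + 3"
    "(of_nat (6 * k + 5) :: rat) = 6 * a + 5" "(of_nat (6 * k + 1) :: rat) = 6 * a + 1"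
    by (simp_all add: a_def)
  have gen: "(2 * x3 * A5 * (2 * x2) * (3 * y) * (2 * x1) * A1 * z * G)
      / (2 * (x3 * x2 * x1 * (2 * z) * y * w * (2 * z)) * F) * (z * w) = 6 * A5 * A1 * (G / (2 * F))"
    if "x3 \<noteq> 0" "x2 \<noteq> 0" "x1 \<noteq> 0" "y \<noteq> 0" "z \<noteq> 0" "w \<noteq> 0" for x1 x2 x3 y z w A1 A5 :: rat
    using that F0 by (simp add: divide_simps)
  show ?thesis unfolding SS S nat e by (rule gen) (use nz in auto)
qed

text \<open>The ratio has zeros at k = n and k = -n - 1. Stating it for all k, including the
  vanishing coefficients, lets the inductions run past the point where the series
  terminates.\<close>

lemma choose_step:
  fixes n k :: nat
  shows "of_nat ((n + Suc k) choose (2 * Suc k)) * ((2 * of_nat k + 2) * (2 * of_nat k + 1))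
    = (of_nat ((n + k) choose (2 * k)) * ((of_nat n + of_nat k + 1) * (of_nat n - of_nat k)) :: 'a :: field_char_0)"
proof (cases "k < n")
  case True
  define m where "m = n + k - 2 * k"
  have m: "m = n - k" using True by (simp add: m_def)
  have "of_nat ((n + k) choose (2 * k)) = (fact (n + k) / (fact (2 * k) * fact (n - k)) :: 'a)"
    using binomial_fact[of "2 * k" "n + k", where 'a = 'a] True by (simp add: m)
  moreover have "of_nat ((n + Suc k) choose (2 * Suc k)) = (fact (Suc (n + k)) / (fact (Suc (Suc (2 * k))) * fact (n - Suc k)) :: 'a)"
    using binomial_fact[of "2 * Suc k" "n + Suc k", where 'a = 'a] True by (simp del: fact_Suc add: Suc_diff_Suc)
  moreover have "fact (n - k) = (of_nat n - of_nat k) * (fact (n - Suc k) :: 'a)"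
    using True by (simp add: Suc_diff_Suc[symmetric] of_nat_diff)
  moreover have "(fact (Suc (n + k)) :: 'a) = (of_nat n + of_nat k + 1) * fact (n + k)"
    by (simp add: algebra_simps)
  moreover have "(fact (Suc (Suc (2 * k))) :: 'a) = (2 * of_nat k + 2) * (2 * of_nat k + 1) * fact (2 * k)"
    by (simp add: algebra_simps)
  moreover have "(of_nat n - of_nat k :: 'a) \<noteq> 0" using True by simp
  moreover have "(2 * of_nat k + 2 :: 'a) \<noteq> 0" "(2 * of_nat k + 1 :: 'a) \<noteq> 0"
    using of_nat_neq_0[of "2 * k + 1", where 'a = 'a] of_nat_neq_0[of "2 * k", where 'a = 'a] by (simp_all add: algebra_simps)
  moreover have "(fact (n - Suc k) :: 'a) \<noteq> 0" "(fact (2 * k) :: 'a) \<noteq> 0" by simp_all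
  moreover have "A * B / (C * E * H * K) * (C * E) = B / (H * (L * K)) * (A * L)"
    if "L \<noteq> 0" "C \<noteq> 0" "E \<noteq> 0" "K \<noteq> 0" "H \<noteq> 0" for A B C E H K L :: 'a
    using that by (simp add: divide_simps)
  ultimately show ?thesis by (simp only:)
next
  case False
  then show ?thesis by (cases "k = n") (simp_all add: binomial_eq_0)
qed

lemma fact_add_prod: "fact (N + m) = (fact N * (\<Prod>i=1..m. of_nat (N + i)) :: 'a :: {semiring_char_0, comm_semiring_1})"
  by (induction m) (simp_all add: mult_ac add_ac)

context eis_localization
begin

definition h :: nat where "h = (p - 1) div 2"

lemma p_eq: "p = 2 * h + 1"
proof -
  have "odd p" using prime_p p_gt_3 by (simp add: prime_odd_nat)
  then show ?thesis unfolding h_def by presburger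
qed

lemma h_ge: "h \<ge> 2" using p_eq p_gt_3 by presburger

text \<open>Used to reduce factorials beyond p after the multiples of p have been split off.\<close>

lemma prod_shift_econg: "(\<Prod>i=1..m. of_nat (a * p + i)) \<approx> fact m"
proof (induction m)
  case (Suc m)
  have "of_nat (a * p + Suc m) \<approx> of_nat (Suc m)"
    by (rule econgI[of _ _ "of_nat a"]) simp_all
  then have "(\<Prod>i=1..m. of_nat (a * p + i)) * of_nat (a * p + Suc m) \<approx> fact m * of_nat (Suc m)"
    using R_of_nat[of "fact m"] R_of_nat[of "Suc m"] Suc by (intro econg_mult) simp_all
  then show ?case by (simp add: mult.commute add_ac)
qed simp

lemma R_inverse_prod_shift: "m < p \<Longrightarrow> inverse (\<Prod>i=1..m. of_nat (a * p + i)) \<in> R"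
proof (induction m)
  case (Suc m)
  have "\<not> p dvd a * p + Suc m" using Suc.prems by (auto dest: nat_dvd_not_less simp del: add_Suc_right)
  then have "inverse (of_nat (a * p + Suc m)) \<in> R"
    using R_inverse_of_int[of "int (a * p + Suc m)"] by (simp only: of_int_of_nat_eq int_dvd_int_iff not_False_eq_True simp_thms)
  then show ?case using Suc by (simp del: add_Suc_right inverse_mult_distrib add: R_inverse_mult)
qed simp

lemma wilson_econg: "fact (p - 1) \<approx> - 1"
proof -
  have "[fact (p - 1) = (- 1 :: int)] (mod int p)" using wilson_theorem[OF prime_p] by simp
  then have "of_int (fact (p - 1)) \<approx> of_int (- 1)" by (intro econg_of_int) (simp only: cong_iff_dvd_diff)
  then show ?thesis by simp
qed

text \<open>The term of index \<open>h = (p - 1) / 2\<close> cannot be reached by the recurrence, whose coefficient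
  \<open>2 k + 3\<close> equals \<open>p\<close> at the step before it.\<close>

lemma S_middle: "4 * of_rat (S h) \<approx> - 1"
proof -
  define F E K :: complex where "F = fact (p - 1)" and "E = fact (p - 3)" and "K = fact (h - 1)"
  define P1 P2 P3 :: complex where "P1 = (\<Prod>i=1..p - 1. of_nat (1 * p + i))"
    and "P2 = (\<Prod>i=1..p - 3. of_nat (2 * p + i))" and "P3 = (\<Prod>i=1..h - 1. of_nat (1 * p + i))"
  have P: "P1 \<approx> F" "P2 \<approx> E" "P3 \<approx> K"
    unfolding P1_def P2_def P3_def F_def E_def K_def by (rule prod_shift_econg)+
  have F1: "F \<approx> - 1" unfolding F_def by (rule wilson_econg)
  have mem: "F \<in> R" "E \<in> R" "K \<in> R"
    unfolding F_def E_def K_def using R_of_nat[of "fact _"] by simp_all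
  have P3i: "inverse P3 \<in> R" unfolding P3_def using p_eq by (intro R_inverse_prod_shift) simp
  have Ki: "inverse K \<in> R"
    using R_inverse_prod_shift[of "h - 1" 0] p_eq by (simp add: K_def fact_prod)
  have Fi: "inverse F \<in> R"
    using R_inverse_prod_shift[of "p - 1" 0] p_gt_3 by (simp add: F_def fact_prod)
  have nz: "F \<noteq> 0" "K \<noteq> 0" "P3 \<noteq> 0" using p_gt_3 by (auto simp: F_def K_def P3_def simp del: of_nat_add)
  \<comment> \<open>Since 6 h = 2 p + (p - 3), the numerator contains exactly the multiples p and 2
    p. They cancel against one p in (3 h)! and one in (2 h + 1)! = p!, so \<open>S h\<close> is
    integral at p.\<close>
  have f6: "fact (6 * h) = 2 * of_nat p * (of_nat p * F * P1) * P2"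
  proof -
    have "6 * h = 2 * p + (p - 3)" using p_eq h_ge by linarith
    then have "fact (6 * h) = fact (2 * p) * P2" unfolding P2_def by (metis fact_add_prod)
    moreover have "2 * p = Suc (p + (p - 1))" using p_gt_3 by simp
    then have "fact (2 * p) = (of_nat (2 * p) * fact (p + (p - 1)) :: complex)" by (metis fact_Suc)
    moreover have "fact (p + (p - 1)) = fact p * P1" unfolding P1_def by (simp add: fact_add_prod)
    moreover have "fact p = of_nat p * F" unfolding F_def using p_gt_3 by (metis fact_reduce less_trans zero_less_numeral)
    ultimately show ?thesis by simp
  qed
  have f3: "fact (3 * h) = of_nat p * F * P3"
  proof -
    have "3 * h = p + (h - 1)" using p_eq h_ge by linarith
    then have "fact (3 * h) = fact p * P3" unfolding P3_def by (metis fact_add_prod mult_1)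
    moreover have "fact p = of_nat p * F" unfolding F_def using p_gt_3 by (metis fact_reduce less_trans zero_less_numeral)
    ultimately show ?thesis by simp
  qed
  have f2: "fact (2 * h) = F" "fact (2 * h + 1) = of_nat p * F"
  proof -
    have "2 * h = p - 1" using p_eq by simp
    then show a: "fact (2 * h) = F" unfolding F_def by simp
    have "fact (Suc (2 * h)) = of_nat (Suc (2 * h)) * F" by (simp only: fact_Suc a)
    moreover have "Suc (2 * h) = p" using p_eq by (metis Suc_eq_plus1)
    ultimately show "fact (2 * h + 1) = of_nat p * F" by (simp only: Suc_eq_plus1[symmetric])
  qed
  have f1: "fact h = of_nat h * K" unfolding K_def using h_ge by (metis fact_reduce less_le_trans pos2)
  have "of_rat (S h) = fact (6 * h) * fact h / (2 * fact (3 * h) * fact (2 * h) * fact (2 * h + 1) :: complex)"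
  proof -
    have "of_rat (fact m) = (fact m :: complex)" for m by (metis of_nat_fact of_rat_of_nat_eq)
    then show ?thesis unfolding S_fact by (simp only: of_rat_divide of_rat_mult of_rat_numeral_eq)
  qed
  also have "\<dots> = P1 * P2 * (of_nat h * K) / (P3 * F * F)"
  proof -
    have "(2 * P * (P * F * P1) * P2) * H / (2 * (P * F * P3) * F * (P * F)) = P1 * P2 * H / (P3 * F * F)"
      if "P \<noteq> 0" "F \<noteq> 0" "P3 \<noteq> 0" for P F P1 P2 P3 H :: complex
      using that by (simp add: divide_simps)
    then show ?thesis unfolding f6 f3 f2 f1 using nz p_gt_3 by simp
  qed
  finally have S: "of_rat (S h) = P1 * P2 * (of_nat h * K) / (P3 * F * F)" .
  have SR: "of_rat (S h) \<in> R" unfolding S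
    by (intro R_divide R_mult R_inverse_mult R_of_nat P3i Fi mem econg_in_R[OF P(1)] econg_in_R[OF P(2)])
  have "K * of_rat (S h) \<approx> P3 * of_rat (S h)"
    by (rule econg_mult_right[OF econg_sym[OF P(3)] SR])
  also have "P3 * of_rat (S h) = (P3 * of_rat (S h)) * 1" by simp
  also have "(P3 * of_rat (S h)) * 1 \<approx> (P3 * of_rat (S h)) * (F * F)"
  proof (rule econg_mult_left)
    have "F * F \<approx> (- 1) * (- 1)" by (intro econg_mult F1 R_minus_1)
    then have "F * F \<approx> 1" by simp
    then show "1 \<approx> F * F" by (rule econg_sym)
    show "P3 * of_rat (S h) \<in> R" using SR econg_in_R[OF P(3) mem(3)] by blast
  qed
  also have "(P3 * of_rat (S h)) * (F * F) = P1 * P2 * (of_nat h * K)" unfolding S using nz by simp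
  also have "\<dots> \<approx> (- 1) * E * (of_nat h * K)"
    by (intro econg_mult_right econg_mult econg_trans[OF P(1) F1] P(2) R_mult R_of_nat R_minus_1 mem)
  also have "\<dots> = K * (- E * of_nat h)" by simp
  finally have SE: "of_rat (S h) \<approx> - E * of_nat h" using Ki nz(2) by (rule econg_cancel)
  \<comment> \<open>Wilson's theorem for (p - 1)! passes to (p - 3)! because (p - 1)(p - 2) = 2 mod
    p.\<close>
  have "2 * E \<approx> of_nat (p - 1) * of_nat (p - 2) * E"
  proof (rule econgI)
    have "of_nat (p - 1) = (of_nat p - 1 :: complex)" "of_nat (p - 2) = (of_nat p - 2 :: complex)"
      using p_gt_3 by (simp_all add: of_nat_diff)
    then show "2 * E - of_nat (p - 1) * of_nat (p - 2) * E = of_nat p * ((3 - of_nat p) * E)"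
      by (simp only:) (simp add: algebra_simps)
    show "(3 - of_nat p) * E \<in> R" using mem by auto
  qed
  also have "of_nat (p - 1) * of_nat (p - 2) * E = F"
  proof -
    have "p - 1 = Suc (Suc (p - 3))" "p - 2 = Suc (p - 3)" using p_gt_3 by simp_all
    then show ?thesis unfolding F_def E_def by (simp only: fact_Suc) (simp add: algebra_simps)
  qed
  also note F1
  finally have E2: "2 * E \<approx> - 1" .
  have "4 * of_rat (S h) \<approx> 4 * (- E * of_nat h)" using SE by (intro econg_mult_left) auto
  also have "4 * (- E * of_nat h) = - of_nat (2 * h) * (2 * E)" by simp
  also have "\<dots> \<approx> - of_nat (2 * h) * (- 1)" using E2 by (intro econg_mult_left) auto
  also have "- of_nat (2 * h) * (- 1) \<approx> - 1"
  proof (rule econgI[of _ _ 1])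
    have "of_nat p = (of_nat (2 * h + 1) :: complex)" using p_eq by metis
    then show "- of_nat (2 * h) * (- 1) - (- 1) = (of_nat p * 1 :: complex)" by simp
  qed simp
  finally show ?thesis .
qed

lemma S_Suc_complex: "of_rat (S (Suc k)) * ((of_nat k + 1) * (2 * of_nat k + 3))
    = 6 * (6 * of_nat k + 5) * (6 * of_nat k + 1) * (of_rat (S k) :: complex)"
  using arg_cong[OF S_Suc[of k], of "of_rat :: rat \<Rightarrow> complex"]
  by (simp only: of_rat_mult of_rat_of_nat_eq of_rat_numeral_eq) (simp add: add_ac)

text \<open>The prefactor 2 (2 k + 1) turns the denominator (k + 1)(2 k + 3) of the ratio into the
  (2 k + 1)(2 k + 2) of \<open>choose_step\<close>. The numerators (6 k + 5)(6 k + 1) and -36 (n -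
  k)(n + k + 1) then differ by (6 n + 1)(6 n + 5), a multiple of p.\<close>

lemma S_lower:
  assumes n: "6 * n + 1 = p \<or> 6 * n + 5 = p" and k: "k < h"
  shows "2 * (2 * of_nat k + 1) * of_rat (S k) \<approx> of_nat ((n + k) choose (2 * k)) * (- 432) ^ k"
  using k
proof (induction k)
  case 0
  then show ?case by (simp add: S_def of_rat_divide)
next
  case (Suc k)
  define P where "P k = 2 * (2 * of_nat k + 1) * (of_rat (S k) :: complex)" for k
  define T where "T k = (of_nat ((n + k) choose (2 * k)) * (- 432) ^ k :: complex)" for k
  define x where "x = (of_nat k :: complex)"
  \<comment> \<open>The cofactor: one of 6 n + 1 and 6 n + 5 is p, the other is q.\<close>
  define q where "q = (if 6 * n + 1 = p then 6 * n + 5 else 6 * n + 1)"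
  have "(6 * n + 1) * (6 * n + 5) = p * q" using n by (auto simp: q_def)
  then have "(of_nat ((6 * n + 1) * (6 * n + 5)) :: complex) = of_nat (p * q)" by simp
  then have q: "36 * of_nat n * (of_nat n + 1) + 5 = (of_nat p * of_nat q :: complex)"
    by (simp add: algebra_simps)
  define d where "d = ((2 * x + 2) * (2 * x + 1))"
  have dn: "d = of_nat ((2 * k + 2)) * of_nat (2 * k + 1)" by (simp add: d_def x_def add_ac)
  have kp: "2 * k + 2 < p" using Suc.prems p_eq by linarith
  have di: "inverse d \<in> R" unfolding dn using kp by (intro R_inverse_mult R_inverse_of_nat) auto
  have d0: "d \<noteq> 0" unfolding dn by (simp del: of_nat_add of_nat_mult of_nat_Suc)
  have dT: "d * T (Suc k) = - 12 * (36 * of_nat n * (of_nat n + 1) - 36 * x * (x + 1)) * T k"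
  proof -
    have "d * T (Suc k) = (of_nat ((n + Suc k) choose (2 * Suc k)) * d) * (- 432) * (- 432) ^ k"
      by (simp add: T_def)
    also have "of_nat ((n + Suc k) choose (2 * Suc k)) * d
       = of_nat ((n + k) choose (2 * k)) * ((of_nat n + x + 1) * (of_nat n - x))"
      unfolding d_def x_def by (rule choose_step)
    finally show ?thesis by (simp add: T_def algebra_simps)
  qed
  have dP: "d * P (Suc k) = 12 * (6 * x + 5) * (6 * x + 1) * P k"
  proof -
    have "d * P (Suc k) = 4 * (2 * x + 1) * (of_rat (S (Suc k)) * ((x + 1) * (2 * x + 3)))"
      by (simp add: P_def d_def x_def algebra_simps)
    also have "of_rat (S (Suc k)) * ((x + 1) * (2 * x + 3)) = 6 * (6 * x + 5) * (6 * x + 1) * of_rat (S k)"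
      unfolding x_def by (rule S_Suc_complex)
    finally show ?thesis by (simp add: P_def x_def algebra_simps)
  qed
  have xR: "x \<in> R" by (simp add: x_def)
  have TR: "T k \<in> R" unfolding T_def by (intro R_mult R_power) auto
  have "P k \<approx> T k" unfolding P_def T_def using Suc by simp
  then have "d * P (Suc k) \<approx> 12 * (6 * x + 5) * (6 * x + 1) * T k"
    unfolding dP by (intro econg_mult_left R_rules xR)
  also have "\<dots> \<approx> d * T (Suc k)"
  proof (rule econgI)
    have "12 * (6 * x + 5) * (6 * x + 1) * T k - d * T (Suc k)
        = 12 * (36 * of_nat n * (of_nat n + 1) + 5) * T k"
      unfolding dT by (simp add: algebra_simps)
    then show "12 * (6 * x + 5) * (6 * x + 1) * T k - d * T (Suc k) = of_nat p * (12 * of_nat q * T k)"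
      unfolding q by simp
    show "12 * of_nat q * T k \<in> R" using TR by auto
  qed
  finally have "P (Suc k) \<approx> T (Suc k)" using di d0 by (rule econg_cancel)
  then show ?case by (simp add: P_def T_def)
qed

text \<open>For k = h + j one has 2 k = 2 j - 1 mod p, so the numerator of the ratio becomes a
  multiple of 9 j^2 - 1, and 9 N^2 = 1 mod p makes this -9 (N^2 - j^2). The sum of the two binomial
  coefficients is the combination whose exact ratio has the symmetric zeros j = N and j = -N. The
  middle value fixes the constant -8.\<close>

lemma S_upper:
  assumes N: "3 * Suc M = p + 1 \<or> 3 * Suc M + 1 = p" and j: "j \<le> h"
  shows "- 8 * of_rat (S (h + j)) \<approx> (of_nat ((Suc M + j) choose (2 * j)) + of_nat ((M + j) choose (2 * j))) * (- 432) ^ j"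
  using j
proof (induction j)
  case 0
  have "- 2 * (4 * of_rat (S h)) \<approx> - 2 * - 1" using S_middle by (intro econg_mult_left) auto
  then show ?case by simp
next
  case (Suc j)
  define k where "k = h + j"
  define t where "t j = ((of_nat ((Suc M + j) choose (2 * j)) + of_nat ((M + j) choose (2 * j))) * (- 432) ^ j :: complex)" for j
  define x N where "x = (of_nat j :: complex)" and "N = (of_nat (Suc M) :: complex)"
  define pc where "pc = (of_nat p :: complex)"
  have k2: "2 * of_nat k = pc - 1 + 2 * x"
  proof -
    have "2 * k + 1 = p + 2 * j" using p_eq by (simp add: k_def)
    then have "(of_nat (2 * k + 1) :: complex) = of_nat (p + 2 * j)" by (simp only:)
    then show ?thesis by (simp add: pc_def x_def algebra_simps)
  qed
  obtain q where q: "9 * N * N = 1 + pc * q" "q \<in> R"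
  proof (cases "3 * Suc M = p + 1")
    case True
    then have "(of_nat (3 * Suc M) :: complex) = of_nat (p + 1)" by (simp only:)
    then have "3 * N = pc + 1" by (simp add: N_def pc_def)
    moreover have "9 * N * N = (3 * N) * (3 * N)" by simp
    ultimately have "9 * N * N = 1 + pc * (pc + 2)" by (simp add: algebra_simps)
    then show ?thesis using that[of "pc + 2"] by (auto simp: pc_def)
  next
    case False
    then have "3 * Suc M + 1 = p" using assms(1) by simp
    then have "(of_nat (3 * Suc M + 1) :: complex) = of_nat p" by (simp only:)
    then have "3 * N = pc - 1" by (simp add: N_def pc_def algebra_simps)
    moreover have "9 * N * N = (3 * N) * (3 * N)" by simp
    ultimately have "9 * N * N = (pc - 1) * (pc - 1)" by (simp only:)
    then have "9 * N * N = 1 + pc * (pc - 2)" by (simp add: algebra_simps)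
    then show ?thesis using that[of "pc - 2"] by (auto simp: pc_def)
  qed
  define d where "d = (2 * of_nat k + 2) * (2 * of_nat k + 3 :: complex)"
  have dn: "d = of_nat (2 * (h + j + 1)) * of_nat (2 * (h + j) + 3)" by (simp add: d_def k_def algebra_simps)
  have kp1: "h + j + 1 < p" using Suc.prems p_eq by linarith
  have kp2: "2 * (h + j) + 3 = p + (2 * j + 2)" using p_eq by simp
  have kp3: "2 * j + 2 < p" using Suc.prems p_eq by linarith
  \<comment> \<open>Past the middle 2 k + 3 = p + (2 j + 2), which is a unit since 2 j + 2 < p; the
    recurrence works again.\<close>
  have di: "inverse d \<in> R" unfolding dn
  proof (rule R_inverse_mult)
    show "inverse (of_nat (2 * (h + j + 1))) \<in> R"
      unfolding of_nat_mult of_nat_numeral using kp1 by (intro R_inverse_mult R_inverse_2 R_inverse_of_nat) auto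
    have "\<not> p dvd 2 * j + 2" using kp3 by (intro nat_dvd_not_less) auto
    then have "\<not> p dvd p + (2 * j + 2)" by (simp only: dvd_add_triv_left_iff not_False_eq_True)
    then have "\<not> int p dvd int (2 * (h + j) + 3)" unfolding kp2 by (simp only: int_dvd_int_iff not_False_eq_True)
    from R_inverse_of_int[OF this] show "inverse (of_nat (2 * (h + j) + 3)) \<in> R" by (simp only: of_int_of_nat_eq)
  qed
  have d0: "d \<noteq> 0" unfolding dn by (simp del: of_nat_add of_nat_mult of_nat_Suc)
  have de: "d = (2 * x + 1) * (2 * x + 2) + pc * (4 * x + 3 + pc)" unfolding d_def k2 by (simp add: algebra_simps)
  have xR: "x \<in> R" "pc \<in> R" by (simp_all add: x_def pc_def)
  have tR: "t j \<in> R" for j unfolding t_def by (intro R_mult R_power R_add) auto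
  have tS: "(2 * x + 1) * (2 * x + 2) * t (Suc j) = - 432 * (N * N - x * x) * t j"
  proof -
    have *: "of_nat (Suc M + Suc j choose (2 * Suc j)) * ((2 * x + 2) * (2 * x + 1))
        = (of_nat (Suc M + j choose (2 * j)) * ((N + x + 1) * (N - x)) :: complex)"
      unfolding x_def N_def by (rule choose_step)
    have **: "of_nat (M + Suc j choose (2 * Suc j)) * ((2 * x + 2) * (2 * x + 1))
        = (of_nat (M + j choose (2 * j)) * ((N + x) * (N - 1 - x)) :: complex)"
      using choose_step[of M j, where 'a = complex] unfolding x_def N_def by (simp add: algebra_simps)
    \<comment> \<open>Absorption relates the two binomial coefficients, so that the terms outside
      the factor N^2 - x^2 cancel.\<close>
    have abs: "of_nat (Suc M + j choose (2 * j)) * (N - x) = (of_nat (M + j choose (2 * j)) * (N + x) :: complex)"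
    proof -
      have nat: "(Suc (M + j) - 2 * j) * (Suc (M + j) choose (2 * j)) = Suc (M + j) * (M + j choose (2 * j))"
        using binomial_absorb_comp[of "Suc (M + j)" "2 * j"] by simp
      show ?thesis
      proof (cases "2 * j \<le> Suc (M + j)")
        case True
        then have "(of_nat (Suc (M + j) - 2 * j) :: complex) = N - x"
          by (simp add: of_nat_diff N_def x_def)
        moreover have "(of_nat (Suc (M + j)) :: complex) = N + x" by (simp add: N_def x_def)
        moreover note arg_cong[OF nat, of "of_nat :: nat \<Rightarrow> complex", unfolded of_nat_mult]
        ultimately show ?thesis by (simp only: mult.commute add_Suc)
      next
        case False
        then show ?thesis by (simp add: binomial_eq_0)
      qed
    qed
    have "(2 * x + 1) * (2 * x + 2) * t (Suc j)
       = (of_nat (Suc M + Suc j choose (2 * Suc j)) * ((2 * x + 2) * (2 * x + 1))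
        + of_nat (M + Suc j choose (2 * Suc j)) * ((2 * x + 2) * (2 * x + 1))) * ((- 432) * (- 432) ^ j)"
      unfolding t_def by (simp only: power_Suc) (simp only: algebra_simps)
    also have "\<dots> = (of_nat (Suc M + j choose (2 * j)) * (N - x) * (N + x + 1)
        + of_nat (M + j choose (2 * j)) * (N + x) * (N - 1 - x)) * ((- 432) * (- 432) ^ j)"
      unfolding * ** by (simp only: mult_ac)
    also have "of_nat (Suc M + j choose (2 * j)) * (N - x) * (N + x + 1)
        + of_nat (M + j choose (2 * j)) * (N + x) * (N - 1 - x)
      = (of_nat (Suc M + j choose (2 * j)) * (N - x)) * (N + x)
        + of_nat (M + j choose (2 * j)) * (N + x) * (N - x)
        + (of_nat (Suc M + j choose (2 * j)) * (N - x) - of_nat (M + j choose (2 * j)) * (N + x))"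
      by (simp add: algebra_simps)
    also have "(\<dots>) * ((- 432) * (- 432) ^ j) = - 432 * (N * N - x * x) * t j"
    proof -
      have "((A * (N - x)) * (N + x) + B * (N + x) * (N - x) + (A * (N - x) - B * (N + x))) * ((- 432) * z)
          = - 432 * (N * N - x * x) * ((A + B) * z)" if "A * (N - x) = B * (N + x)" for A B z
      proof -
        have "A * (N - x) - B * (N + x) = 0" using that by simp
        then have "((A * (N - x)) * (N + x) + B * (N + x) * (N - x) + (A * (N - x) - B * (N + x))) * ((- 432) * z)
          = ((A * (N - x)) * (N + x) + B * (N + x) * (N - x)) * ((- 432) * z)" by (simp only: add_0_right)
        then show ?thesis by (simp add: algebra_simps)
      qed
      from this[OF abs] show ?thesis unfolding t_def .
    qed
    finally show ?thesis .
  qed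
  define Q where "Q i = - 8 * (of_rat (S (h + i)) :: complex)" for i
  have dQ: "d * Q (Suc j) = 12 * (6 * x + 2 + 3 * pc) * (6 * x - 2 + 3 * pc) * Q j"
  proof -
    have "d * Q (Suc j) = - 16 * (of_rat (S (Suc k)) * ((of_nat k + 1) * (2 * of_nat k + 3)))"
      by (simp add: Q_def d_def k_def algebra_simps)
    also have "\<dots> = - 16 * (6 * (3 * (2 * of_nat k) + 5) * (3 * (2 * of_nat k) + 1) * of_rat (S k))"
      unfolding S_Suc_complex by simp
    also have "\<dots> = 12 * (6 * x + 2 + 3 * pc) * (6 * x - 2 + 3 * pc) * Q j"
      unfolding k2 by (simp add: Q_def k_def algebra_simps)
    finally show ?thesis .
  qed
  have "Q j \<approx> t j" unfolding Q_def t_def using Suc by simp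
  then have "d * Q (Suc j) \<approx> 12 * (6 * x + 2 + 3 * pc) * (6 * x - 2 + 3 * pc) * t j"
    unfolding dQ by (intro econg_mult_left R_rules xR)
  also have "\<dots> \<approx> d * t (Suc j)"
  proof (rule econgI)
    have "d * t (Suc j) = (2 * x + 1) * (2 * x + 2) * t (Suc j) + pc * (4 * x + 3 + pc) * t (Suc j)"
      unfolding de by (simp add: algebra_simps)
    also have "(2 * x + 1) * (2 * x + 2) * t (Suc j) = (- 48 * (9 * N * N) + 432 * x * x) * t j"
      unfolding tS by (simp add: algebra_simps)
    finally show "12 * (6 * x + 2 + 3 * pc) * (6 * x - 2 + 3 * pc) * t j - d * t (Suc j)
       = of_nat p * ((432 * x + 108 * pc) * t j + 48 * q * t j - (4 * x + 3 + pc) * t (Suc j))"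
      unfolding q(1) pc_def[symmetric] by (simp add: algebra_simps)
    show "(432 * x + 108 * pc) * t j + 48 * q * t j - (4 * x + 3 + pc) * t (Suc j) \<in> R"
      by (intro R_rules xR tR q(2))
  qed
  finally have "Q (Suc j) \<approx> t (Suc j)" using di d0 by (rule econg_cancel)
  then show ?case by (simp add: Q_def t_def)
qed

end

section \<open>Closed forms and the evaluation of the sums\<close>

text \<open>For \<open>u = exp (2 i \<theta>)\<close> one has \<open>y = u + 1 / u - 2 = - 4 sin\<^sup>2 \<theta>\<close>, and \<open>cheb_W n y\<close>, \<open>cheb_V n y\<close> are
  \<open>cos ((2 n + 1) \<theta>) / cos \<theta>\<close> and \<open>sin (2 n \<theta>) / sin (2 \<theta>)\<close>.\<close>

definition cheb_W :: "nat \<Rightarrow> complex \<Rightarrow> complex" where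
  "cheb_W n y = (\<Sum>k\<le>n. of_nat ((n + k) choose (2 * k)) * y ^ k)"

definition cheb_V :: "nat \<Rightarrow> complex \<Rightarrow> complex" where
  "cheb_V n y = (\<Sum>k\<le>n. of_nat ((n + k) choose (2 * k + 1)) * y ^ k)"

lemma cheb_V_Suc: "cheb_V (Suc n) y = cheb_V n y + cheb_W n y"
proof -
  have "cheb_V (Suc n) y = (\<Sum>k\<le>n. of_nat ((Suc n + k) choose (2 * k + 1)) * y ^ k)"
    by (simp add: cheb_V_def binomial_eq_0)
  also have "\<dots> = (\<Sum>k\<le>n. of_nat ((n + k) choose (2 * k + 1)) * y ^ k + of_nat ((n + k) choose (2 * k)) * y ^ k)"
    by (intro sum.cong) (simp_all add: algebra_simps)
  finally show ?thesis by (simp add: cheb_V_def cheb_W_def sum.distrib)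
qed

lemma cheb_W_Suc: "cheb_W (Suc n) y = cheb_W n y + y * cheb_V (Suc n) y"
proof -
  have W: "cheb_W n y = 1 + (\<Sum>k\<le>n. of_nat ((n + Suc k) choose (2 * Suc k)) * y ^ Suc k)"
  proof -
    have "cheb_W n y = (\<Sum>k\<le>Suc n. of_nat ((n + k) choose (2 * k)) * y ^ k)"
      by (simp add: cheb_W_def binomial_eq_0)
    then show ?thesis by (simp only: sum.atMost_Suc_shift) simp
  qed
  have V: "cheb_V (Suc n) y = (\<Sum>k\<le>n. of_nat ((Suc n + k) choose (2 * k + 1)) * y ^ k)"
    by (simp add: cheb_V_def binomial_eq_0)
  have "cheb_W (Suc n) y = 1 + (\<Sum>k\<le>n. of_nat ((Suc n + Suc k) choose (2 * Suc k)) * y ^ Suc k)"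
    unfolding cheb_W_def by (simp only: sum.atMost_Suc_shift) simp
  also have "(\<Sum>k\<le>n. of_nat ((Suc n + Suc k) choose (2 * Suc k)) * y ^ Suc k)
     = (\<Sum>k\<le>n. of_nat ((n + Suc k) choose (2 * Suc k)) * y ^ Suc k + y * (of_nat ((Suc n + k) choose (2 * k + 1)) * y ^ k))"
    by (intro sum.cong) (simp_all add: algebra_simps)
  finally show ?thesis unfolding W V by (simp add: sum.distrib sum_distrib_left)
qed

text \<open>Both closed forms are proved in one induction, as each recurrence refers to the other;
  clearing denominators keeps u = 1 and u = -1 admissible. Here t stands for 1 / u.\<close>

lemma cheb_closed:
  assumes ut: "u * t = 1" and y: "y = u + t - 2"
  shows "(u + 1) * cheb_W n y = u ^ Suc n + t ^ n \<and> (u * u - 1) * cheb_V n y = u ^ Suc n - u * t ^ n"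
proof (induction n)
  case 0
  then show ?case by (simp add: cheb_W_def cheb_V_def)
next
  case (Suc n)
  then have W: "(u + 1) * cheb_W n y = u ^ Suc n + t ^ n" and V: "(u * u - 1) * cheb_V n y = u ^ Suc n - u * t ^ n"
    by auto
  have utn: "u * (t * x) = x" "t * (u * x) = x" "t * u = 1" for x using ut by (simp_all add: mult.commute flip: mult.assoc)
  have "(u * u - 1) * cheb_V (Suc n) y = (u * u - 1) * cheb_V n y + (u - 1) * ((u + 1) * cheb_W n y)"
    unfolding cheb_V_Suc by (simp add: algebra_simps)
  also have "\<dots> = u ^ Suc (Suc n) - u * t ^ Suc n" unfolding W V by (simp add: algebra_simps utn)
  finally have V': "(u * u - 1) * cheb_V (Suc n) y = u ^ Suc (Suc n) - u * t ^ Suc n" .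
  have yu: "(u + 1) * y = (u - 1) * t * (u * u - 1)"
    unfolding y by (simp add: algebra_simps utn ut)
  have "(u + 1) * cheb_W (Suc n) y = (u + 1) * cheb_W n y + ((u + 1) * y) * cheb_V (Suc n) y"
    unfolding cheb_W_Suc by (simp add: algebra_simps)
  also have "\<dots> = u ^ Suc n + t ^ n + (u - 1) * t * ((u * u - 1) * cheb_V (Suc n) y)"
    unfolding W yu by (simp only: mult.assoc)
  also have "\<dots> = u ^ Suc (Suc n) + t ^ Suc n" unfolding V' by (simp add: algebra_simps utn)
  finally show ?case using V' by blast
qed

text \<open>The second and third forms evaluate the halves of the first sum, at u = -v; the first
  and fourth those of the second sum, at u = v.\<close>

lemma cheb_values:
  assumes ut: "u * t = 1" and y: "y = u + t - 2" and u: "u \<noteq> 1" "u \<noteq> - 1"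
  shows "cheb_W n y = (u ^ Suc n + t ^ n) / (u + 1)"
    and "cheb_V n y + cheb_V (Suc n) y = (u ^ Suc n - t ^ n) / (u - 1)"
    and "cheb_W (Suc n) y + cheb_W n y = u ^ Suc n + t ^ Suc n"
    and "y * cheb_V n y = (u - 1) * (u ^ n - t ^ n) / (u + 1)"
proof -
  have utn: "u * (t * x) = x" "t * (u * x) = x" "t * u = 1" for x using ut by (simp_all add: mult.commute flip: mult.assoc)
  have u1: "u + 1 \<noteq> 0" "u - 1 \<noteq> 0" using u by (simp_all add: eq_neg_iff_add_eq_0)
  then have uu: "u * u - 1 \<noteq> 0" by (simp add: square_eq_1_iff u)
  have W: "(u + 1) * cheb_W n y = u ^ Suc n + t ^ n" and V: "(u * u - 1) * cheb_V n y = u ^ Suc n - u * t ^ n" for n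
    using cheb_closed[OF ut y] by auto
  show "cheb_W n y = (u ^ Suc n + t ^ n) / (u + 1)" unfolding W[symmetric] using u1 by simp
  have "(u + 1) * ((u - 1) * (cheb_V n y + cheb_V (Suc n) y)) = (u * u - 1) * cheb_V n y + (u * u - 1) * cheb_V (Suc n) y"
    by (simp add: algebra_simps)
  also have "\<dots> = (u + 1) * (u ^ Suc n - t ^ n)" unfolding V by (simp add: algebra_simps utn)
  finally have "(u - 1) * (cheb_V n y + cheb_V (Suc n) y) = u ^ Suc n - t ^ n" using u1 by (simp only: mult_cancel_left simp_thms)
  then show "cheb_V n y + cheb_V (Suc n) y = (u ^ Suc n - t ^ n) / (u - 1)" using u1 by (simp add: eq_divide_eq mult.commute)
  have "(u + 1) * (cheb_W (Suc n) y + cheb_W n y) = (u + 1) * (u ^ Suc n + t ^ Suc n)"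
    unfolding distrib_left[of "u + 1" "cheb_W _ _"] W by (simp add: algebra_simps utn)
  then show "cheb_W (Suc n) y + cheb_W n y = u ^ Suc n + t ^ Suc n" using u1 by (simp only: mult_cancel_left simp_thms)
  have uy: "u * y = (u - 1) * (u - 1)" unfolding y by (simp add: algebra_simps ut utn)
  have "(u - 1) * ((u + 1) * (y * cheb_V n y)) = y * ((u * u - 1) * cheb_V n y)" by (simp add: algebra_simps)
  also have "\<dots> = (u * y) * (u ^ n - t ^ n)" unfolding V by (simp add: algebra_simps)
  also have "\<dots> = (u - 1) * ((u - 1) * (u ^ n - t ^ n))" unfolding uy by (simp only: mult.assoc)
  finally have "(u + 1) * (y * cheb_V n y) = (u - 1) * (u ^ n - t ^ n)" using u1 by (simp only: mult_cancel_left simp_thms)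
  then show "y * cheb_V n y = (u - 1) * (u ^ n - t ^ n) / (u + 1)" using u1 by (simp add: eq_divide_eq mult.commute)
qed

text \<open>From (2 k + 1) C(n+k+1, 2k+1) = (n + k + 1) C(n+k, 2k) and Pascal's rule, each
  denominator 2 k + 1 can be traded for the common denominator 2 n + 1.\<close>

lemma sum_odd_denominators:
  "(\<Sum>k\<le>n. of_nat ((n + k) choose (2 * k)) / (2 * of_nat k + 1) * y ^ k)
    = (cheb_V n y + cheb_V (Suc n) y) / (2 * of_nat n + 1)"
proof -
  have nz: "2 * of_nat k + 1 \<noteq> (0 :: complex)" for k using of_nat_neq_0[of "2 * k"] by (simp add: add.commute)
  have V: "cheb_V (Suc n) y = (\<Sum>k\<le>n. of_nat ((Suc n + k) choose (2 * k + 1)) * y ^ k)"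
    by (simp add: cheb_V_def binomial_eq_0)
  have "(2 * of_nat n + 1) * (of_nat ((n + k) choose (2 * k)) / (2 * of_nat k + 1) * y ^ k)
     = (of_nat ((n + k) choose (2 * k + 1)) * y ^ k + of_nat ((Suc n + k) choose (2 * k + 1)) * y ^ k)" for k
  proof -
    define a b e :: complex where "a = of_nat ((n + k) choose (2 * k))" and "b = of_nat ((n + k) choose (2 * k + 1))"
      and "e = of_nat ((Suc n + k) choose (2 * k + 1))"
    have "Suc (2 * k) * (Suc (n + k) choose Suc (2 * k)) = Suc (n + k) * (n + k choose (2 * k))"
      by (rule Suc_times_binomial)
    then have "(of_nat (Suc (2 * k) * (Suc (n + k) choose Suc (2 * k))) :: complex) = of_nat (Suc (n + k) * (n + k choose (2 * k)))"
      by (simp only:)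
    then have 1: "(2 * of_nat k + 1) * e = (of_nat n + of_nat k + 1) * a"
      unfolding e_def a_def of_nat_mult by (simp add: algebra_simps)
    have 2: "e = a + b" by (simp add: a_def b_def e_def)
    have "(2 * of_nat n + 1) * a = (2 * of_nat k + 1) * (b + e)"
    proof -
      have "(2 * of_nat k + 1) * (b + e) = 2 * ((2 * of_nat k + 1) * e) - (2 * of_nat k + 1) * a"
        unfolding 2 by (simp add: algebra_simps)
      then show ?thesis unfolding 1 by (simp add: algebra_simps)
    qed
    then have "(2 * of_nat n + 1) * (a / (2 * of_nat k + 1)) = b + e"
      unfolding times_divide_eq_right using nz[of k] by (simp only: nonzero_mult_div_cancel_left not_False_eq_True)
    then have "(2 * of_nat n + 1) * (a / (2 * of_nat k + 1)) * y ^ k = (b + e) * y ^ k" by (simp only:)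
    then show ?thesis unfolding a_def b_def e_def by (simp only: mult.assoc distrib_right)
  qed
  then have "(2 * of_nat n + 1) * (\<Sum>k\<le>n. of_nat ((n + k) choose (2 * k)) / (2 * of_nat k + 1) * y ^ k)
     = cheb_V n y + cheb_V (Suc n) y"
    unfolding V unfolding cheb_V_def by (simp only: sum_distrib_left sum.distrib)
  then show ?thesis by (intro eq_divide_imp nz) (simp only: mult.commute)
qed

text \<open>In Chebyshev terms, the derivative of the first-kind polynomial of degree N is N times a
  second-kind one: the weight j is the operator y d/dy.\<close>

lemma sum_index_weights:
  "(\<Sum>j\<le>Suc M. 2 * of_nat j * (of_nat ((Suc M + j) choose (2 * j)) + of_nat ((M + j) choose (2 * j))) * y ^ j)
    = 2 * of_nat (Suc M) * (y * cheb_V (Suc M) y)"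
proof -
  have c: "2 * of_nat (Suc i) * (of_nat ((Suc M + Suc i) choose (2 * Suc i)) + of_nat ((M + Suc i) choose (2 * Suc i)))
     = 2 * of_nat (Suc M) * (of_nat ((Suc M + i) choose (2 * i + 1)) :: complex)" for i
  proof -
    define a b e :: complex where "a = of_nat ((Suc M + i) choose (2 * i + 1))" and "b = of_nat ((M + Suc i) choose (2 * Suc i))"
      and "e = of_nat ((Suc M + Suc i) choose (2 * Suc i))"
    have "Suc (2 * i + 1) * (Suc (Suc M + i) choose Suc (2 * i + 1)) = Suc (Suc M + i) * (Suc M + i choose (2 * i + 1))"
      by (rule Suc_times_binomial)
    then have "(of_nat (Suc (2 * i + 1) * (Suc (Suc M + i) choose Suc (2 * i + 1))) :: complex) = of_nat (Suc (Suc M + i) * (Suc M + i choose (2 * i + 1)))"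
      by (simp only:)
    then have 1: "(2 * of_nat i + 2) * e = (of_nat M + of_nat i + 2) * a"
      unfolding e_def a_def of_nat_mult by (simp add: algebra_simps)
    have 2: "e = a + b" by (simp add: a_def b_def e_def)
    have "(2 * of_nat i + 2) * (e + b) = 2 * ((2 * of_nat i + 2) * e) - (2 * of_nat i + 2) * a"
      unfolding 2 by (simp add: algebra_simps)
    then have "(2 * of_nat i + 2) * (e + b) = 2 * of_nat (Suc M) * a" unfolding 1 by (simp add: algebra_simps)
    moreover have "2 * of_nat i + 2 = (2 * of_nat (Suc i) :: complex)" by simp
    ultimately show ?thesis unfolding a_def b_def e_def by (simp only:)
  qed
  have V: "cheb_V (Suc M) y = (\<Sum>k\<le>M. of_nat ((Suc M + k) choose (2 * k + 1)) * y ^ k)"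
    by (simp add: cheb_V_def binomial_eq_0)
  show ?thesis unfolding sum.atMost_Suc_shift V c
    by (simp add: sum_distrib_left mult_ac)
qed

context eis_localization
begin

text \<open>In both cases N = \<open>Suc M\<close> is (p - 1) / 3 or (p + 1) / 3 and even; the
  successor form makes N - 1 = \<open>M\<close> available without subtraction.\<close>

lemma index_exists:
  obtains n M where "6 * n + 1 = p \<and> Suc M = 2 * n \<or> 6 * n + 5 = p \<and> Suc M = 2 * n + 2"
proof -
  have "\<not> 2 dvd p" "\<not> 3 dvd p" using prime_p p_gt_3 primes_dvd_imp_eq[of 2 p] primes_dvd_imp_eq[of 3 p] by auto
  then have "p mod 6 = 1 \<or> p mod 6 = 5" by presburger
  then show ?thesis
  proof
    assume "p mod 6 = 1"
    then have "6 * (p div 6) + 1 = p" "Suc (2 * (p div 6) - 1) = 2 * (p div 6)" using p_gt_3 by presburger+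
    then show ?thesis using that by blast
  next
    assume "p mod 6 = 5"
    then have "6 * (p div 6) + 5 = p" "Suc (2 * (p div 6) + 1) = 2 * (p div 6) + 2" by presburger+
    then show ?thesis using that by blast
  qed
qed

text \<open>Not visible from the definition, which has 2 k + 1 = p in the denominator at k = h; it
  follows because the congruences put multiples of \<open>S k\<close> by units into
  \<open>R\<close>.\<close>

lemma S_in_R:
  assumes k: "k \<le> p - 1" shows "of_rat (S k) \<in> R"
proof -
  obtain n M where "6 * n + 1 = p \<and> Suc M = 2 * n \<or> 6 * n + 5 = p \<and> Suc M = 2 * n + 2"
    by (rule index_exists)
  then have n: "6 * n + 1 = p \<or> 6 * n + 5 = p" and M: "3 * Suc M = p + 1 \<or> 3 * Suc M + 1 = p"
    by presburger+
  show ?thesis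
  proof (cases "k < h")
    case True
    have *: "2 * (2 * of_nat k + 1) * of_rat (S k) \<in> R"
      by (rule econg_in_R[OF S_lower[OF n True]]) (intro R_rules)
    have "inverse (2 * of_nat (2 * k + 1)) \<in> R"
      using True p_eq by (intro R_inverse_mult R_inverse_2 R_inverse_of_nat) auto
    with * have "inverse (2 * of_nat (2 * k + 1)) * (2 * (2 * of_nat k + 1) * of_rat (S k)) \<in> R"
      by (rule R_mult[rotated])
    moreover have "inverse (2 * of_nat (2 * k + 1)) * (2 * (2 * of_nat k + 1) * of_rat (S k))
        = (of_rat (S k) :: complex)"
    proof -
      have "2 * of_nat (2 * k + 1) \<noteq> (0 :: complex)"
        by (simp only: mult_eq_0_iff of_nat_eq_0_iff) simp
      moreover have "2 * (2 * of_nat k + 1) = (2 * of_nat (2 * k + 1) :: complex)" by simp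
      moreover have "inverse d * (d * z) = z" if "d \<noteq> 0" for d z :: complex
        using that by simp
      ultimately show ?thesis by (simp only:) simp
    qed
    ultimately show ?thesis by (simp only:)
  next
    case False
    define i where "i = k - h"
    have i: "k = h + i" "i \<le> h" using False k p_eq unfolding i_def by linarith+
    have "- 8 * of_rat (S (h + i)) \<in> R"
      by (rule econg_in_R[OF S_upper[OF M i(2)]]) (intro R_rules)
    then have "- (inverse 2 * inverse 2 * inverse 2) * (- 8 * of_rat (S (h + i))) \<in> R"
      by (rule R_mult[rotated]) (intro R_rules R_inverse_2)
    then show ?thesis by (simp add: i)
  qed
qed

lemma sum_split_middle: "(\<Sum>k = 0..p - 1. f k) = (\<Sum>k<h. f k) + (\<Sum>j\<le>h. f (h + j))"
  for f :: "nat \<Rightarrow> complex"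
proof -
  have ph: "p - 1 = h + h" using p_eq by linarith
  have "{0..h + h} = {..<h} \<union> {h..h + h}" by auto
  then have "(\<Sum>k = 0..p - 1. f k) = sum f ({..<h} \<union> {h..h + h})" unfolding ph by (simp only:)
  also have "\<dots> = (\<Sum>k<h. f k) + (\<Sum>k=h..h + h. f k)"
    by (intro sum.union_disjoint) auto
  also have "(\<Sum>k=h..h + h. f k) = (\<Sum>j\<le>h. f (h + j))"
    by (rule sum.reindex_bij_witness[of _ "\<lambda>j. h + j" "\<lambda>k. k - h"]) auto
  finally show ?thesis .
qed

text \<open>The weight 2 k + 1 of the second sum cancels the odd denominators of the lower half, and
  equals 2 j mod p in the upper half. This is what makes both halves closed forms.\<close>

lemma sum_S_econg:
  assumes n: "6 * n + 1 = p \<or> 6 * n + 5 = p" and M: "3 * Suc M = p + 1 \<or> 3 * Suc M + 1 = p"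
    and x: "x \<in> R" and y: "y = - 432 * x"
  shows "(\<Sum>k = 0..p - 1. of_rat (S k) * x ^ k)
      \<approx> (cheb_V n y + cheb_V (Suc n) y) / (2 * (2 * of_nat n + 1))
         - x ^ h / 8 * (cheb_W (Suc M) y + cheb_W M y)" (is ?A)
    and "(\<Sum>k = 0..p - 1. (2 * of_nat k + 1) * of_rat (S k) * x ^ k)
      \<approx> cheb_W n y / 2 - x ^ h / 4 * (of_nat (Suc M) * (y * cheb_V (Suc M) y))" (is ?B)
proof -
  have nh: "n < h" using n p_eq p_gt_3 by presburger
  have Mh: "Suc M \<le> h" using M p_eq h_ge by presburger
  define b where "b k = (of_nat ((n + k) choose (2 * k)) :: complex)" for k
  define t where "t j = (of_nat ((Suc M + j) choose (2 * j)) + of_nat ((M + j) choose (2 * j)) :: complex)" for j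
  have yk: "y ^ k = (- 432) ^ k * x ^ k" for k unfolding y by (simp only: power_mult_distrib)
  have i8: "inverse 8 \<in> R" using R_inverse_power[OF R_inverse_2, of 3] by simp
  have tR: "t j \<in> R" for j unfolding t_def by (intro R_rules)
  have bR: "b k \<in> R" for k unfolding b_def by (intro R_rules)
  have low: "of_rat (S k) * x ^ k \<approx> b k / (2 * (2 * of_nat k + 1)) * y ^ k"
    and low2: "(2 * of_nat k + 1) * of_rat (S k) * x ^ k \<approx> b k / 2 * y ^ k" if "k < h" for k
  proof -
    have d: "2 * of_nat k + 1 = (of_nat (2 * k + 1) :: complex)" by simp
    have d0: "2 * of_nat k + 1 \<noteq> (0 :: complex)" unfolding d by (simp only: of_nat_eq_0_iff)
    have di: "inverse (2 * of_nat k + 1) \<in> R" unfolding d using that p_eq by (intro R_inverse_of_nat) auto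
    have *: "2 * (2 * of_nat k + 1) * of_rat (S k) * x ^ k \<approx> b k * (- 432) ^ k * x ^ k"
      unfolding b_def by (intro econg_mult_right S_lower[OF n that] R_rules x)
    have "inverse (2 * (2 * of_nat k + 1)) * (2 * (2 * of_nat k + 1) * of_rat (S k) * x ^ k)
        \<approx> inverse (2 * (2 * of_nat k + 1)) * (b k * (- 432) ^ k * x ^ k)"
      by (intro econg_mult_left[OF *] R_inverse_mult R_inverse_2 di)
    moreover have "inverse (2 * (2 * of_nat k + 1)) * (2 * (2 * of_nat k + 1) * of_rat (S k) * x ^ k)
        = of_rat (S k) * x ^ k"
    proof -
      have "inverse d * (d * z * w) = z * w" if "d \<noteq> 0" for d z w :: complex
        using that by simp
      moreover have "2 * (2 * of_nat k + 1) \<noteq> (0 :: complex)" using d0 by (simp only: mult_eq_0_iff) simp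
      ultimately show ?thesis by blast
    qed
    moreover have "inverse (2 * (2 * of_nat k + 1)) * (b k * (- 432) ^ k * x ^ k)
        = b k / (2 * (2 * of_nat k + 1)) * y ^ k"
      unfolding yk divide_inverse by (simp only: mult_ac)
    ultimately show "of_rat (S k) * x ^ k \<approx> b k / (2 * (2 * of_nat k + 1)) * y ^ k"
      by (simp only:)
    have "inverse 2 * (2 * (2 * of_nat k + 1) * of_rat (S k) * x ^ k)
        \<approx> inverse 2 * (b k * (- 432) ^ k * x ^ k)"
      by (intro econg_mult_left[OF *] R_inverse_2)
    moreover have "inverse 2 * (2 * d * z * w) = d * z * w" for d z w :: complex by simp
    moreover have "inverse 2 * (b k * (- 432) ^ k * x ^ k) = b k / 2 * y ^ k"
      unfolding yk divide_inverse by (simp only: mult_ac)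
    ultimately show "(2 * of_nat k + 1) * of_rat (S k) * x ^ k \<approx> b k / 2 * y ^ k"
      by (simp only:)
  qed
  have up: "of_rat (S (h + j)) * x ^ (h + j) \<approx> - (x ^ h / 8) * (t j * y ^ j)"
    and up2: "(2 * of_nat (h + j) + 1) * of_rat (S (h + j)) * x ^ (h + j) \<approx> - (x ^ h / 8) * (2 * of_nat j * t j * y ^ j)"
    if "j \<le> h" for j
  proof -
    have "- (inverse 8) * (x ^ h * x ^ j) * (- 8 * of_rat (S (h + j))) \<approx> - (inverse 8) * (x ^ h * x ^ j) * (t j * (- 432) ^ j)"
      unfolding t_def by (intro econg_mult_left S_upper[OF M that] R_rules x i8)
    moreover have "- (inverse 8) * (a * b) * (- 8 * z) = z * (a * b)" for a b z :: complex by simp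
    moreover have "- (inverse 8) * (x ^ h * x ^ j) * (t j * (- 432) ^ j) = - (x ^ h / 8) * (t j * y ^ j)"
      unfolding yk by simp
    ultimately show u: "of_rat (S (h + j)) * x ^ (h + j) \<approx> - (x ^ h / 8) * (t j * y ^ j)"
      by (simp only: power_add)
    have "2 * of_nat (h + j) + 1 \<approx> 2 * of_nat j"
    proof (rule econgI[of _ _ 1])
      have "2 * (h + j) + 1 = p + 2 * j" using p_eq by simp
      then have "(of_nat (2 * (h + j) + 1) :: complex) = of_nat (p + 2 * j)" by (simp only:)
      then show "2 * of_nat (h + j) + 1 - 2 * of_nat j = (of_nat p * 1 :: complex)" by (simp add: algebra_simps)
    qed simp
    then have "(2 * of_nat (h + j) + 1) * (of_rat (S (h + j)) * x ^ (h + j)) \<approx> 2 * of_nat j * (- (x ^ h / 8) * (t j * y ^ j))"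
      unfolding y by (intro econg_mult u[unfolded y] R_rules x tR i8)
    then show "(2 * of_nat (h + j) + 1) * of_rat (S (h + j)) * x ^ (h + j) \<approx> - (x ^ h / 8) * (2 * of_nat j * t j * y ^ j)"
      by (simp add: mult_ac)
  qed
  \<comment> \<open>As n < h and \<open>Suc M\<close> <= h, the ranges of summation contain all
    nonzero binomial coefficients, so the halves are complete Chebyshev polynomials.\<close>
  have trb: "(\<Sum>k<h. b k * g k) = (\<Sum>k\<le>n. b k * g k)" for g
    using nh by (intro sum.mono_neutral_right) (auto simp: b_def binomial_eq_0)
  have trt: "(\<Sum>j\<le>h. t j * g j) = (\<Sum>j\<le>Suc M. t j * g j)" for g
    using Mh by (intro sum.mono_neutral_right) (auto simp: t_def binomial_eq_0)
  have "(\<Sum>k = 0..p - 1. of_rat (S k) * x ^ k)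
     \<approx> (\<Sum>k<h. b k / (2 * (2 * of_nat k + 1)) * y ^ k) + (\<Sum>j\<le>h. - (x ^ h / 8) * (t j * y ^ j))"
    unfolding sum_split_middle by (intro econg_add econg_sum low up) auto
  also have "(\<Sum>k<h. b k / (2 * (2 * of_nat k + 1)) * y ^ k) = (\<Sum>k\<le>n. b k * (1 / (2 * (2 * of_nat k + 1)) * y ^ k))"
    unfolding trb[symmetric] by (intro sum.cong) simp_all
  also have "\<dots> = 1 / 2 * (\<Sum>k\<le>n. b k / (2 * of_nat k + 1) * y ^ k)"
    unfolding sum_distrib_left by (intro sum.cong) simp_all
  also have "\<dots> = (cheb_V n y + cheb_V (Suc n) y) / (2 * (2 * of_nat n + 1))"
    unfolding b_def sum_odd_denominators by simp
  also have "(\<Sum>j\<le>h. - (x ^ h / 8) * (t j * y ^ j)) = - (x ^ h / 8) * (\<Sum>j\<le>Suc M. t j * y ^ j)"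
    unfolding trt[symmetric] sum_distrib_left ..
  also have "(\<Sum>j\<le>Suc M. t j * y ^ j) = cheb_W (Suc M) y + cheb_W M y"
    unfolding t_def cheb_W_def distrib_right sum.distrib by (simp add: binomial_eq_0)
  finally show ?A by simp
  have "(\<Sum>k = 0..p - 1. (2 * of_nat k + 1) * of_rat (S k) * x ^ k)
     \<approx> (\<Sum>k<h. b k / 2 * y ^ k) + (\<Sum>j\<le>h. - (x ^ h / 8) * (2 * of_nat j * t j * y ^ j))"
    unfolding sum_split_middle by (intro econg_add econg_sum low2 up2) auto
  also have "(\<Sum>k<h. b k / 2 * y ^ k) = (\<Sum>k\<le>n. b k * (1 / 2 * y ^ k))"
    unfolding trb[symmetric] by (intro sum.cong) simp_all
  also have "\<dots> = cheb_W n y / 2"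
    unfolding cheb_W_def b_def sum_divide_distrib by (intro sum.cong) simp_all
  also have "(\<Sum>j\<le>h. - (x ^ h / 8) * (2 * of_nat j * t j * y ^ j)) = - (x ^ h / 8) * (\<Sum>j\<le>h. t j * (2 * of_nat j * y ^ j))"
    unfolding sum_distrib_left by (intro sum.cong) (simp_all add: mult_ac)
  also have "(\<Sum>j\<le>h. t j * (2 * of_nat j * y ^ j)) = (\<Sum>j\<le>Suc M. 2 * of_nat j * t j * y ^ j)"
    unfolding trt by (intro sum.cong) (simp_all add: mult_ac)
  also have "\<dots> = 2 * of_nat (Suc M) * (y * cheb_V (Suc M) y)"
    unfolding t_def by (rule sum_index_weights)
  also have "cheb_W n y / 2 + - (x ^ h / 8) * (2 * of_nat (Suc M) * (y * cheb_V (Suc M) y))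
    = cheb_W n y / 2 - x ^ h / 4 * (of_nat (Suc M) * (y * cheb_V (Suc M) y))"
    by (simp add: field_simps)
  finally show ?B .
qed

end

section \<open>Euler's criterion, Frobenius and powers of 3 in the localization\<close>

context eis_localization
begin

lemma two_h: "2 * h = p - 1" using p_eq by linarith

lemma fermat_econg_int:
  assumes "\<not> int p dvd b" shows "of_int b ^ (2 * h) \<approx> 1"
proof -
  have "int p dvd b ^ p - b" by (rule fermat_int[OF prime_p])
  moreover have "b ^ p - b = b * (b ^ (2 * h) - 1)" by (subst p_eq) (simp add: algebra_simps)
  ultimately have "int p dvd b * (b ^ (2 * h) - 1)" by simp
  then have "int p dvd b ^ (2 * h) - 1" using assms prime_p
    by (simp only: prime_dvd_mult_iff prime_nat_int_transfer simp_thms)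
  from econg_of_int[OF this] show ?thesis by simp
qed

lemma fermat_econg_rat:
  assumes r: "r \<in> D p" "\<not> rat_cong p r 0" shows "of_rat r ^ (2 * h) \<approx> 1"
proof -
  obtain a b where ab: "\<not> int p dvd b" "r = of_int a / of_int b" using r(1) unfolding D_iff by blast
  have "\<not> int p dvd a"
  proof
    assume "int p dvd a"
    then obtain a' where "a = int p * a'" by (auto simp: dvd_def)
    then have "r - 0 = of_nat p * (of_int a' / of_int b)" using ab(2) by simp
    moreover have "of_int a' / of_int b \<in> D p" using ab(1) unfolding D_iff by blast
    ultimately show False using r(2) unfolding rat_cong_def by blast
  qed
  then have a1: "of_int a ^ (2 * h) \<approx> 1" by (rule fermat_econg_int)
  have b1: "of_int b ^ (2 * h) \<approx> 1" by (rule fermat_econg_int[OF ab(1)])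
  have b0: "b \<noteq> 0" using ab(1) by auto
  have rR: "of_rat r ^ (2 * h) \<in> R" by (intro R_rules R_of_rat r)
  have "of_rat r ^ (2 * h) * 1 \<approx> of_rat r ^ (2 * h) * of_int b ^ (2 * h)"
    by (rule econg_mult_left[OF econg_sym[OF b1] rR])
  also have "of_rat r ^ (2 * h) * of_int b ^ (2 * h) = (of_rat r * of_int b) ^ (2 * h)"
    by (simp only: power_mult_distrib)
  also have "of_rat r * of_int b = (of_int a :: complex)" using b0 by (simp add: ab of_rat_divide)
  also note a1
  finally show ?thesis by simp
qed

text \<open>Euler's criterion for a b = (a / b) b^2, where b^(p - 1) = 1 mod p.\<close>

lemma rat_Legendre_econg:
  assumes r: "r \<in> D p" shows "of_int (rat_Legendre r p) \<approx> of_rat r ^ h"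
proof -
  obtain a b where q: "quotient_of r = (a, b)" by (cases "quotient_of r")
  have rab: "r = of_int a / of_int b" and b0: "b > 0" using q quotient_of_div quotient_of_denom_pos by blast+
  have nb: "\<not> int p dvd b" using r q by (simp add: D_def)
  have "[Legendre (a * b) (int p) = (a * b) ^ ((p - 1) div 2)] (mod int p)"
    using prime_p p_gt_3 by (intro euler_criterion) auto
  then have "of_int (Legendre (a * b) (int p)) \<approx> of_int ((a * b) ^ h)"
    by (intro econg_of_int) (simp add: cong_iff_dvd_diff h_def)
  also have "of_int ((a * b) ^ h) = of_rat r ^ h * (of_int b ^ (2 * h) :: complex)"
  proof -
    have "of_int ((a * b) ^ h) = ((of_int a / of_int b) * (of_int b)\<^sup>2 :: complex) ^ h"
      using b0 by (simp add: power2_eq_square)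
    then show ?thesis by (simp add: rab of_rat_divide power_mult power_mult_distrib power_divide)
  qed
  also have "\<dots> \<approx> of_rat r ^ h * 1"
    by (intro econg_mult_left fermat_econg_int nb R_rules R_of_rat r)
  finally show ?thesis by (simp add: rat_Legendre_def q)
qed

definition s :: complex where "s = 1 + 2 * complex_omega"

lemma s_square: "s * s = - 3"
proof -
  have "s * s = 1 + 4 * complex_omega + 4 * (complex_omega * complex_omega)"
    unfolding s_def by (simp add: algebra_simps)
  then show ?thesis unfolding complex_omega_square by simp
qed

lemma s_in_R [intro, simp]: "s \<in> R" unfolding s_def by (intro R_rules)

lemma omega_cube_complex: "complex_omega ^ 3 = 1"
  using arg_cong[OF omega_cube, of complex_of_eisenstein] by (simp add: eis_rep)

lemma frobenius_econg:
  assumes m: "x \<approx> of_int m"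
  shows "p mod 3 = 1 \<Longrightarrow> (x + of_int e * s) ^ p \<approx> x + of_int e * s"
    and "p mod 3 = 2 \<Longrightarrow> (x + of_int e * s) ^ p \<approx> x - of_int e * s"
proof -
  define z where "z = of_int m + of_int e * (1 + 2 * omega)"
  have z: "complex_of_eisenstein z = of_int m + of_int e * s" by (simp add: z_def s_def eis_rep)
  have zc: "complex_of_eisenstein (eis_cnj z) = of_int m - of_int e * s"
    by (simp add: z_def s_def eis_rep cnj_complex_omega algebra_simps)
  have 1: "x + of_int e * s \<approx> of_int m + of_int e * s" "x - of_int e * s \<approx> of_int m - of_int e * s"
    using m by (auto intro: econg_add econg_diff)
  have 2: "(x + of_int e * s) ^ p \<approx> (of_int m + of_int e * s) ^ p"
    by (rule econg_power[OF 1(1)]) (intro R_rules s_in_R)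
  show "(x + of_int e * s) ^ p \<approx> x + of_int e * s" if "p mod 3 = 1"
  proof -
    have "complex_of_eisenstein (z ^ p) \<approx> complex_of_eisenstein z"
      by (intro econg_eisenstein eis_frobenius_split prime_p that)
    then have "(of_int m + of_int e * s) ^ p \<approx> of_int m + of_int e * s" by (simp add: z)
    from econg_trans[OF 2 econg_trans[OF this econg_sym[OF 1(1)]]] show ?thesis .
  qed
  show "(x + of_int e * s) ^ p \<approx> x - of_int e * s" if "p mod 3 = 2"
  proof -
    have "complex_of_eisenstein (z ^ p) \<approx> complex_of_eisenstein (eis_cnj z)"
      by (intro econg_eisenstein eis_frobenius_inert prime_p that)
    then have "(of_int m + of_int e * s) ^ p \<approx> of_int m - of_int e * s" by (simp add: z zc)
    from econg_trans[OF 2 econg_trans[OF this econg_sym[OF 1(2)]]] show ?thesis .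
  qed
qed

text \<open>Cancels the denominator 2 n + 1 of the lower half of the first sum against (3/p) and the
  sign produced by u = -v. With d = (-3/p), one has 3 (2 n + 1) = p + 2 d, and h + n is
  even.\<close>

lemma three_power_econg:
  assumes n: "6 * n + 1 = p \<or> 6 * n + 5 = p"
  shows "2 * 3 ^ h * (- 1) ^ n \<approx> 3 * (2 * of_nat n + 1)"
proof -
  define d :: int where "d = (if p mod 3 = 1 then 1 else - 1)"
  have "of_int ((- 3) ^ h) \<approx> of_int d"
    unfolding d_def h_def by (intro econg_of_int minus_three_power prime_p p_gt_3)
  then have *: "2 * (- 3) ^ h \<approx> 2 * of_int d" by (intro econg_mult_left) auto
  have "even (h + n)" "3 * (2 * int n + 1) = int p + 2 * d"
  proof -
    have "h = 3 * n \<or> h = 3 * n + 2" using n p_eq by presburger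
    then show "even (h + n)" by presburger
    from n show "3 * (2 * int n + 1) = int p + 2 * d"
    proof
      assume p: "6 * n + 1 = p"
      then have "p mod 3 = 1" by presburger
      then show ?thesis using p by (simp add: d_def)
    next
      assume p: "6 * n + 5 = p"
      then have "p mod 3 = 2" by presburger
      then show ?thesis using p by (simp add: d_def)
    qed
  qed
  have "3 ^ h * (- 1) ^ n = (- 3 :: complex) ^ h * ((- 1) ^ h * (- 1) ^ n)"
    by (simp flip: power_mult_distrib mult.assoc)
  also have "(- 1 :: complex) ^ h * (- 1) ^ n = 1" using \<open>even (h + n)\<close> by (simp flip: power_add)
  finally have "2 * 3 ^ h * (- 1) ^ n = 2 * (- 3 :: complex) ^ h" by simp
  also note *
  also have "2 * of_int d \<approx> 3 * (2 * of_nat n + 1)"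
  proof (rule econgI[of _ _ "- 1"])
    have "(of_int (3 * (2 * int n + 1)) :: complex) = of_int (int p + 2 * d)"
      using \<open>3 * (2 * int n + 1) = int p + 2 * d\<close> by (simp only:)
    then show "2 * of_int d - 3 * (2 * of_nat n + 1) = (of_nat p * - 1 :: complex)" by simp
  qed simp
  finally show ?thesis .
qed

lemma not_one_econg_zero: "\<not> 1 \<approx> 0"
proof
  assume "1 \<approx> 0"
  then have "of_rat 1 \<approx> of_rat 0" by simp
  then have "rat_cong p 1 0" by (simp only: econg_of_rat_iff)
  then obtain z where "z \<in> D p" "1 = of_nat p * z" unfolding rat_cong_def by auto
  then obtain a b where ab: "\<not> int p dvd b" "1 = of_nat p * (of_int a / of_int b :: rat)" unfolding D_iff by blast
  then have "b \<noteq> 0" by auto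
  then have "(of_int b :: rat) = of_int (int p * a)" using ab(2) by (simp add: field_simps)
  then have "b = int p * a" by (simp only: of_int_eq_iff)
  then show False using ab(1) by simp
qed

text \<open>These powers z satisfy z + z^2 = -1; z = 1 mod p would make 3 vanish modulo p.\<close>

lemma omega_power_not_econg_one:
  assumes "j \<in> {1, 2 :: nat}" shows "\<not> complex_omega ^ j \<approx> 1"
proof
  assume *: "complex_omega ^ j \<approx> 1"
  have "(complex_omega ^ j) ^ k \<approx> 1" for k
    using econg_power[OF * R_1, of k] by simp
  from this[of 2] have "complex_omega ^ j + (complex_omega ^ j)\<^sup>2 \<approx> 1 + 1" by (rule econg_add[OF *])
  moreover have "complex_omega ^ j + (complex_omega ^ j)\<^sup>2 = - 1"
  proof -
    have w: "complex_omega\<^sup>2 = - 1 - complex_omega" using complex_omega_square by (simp add: power2_eq_square)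
    have "(- 1 - complex_omega) + (- 1 - complex_omega)\<^sup>2 = complex_omega + complex_omega\<^sup>2"
      by (simp add: power2_eq_square algebra_simps)
    then have "(- 1 - complex_omega) + (- 1 - complex_omega)\<^sup>2 = - 1" unfolding w by simp
    then show ?thesis using assms by (elim insertE emptyE) (simp_all add: w)
  qed
  ultimately have "- 1 + 1 \<approx> 1 + 1 + 1" by (intro econg_add) auto
  then have "0 \<approx> 3" by simp
  then have "3 \<approx> 0" by (rule econg_sym)
  then have "inverse 3 * 3 \<approx> inverse 3 * 0" by (rule econg_mult_left[OF _ R_inverse_3])
  then show False using not_one_econg_zero by simp
qed


section \<open>The quantities v and W attached to c and its cubic symbol\<close>

context
  fixes c :: rat and m :: int and j :: nat
  assumes c: "c \<in> D p" and c3: "\<not> rat_cong p (c\<^sup>2) (- 3)"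
    and m: "rat_cong p c (of_int m)"
    and sym: "cubic_symbol (of_int m + 1 + 2 * omega) p = omega ^ j"
begin

definition cc :: complex where "cc = of_rat c"
definition v :: complex where "v = (cc + s) / (cc - s)"
definition v' :: complex where "v' = (cc - s) / (cc + s)"
definition W :: complex where "W = complex_omega ^ j"

lemma cc_R: "cc \<in> R" unfolding cc_def by (rule R_of_rat[OF c])

lemma c3_D: "c\<^sup>2 + 3 \<in> D p"
  using D_add[OF prime_p D_mult[OF prime_p c c] of_int_in_D[OF prime_p, of 3]] by (simp add: power2_eq_square)

lemma c3_unit: "\<not> rat_cong p (c\<^sup>2 + 3) 0"
  using c3 unfolding rat_cong_def by simp

lemma c3_complex: "of_rat (c\<^sup>2 + 3) = (cc + s) * (cc - s)"
proof -
  have "(cc + s) * (cc - s) = cc * cc - s * s" by (simp add: algebra_simps)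
  then show ?thesis unfolding s_square by (simp add: cc_def of_rat_add of_rat_power power2_eq_square of_rat_mult)
qed

lemma inverse_c3: "inverse ((cc + s) * (cc - s)) \<in> R"
  unfolding c3_complex[symmetric] by (rule R_inverse_of_rat[OF c3_D c3_unit])

lemma cs_nonzero: "cc + s \<noteq> 0" "cc - s \<noteq> 0"
proof -
  have "c\<^sup>2 + 3 \<noteq> 0" using c3_unit of_int_in_D[OF prime_p, of 0] unfolding rat_cong_def by auto
  then have "(of_rat (c\<^sup>2 + 3) :: complex) \<noteq> 0" by (simp only: of_rat_eq_0_iff not_False_eq_True)
  then show "cc + s \<noteq> 0" "cc - s \<noteq> 0" unfolding c3_complex by auto
qed

lemma cs_R: "cc + s \<in> R" "cc - s \<in> R" by (intro R_rules cc_R s_in_R)+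

lemma inverse_cs: "inverse (cc + s) \<in> R" "inverse (cc - s) \<in> R"
proof -
  have "inverse (cc + s) = (cc - s) * inverse ((cc + s) * (cc - s))" using cs_nonzero by simp
  then show "inverse (cc + s) \<in> R" using R_mult[OF cs_R(2) inverse_c3] by (simp only:)
  have "inverse (cc - s) = (cc + s) * inverse ((cc + s) * (cc - s))" using cs_nonzero by simp
  then show "inverse (cc - s) \<in> R" using R_mult[OF cs_R(1) inverse_c3] by (simp only:)
qed

lemma v_R: "v \<in> R" "v' \<in> R" unfolding v_def v'_def by (intro R_rules cs_R inverse_cs)+
lemma W_R: "W \<in> R" unfolding W_def by (intro R_rules)
lemma vv': "v * v' = 1" unfolding v_def v'_def using cs_nonzero by simp
lemma W3: "W ^ 3 = 1"
proof -
  have "W ^ 3 = (complex_omega ^ 3) ^ j" unfolding W_def by (simp add: mult.commute flip: power_mult)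
  then show ?thesis by (simp add: omega_cube_complex)
qed

lemma cc_m: "cc \<approx> of_int m"
  using m unfolding econg_of_rat_iff[symmetric] cc_def by simp

text \<open>The power p - 1 of c - s or c + s is the Frobenius image divided by the element: 1 if p
  splits, and the conjugate quotient, v or v', if p is inert.\<close>

lemma frobenius_cs:
  "p mod 3 = 1 \<Longrightarrow> (cc - s) ^ (2 * h) \<approx> 1"
  "p mod 3 = 2 \<Longrightarrow> (cc - s) ^ (2 * h) \<approx> v"
  "p mod 3 = 2 \<Longrightarrow> (cc + s) ^ (2 * h) \<approx> v'"
proof -
  have pw: "x ^ p = x * x ^ (2 * h)" for x :: complex by (subst p_eq) simp
  have pw1: "(cc - s) * (cc - s) ^ (2 * h) = (cc + of_int (- 1) * s) ^ p"
    and pw2: "(cc + s) * (cc + s) ^ (2 * h) = (cc + of_int 1 * s) ^ p" unfolding pw by simp_all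
  show "(cc - s) ^ (2 * h) \<approx> 1" if "p mod 3 = 1"
  proof (rule econg_cancel[OF _ inverse_cs(2) cs_nonzero(2)])
    show "(cc - s) * (cc - s) ^ (2 * h) \<approx> (cc - s) * 1"
      unfolding pw1 using frobenius_econg(1)[OF cc_m that, of "- 1"] by simp
  qed
  show "(cc - s) ^ (2 * h) \<approx> v" if "p mod 3 = 2"
  proof (rule econg_cancel[OF _ inverse_cs(2) cs_nonzero(2)])
    have "(cc - s) * v = cc + s" using cs_nonzero by (simp add: v_def)
    then show "(cc - s) * (cc - s) ^ (2 * h) \<approx> (cc - s) * v"
      unfolding pw1 using frobenius_econg(2)[OF cc_m that, of "- 1"] by simp
  qed
  show "(cc + s) ^ (2 * h) \<approx> v'" if "p mod 3 = 2"
  proof (rule econg_cancel[OF _ inverse_cs(1) cs_nonzero(1)])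
    have "(cc + s) * v' = cc - s" using cs_nonzero by (simp add: v'_def)
    then show "(cc + s) * (cc + s) ^ (2 * h) \<approx> (cc + s) * v'"
      unfolding pw2 using frobenius_econg(2)[OF cc_m that, of 1] by simp
  qed
qed

text \<open>Write c^2 + 3 = (c - s)^2 v; its h-th power is (c - s)^(p - 1) v^h, and an inert p
  contributes one more v.\<close>

lemma c3_power:
  "p mod 3 = 1 \<Longrightarrow> of_rat (c\<^sup>2 + 3) ^ h \<approx> v ^ h"
  "p mod 3 = 2 \<Longrightarrow> of_rat (c\<^sup>2 + 3) ^ h \<approx> v ^ Suc h"
proof -
  have "(cc + s) * (cc - s) = (cc - s)\<^sup>2 * v" using cs_nonzero by (simp add: v_def power2_eq_square)
  then have e: "of_rat (c\<^sup>2 + 3) ^ h = (cc - s) ^ (2 * h) * v ^ h"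
    unfolding c3_complex by (simp add: power_mult_distrib power_mult)
  have "(cc - s) ^ (2 * h) * v ^ h \<approx> 1 * v ^ h" if "p mod 3 = 1"
    by (intro econg_mult_right frobenius_cs that R_rules v_R)
  then show "p mod 3 = 1 \<Longrightarrow> of_rat (c\<^sup>2 + 3) ^ h \<approx> v ^ h" unfolding e by simp
  have "(cc - s) ^ (2 * h) * v ^ h \<approx> v * v ^ h" if "p mod 3 = 2"
    by (intro econg_mult_right frobenius_cs that R_rules v_R)
  then show "p mod 3 = 2 \<Longrightarrow> of_rat (c\<^sup>2 + 3) ^ h \<approx> v ^ Suc h" unfolding e by simp
qed

lemma symbol_split: assumes p1: "p mod 3 = 1" shows "v ^ ((p - 1) div 3) \<approx> W"
proof -
  define N where "N = (p - 1) div 3"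
  define \<alpha> where "\<alpha> = of_int m + 1 + 2 * omega"
  have a: "complex_of_eisenstein \<alpha> = of_int m + s" "complex_of_eisenstein (eis_cnj \<alpha>) = of_int m - s"
    by (simp_all add: \<alpha>_def s_def eis_rep cnj_complex_omega algebra_simps)
  have "complex_of_eisenstein (\<alpha> ^ N) \<approx> complex_of_eisenstein (omega ^ j * eis_cnj \<alpha> ^ N)"
    unfolding N_def \<alpha>_def by (intro econg_eisenstein cubic_symbol_split prime_p p1 sym)
  then have 1: "(of_int m + s) ^ N \<approx> W * (of_int m - s) ^ N"
    by (simp only: a times_eisenstein.rep_eq omega.rep_eq complex_of_eisenstein_power W_def)
  have "(cc + s) ^ N \<approx> (of_int m + s) ^ N"
    by (intro econg_power econg_add cc_m econg_refl R_rules s_in_R)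
  also note 1
  also have "W * (of_int m - s) ^ N \<approx> W * (cc - s) ^ N"
    by (intro econg_mult_left econg_power econg_diff econg_sym[OF cc_m] econg_refl cs_R W_R)
  finally have "(cc - s) ^ N * v ^ N \<approx> (cc - s) ^ N * W"
    using cs_nonzero by (simp add: v_def power_divide mult.commute)
  then have "v ^ N \<approx> W" by (rule econg_cancel) (use inverse_cs cs_nonzero in \<open>auto intro: R_inverse_power\<close>)
  then show ?thesis by (simp add: N_def)
qed

text \<open>The factor p - 1 of the exponent turns c + s into v', and the factor (p + 1) / 3
  remains.\<close>

lemma symbol_inert: assumes p2: "p mod 3 = 2" shows "v' ^ ((p + 1) div 3) \<approx> W"
proof -
  define N where "N = (p + 1) div 3"
  define \<alpha> where "\<alpha> = of_int m + 1 + 2 * omega"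
  have a: "complex_of_eisenstein \<alpha> = of_int m + s" by (simp add: \<alpha>_def s_def eis_rep)
  have "complex_of_eisenstein (\<alpha> ^ ((p - 1) * N)) \<approx> complex_of_eisenstein (omega ^ j)"
    unfolding N_def \<alpha>_def by (intro econg_eisenstein cubic_symbol_inert prime_p p2 p_gt_3 sym)
  then have 1: "(of_int m + s) ^ (2 * h * N) \<approx> W" unfolding two_h by (simp add: a eis_rep W_def)
  have "v' ^ N \<approx> ((cc + s) ^ (2 * h)) ^ N"
    by (rule econg_sym, intro econg_power frobenius_cs p2 v_R)
  also have "((cc + s) ^ (2 * h)) ^ N = (cc + s) ^ (2 * h * N)" by (simp only: power_mult)
  also have "\<dots> \<approx> (of_int m + s) ^ (2 * h * N)"
    by (intro econg_power econg_add cc_m econg_refl R_rules s_in_R)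
  also note 1
  finally show ?thesis by (simp add: N_def)
qed


text \<open>As W^3 = 1, the inverse of W is W^2.\<close>

lemma inverse_power_econg:
  assumes "x * y = 1" "x ^ N \<approx> W" "y \<in> R" shows "y ^ N \<approx> W\<^sup>2"
proof -
  have "y ^ N = y ^ N * (W * W\<^sup>2)" using W3 by (simp add: power3_eq_cube power2_eq_square mult.assoc)
  also have "\<dots> \<approx> y ^ N * (x ^ N * W\<^sup>2)"
    by (intro econg_mult_left econg_mult_right econg_sym[OF assms(2)] R_rules W_R assms(3))
  also have "y ^ N * (x ^ N * W\<^sup>2) = W\<^sup>2"
  proof -
    have "y ^ N * x ^ N = 1" using assms(1) by (metis mult.commute power_mult_distrib power_one)
    then show ?thesis by (simp flip: mult.assoc)
  qed
  finally show ?thesis .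
qed

context
  fixes n M :: nat
  assumes nM: "6 * n + 1 = p \<and> Suc M = 2 * n \<or> 6 * n + 5 = p \<and> Suc M = 2 * n + 2"
begin

lemma n_cases: "6 * n + 1 = p \<or> 6 * n + 5 = p" using nM by blast
lemma M_cases: "3 * Suc M = p + 1 \<or> 3 * Suc M + 1 = p" using nM by presburger
lemma even_SucM: "even (Suc M)" using nM by presburger

lemma powers_split: "6 * n + 1 = p \<Longrightarrow> v ^ (2 * n) \<approx> W \<and> v' ^ (2 * n) \<approx> W\<^sup>2"
proof -
  assume p: "6 * n + 1 = p"
  then have "p mod 3 = 1" "(p - 1) div 3 = 2 * n" by presburger+
  then have "v ^ (2 * n) \<approx> W" using symbol_split by simp
  then show ?thesis using inverse_power_econg[OF vv' _ v_R(2)] by blast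
qed

lemma powers_inert: "6 * n + 5 = p \<Longrightarrow> v' ^ (2 * n + 2) \<approx> W \<and> v ^ (2 * n + 2) \<approx> W\<^sup>2"
proof -
  assume p: "6 * n + 5 = p"
  then have "p mod 3 = 2" "(p + 1) div 3 = 2 * n + 2" by presburger+
  then have "v' ^ (2 * n + 2) \<approx> W" using symbol_inert by simp
  moreover have "v' * v = 1" using vv' by (simp add: mult.commute)
  ultimately show ?thesis using inverse_power_econg[OF _ _ v_R(1)] by blast
qed

text \<open>If p splits, h = 3 n and the two terms are v * v^(4n) and v^(2n), with v^(2n) = W. If p
  is inert, h + 1 = 3 n + 3 and they are v^(4n+4) and v * v^(2n+2), with v^(2n+2) = W^2. The two
  terms change roles and the sum is the same.\<close>

lemma lower_econg: "of_rat (c\<^sup>2 + 3) ^ h * (v ^ Suc n + v' ^ n) \<approx> v * W\<^sup>2 + W"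
proof -
  have 1: "v ^ k * (v' ^ k * x) = x" for k x
    using vv' by (metis mult.assoc mult_1 power_mult_distrib power_one)
  have gR: "v ^ Suc n + v' ^ n \<in> R" by (intro R_rules v_R)
  show ?thesis using n_cases
  proof
    assume p: "6 * n + 1 = p"
    then have p1: "p mod 3 = 1" and h3: "h = 2 * n + n" using p_eq by presburger+
    have "of_rat (c\<^sup>2 + 3) ^ h * (v ^ Suc n + v' ^ n) \<approx> v ^ h * (v ^ Suc n + v' ^ n)"
      by (intro econg_mult_right c3_power p1 gR)
    also have "v ^ h * (v ^ Suc n + v' ^ n) = v * (v ^ (2 * n) * v ^ (2 * n)) + v ^ (2 * n)"
    proof -
      have "v ^ n * v ^ Suc n = v * v ^ (2 * n)" by (simp add: mult_2 power_add)
      moreover have "v ^ n * v' ^ n = 1" using 1[of n 1] by simp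
      ultimately have "v ^ n * (v ^ Suc n + v' ^ n) = v * v ^ (2 * n) + 1" by (simp only: distrib_left)
      then show ?thesis unfolding h3 power_add mult.assoc by (simp add: algebra_simps)
    qed
    also have "\<dots> \<approx> v * (W * W) + W"
      using powers_split[OF p] by (intro econg_add econg_mult_left econg_mult v_R W_R) auto
    finally show ?thesis by (simp add: power2_eq_square)
  next
    assume p: "6 * n + 5 = p"
    then have p2: "p mod 3 = 2" and h3: "Suc h = (2 * n + 2) + (n + 1)" using p_eq by presburger+
    have "of_rat (c\<^sup>2 + 3) ^ h * (v ^ Suc n + v' ^ n) \<approx> v ^ Suc h * (v ^ Suc n + v' ^ n)"
      by (intro econg_mult_right c3_power p2 gR)
    also have "v ^ Suc h * (v ^ Suc n + v' ^ n) = v ^ (2 * n + 2) * v ^ (2 * n + 2) + v * v ^ (2 * n + 2)"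
    proof -
      have "v ^ (n + 1) * v ^ Suc n = v ^ (2 * n + 2)" by (simp add: mult_2 power_add)
      moreover have "v ^ (n + 1) * v' ^ n = v" using 1[of n 1] by simp
      ultimately have "v ^ (n + 1) * (v ^ Suc n + v' ^ n) = v ^ (2 * n + 2) + v" by (simp only: distrib_left)
      then show ?thesis unfolding h3 power_add[of v "2 * n + 2"] mult.assoc by (simp add: distrib_left mult.commute)
    qed
    also have "\<dots> \<approx> W\<^sup>2 * W\<^sup>2 + v * W\<^sup>2"
      using powers_inert[OF p] by (intro econg_add econg_mult_left econg_mult R_rules v_R W_R) auto
    also have "W\<^sup>2 * W\<^sup>2 + v * W\<^sup>2 = v * W\<^sup>2 + W"
    proof -
      have "W\<^sup>2 * W\<^sup>2 = W ^ 3 * W" by (simp add: power2_eq_square power3_eq_cube)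
      then show ?thesis unfolding W3 by simp
    qed
    finally show ?thesis .
  qed
qed

lemma upper_sum_econg: "v ^ Suc M + v' ^ Suc M \<approx> W + W\<^sup>2"
  using nM
proof
  assume p: "6 * n + 1 = p \<and> Suc M = 2 * n"
  then show ?thesis using powers_split by (metis econg_add)
next
  assume p: "6 * n + 5 = p \<and> Suc M = 2 * n + 2"
  then have "v ^ Suc M + v' ^ Suc M \<approx> W\<^sup>2 + W" using powers_inert by (metis econg_add)
  then show ?thesis by (simp add: add.commute)
qed

text \<open>Two signs compensate: 3 N is -1 or 1 modulo p, and v^N is W or W^2, in the split and the
  inert case.\<close>

lemma upper_diff_econg: "3 * of_nat (Suc M) * (v ^ Suc M - v' ^ Suc M) \<approx> W\<^sup>2 - W"
  using nM
proof
  assume p: "6 * n + 1 = p \<and> Suc M = 2 * n"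
  have 1: "3 * of_nat (Suc M) \<approx> - 1"
  proof (rule econgI[of _ _ 1])
    have "3 * Suc M + 1 = p" using p by presburger
    then have "(of_nat (3 * Suc M + 1) :: complex) = of_nat p" by (simp only:)
    then show "3 * of_nat (Suc M) - (- 1) = (of_nat p * 1 :: complex)" by simp
  qed simp
  have 2: "v ^ Suc M - v' ^ Suc M \<approx> W - W\<^sup>2" using powers_split p by (metis econg_diff)
  have "3 * of_nat (Suc M) * (v ^ Suc M - v' ^ Suc M) \<approx> - 1 * (W - W\<^sup>2)"
    by (intro econg_mult 1 2 R_rules W_R)
  then show ?thesis by simp
next
  assume p: "6 * n + 5 = p \<and> Suc M = 2 * n + 2"
  have 1: "3 * of_nat (Suc M) \<approx> 1"
  proof (rule econgI[of _ _ 1])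
    have "3 * Suc M = p + 1" using p by presburger
    then have "(of_nat (3 * Suc M) :: complex) = of_nat (p + 1)" by (simp only:)
    then show "3 * of_nat (Suc M) - 1 = (of_nat p * 1 :: complex)" by simp
  qed simp
  have 2: "v ^ Suc M - v' ^ Suc M \<approx> W\<^sup>2 - W" using powers_inert p by (metis econg_diff)
  have "3 * of_nat (Suc M) * (v ^ Suc M - v' ^ Suc M) \<approx> 1 * (W\<^sup>2 - W)"
    by (intro econg_mult 1 2 R_rules W_R)
  then show ?thesis by simp
qed


section \<open>Evaluation of both sums when c is a unit modulo p\<close>

context
  assumes cu: "\<not> rat_cong p c 0"
begin

lemma cc_nonzero: "cc \<noteq> 0"
proof
  assume "cc = 0"
  then have "c = 0" by (simp add: cc_def)
  then show False using cu of_int_in_D[OF prime_p, of 0] by (auto simp: rat_cong_def)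
qed

lemma inverse_cc: "inverse cc \<in> R" unfolding cc_def by (rule R_inverse_of_rat[OF c cu])

lemma v_plus_1: "v + 1 = 2 * cc / (cc - s)" unfolding v_def using cs_nonzero by (simp add: divide_simps)
lemma v_minus_1: "v - 1 = 2 * s / (cc - s)" unfolding v_def using cs_nonzero by (simp add: divide_simps)

lemma s_nonzero: "s \<noteq> 0" using s_square by auto

lemma v_not_plus_minus_1: "v + 1 \<noteq> 0" "v \<noteq> 1" "v \<noteq> - 1"
proof -
  show a: "v + 1 \<noteq> 0" unfolding v_plus_1 using cs_nonzero cc_nonzero by simp
  then show "v \<noteq> - 1" by auto
  have "v - 1 \<noteq> 0" unfolding v_minus_1 using cs_nonzero s_nonzero by simp
  then show "v \<noteq> 1" by auto
qed

lemma inverse_v_plus_1: "inverse (v + 1) \<in> R"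
proof -
  have "inverse (v + 1) = (cc - s) * (inverse 2 * inverse cc)"
    unfolding v_plus_1 using cs_nonzero cc_nonzero by (simp add: field_simps)
  moreover have "(cc - s) * (inverse 2 * inverse cc) \<in> R" by (intro R_rules cs_R inverse_cc R_inverse_2)
  ultimately show ?thesis by (simp only:)
qed

text \<open>For the upper halves: the base of the Legendre symbol times the argument of the sum is
  (c / 6)^2 in the first congruence and (1 / 6)^2 in the second, so the factor in front becomes a (p
  - 1)-th power.\<close>

lemma power_div_36_econg:
  assumes "x \<in> R" "x ^ (2 * h) \<approx> 1" shows "(x\<^sup>2 / 36) ^ h \<approx> 1"
proof -
  have "6 ^ (2 * h) \<approx> 1"
  proof -
    have "\<not> int p dvd 6"
    proof
      assume "int p dvd 6"
      then have "int p dvd 2 * 3" by simp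
      then have "int p dvd 2 \<or> int p dvd 3" using prime_p by (simp only: prime_dvd_mult_iff prime_nat_int_transfer)
      then show False using p_gt_3 by (auto dest: zdvd_imp_le)
    qed
    from fermat_econg_int[OF this] show ?thesis by simp
  qed
  moreover have "(x\<^sup>2 / 36) ^ h \<in> R"
  proof -
    have "(x\<^sup>2 / 36) ^ h = (x\<^sup>2 * (inverse 2 * inverse 3)\<^sup>2) ^ h" by (simp add: power2_eq_square)
    moreover have "\<dots> \<in> R" by (intro R_rules R_inverse_2 R_inverse_3 assms(1))
    ultimately show ?thesis by (simp only:)
  qed
  ultimately have "(x\<^sup>2 / 36) ^ h * 1 \<approx> (x\<^sup>2 / 36) ^ h * 6 ^ (2 * h)"
    by (intro econg_mult_left econg_sym[of "6 ^ (2 * h)" 1])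
  also have "(x\<^sup>2 / 36) ^ h * 6 ^ (2 * h) = x ^ (2 * h)"
    unfolding power_mult power_mult_distrib[symmetric] by simp
  also note assms(2)
  finally show ?thesis by simp
qed

lemma R_inverse_numerals: "inverse 36 \<in> R" "inverse 108 \<in> R" "inverse 8 \<in> R" "inverse 4 \<in> R" "inverse 12 \<in> R"
  using R_inverse_mult[OF R_inverse_power[OF R_inverse_2, of 2] R_inverse_power[OF R_inverse_3, of 2]]
    R_inverse_mult[OF R_inverse_power[OF R_inverse_2, of 2] R_inverse_power[OF R_inverse_3, of 3]]
    R_inverse_power[OF R_inverse_2, of 3] R_inverse_power[OF R_inverse_2, of 2]
    R_inverse_mult[OF R_inverse_power[OF R_inverse_2, of 2] R_inverse_3] by simp_all

lemma lower_div_econg: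
  "of_rat (c\<^sup>2 + 3) ^ h * (v ^ Suc n + v' ^ n) / (v + 1) \<approx> (v * W\<^sup>2 + W) / (v + 1)"
  by (intro econg_divide lower_econg inverse_v_plus_1)

lemma A_econg:
  "of_int (rat_Legendre (3 * (c\<^sup>2 + 3)) p) * (\<Sum>k = 0..p - 1. of_rat (S k) * of_rat (c\<^sup>2 / (108 * (c\<^sup>2 + 3))) ^ k)
    \<approx> 3 / 4 * ((v * W\<^sup>2 + W) / (v + 1)) - (W + W\<^sup>2) / 8"
proof -
  define C3 x y where "C3 = (of_rat (c\<^sup>2 + 3) :: complex)" and "x = (of_rat (c\<^sup>2 / (108 * (c\<^sup>2 + 3))) :: complex)"
    and "y = - 432 * x"
  define g where "g = v ^ Suc n + v' ^ n"
  have C30: "C3 \<noteq> 0" unfolding C3_def c3_complex using cs_nonzero by simp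
  have x: "x = cc\<^sup>2 / (108 * C3)" unfolding x_def C3_def cc_def by (simp only: of_rat_divide of_rat_mult of_rat_power of_rat_numeral_eq)
  have C3i: "inverse C3 \<in> R" unfolding C3_def c3_complex by (rule inverse_c3)
  have C3R: "C3 \<in> R" unfolding C3_def by (rule R_of_rat[OF c3_D])
  have xR: "x \<in> R" unfolding x by (intro R_rules cc_R C3i R_inverse_numerals)
  \<comment> \<open>Here y = -4 c^2 / (c^2 + 3), and v + 1 / v + 2 = 4 c^2 / (c^2 + 3); hence u =
    -v.\<close>
  have y: "y = (- v) + (- v') - 2"
  proof -
    have "y = - (4 * cc\<^sup>2 / C3)" unfolding y_def x using C30 by (simp add: divide_simps)
    also have "\<dots> = (- v) + (- v') - 2"
      unfolding C3_def c3_complex v_def v'_def using cs_nonzero by (simp add: divide_simps power2_eq_square) (simp add: algebra_simps)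
    finally show ?thesis .
  qed
  have ut: "(- v) * (- v') = 1" using vv' by simp
  have u: "- v \<noteq> 1" "- v \<noteq> - 1" using v_not_plus_minus_1 by (auto simp: minus_equation_iff[of v])
  have dn: "2 * of_nat n + 1 = (of_nat (2 * n + 1) :: complex)" by simp
  have n1: "2 * n + 1 < p" using n_cases p_gt_3 by presburger
  have di: "inverse (2 * of_nat n + 1) \<in> R" unfolding dn using n1 by (intro R_inverse_of_nat) auto
  have d0: "2 * of_nat n + 1 \<noteq> (0 :: complex)" unfolding dn of_nat_eq_0_iff by simp
  have Vs: "cheb_V n y + cheb_V (Suc n) y = (- 1) ^ n * g / (v + 1)"
  proof -
    have "cheb_V n y + cheb_V (Suc n) y = ((- v) ^ Suc n - (- v') ^ n) / (- v - 1)"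
      by (rule cheb_values[OF ut y u])
    also have "(- v) ^ Suc n - (- v') ^ n = - ((- 1) ^ n * g)"
      unfolding power_minus[of v] power_minus[of v'] g_def by (simp add: algebra_simps)
    also have "- v - 1 = - (v + 1)" by simp
    finally show ?thesis by (simp only: minus_divide_divide)
  qed
  have Ws: "cheb_W (Suc M) y + cheb_W M y = v ^ Suc M + v' ^ Suc M"
    unfolding cheb_values(3)[OF ut y u] using even_SucM by (simp only: power_minus_even)
  have gR: "g \<in> R" unfolding g_def by (intro R_rules v_R)
  have S: "(\<Sum>k = 0..p - 1. of_rat (S k) * x ^ k)
      \<approx> (- 1) ^ n * g / (v + 1) / (2 * (2 * of_nat n + 1)) - x ^ h / 8 * (v ^ Suc M + v' ^ Suc M)"
    using sum_S_econg(1)[OF n_cases M_cases xR y_def] unfolding Vs Ws .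
  have L: "of_int (rat_Legendre (3 * (c\<^sup>2 + 3)) p) \<approx> (3 * C3) ^ h"
  proof -
    have "3 * (c\<^sup>2 + 3) \<in> D p" using D_mult[OF prime_p of_int_in_D[OF prime_p, of 3] c3_D] by simp
    from rat_Legendre_econg[OF this] show ?thesis unfolding C3_def by (simp only: of_rat_mult of_rat_numeral_eq)
  qed
  have "of_int (rat_Legendre (3 * (c\<^sup>2 + 3)) p) * (\<Sum>k = 0..p - 1. of_rat (S k) * x ^ k)
     \<approx> (3 * C3) ^ h * ((- 1) ^ n * g / (v + 1) / (2 * (2 * of_nat n + 1)) - x ^ h / 8 * (v ^ Suc M + v' ^ Suc M))"
    by (intro econg_mult L S R_rules C3R gR xR v_R di inverse_v_plus_1 R_inverse_2 R_inverse_numerals)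
  \<comment> \<open>Regrouped so that 3^h (-1)^n meets 1 / (2 n + 1), and the power of c^2 + 3 meets
    g.\<close>
  also have "\<dots> = (2 * 3 ^ h * (- 1) ^ n) * (inverse 4 * inverse (2 * of_nat n + 1)) * (C3 ^ h * g / (v + 1))
     - (cc\<^sup>2 / 36) ^ h * ((v ^ Suc M + v' ^ Suc M) / 8)"
  proof -
    have "cc\<^sup>2 / 36 = 3 * C3 * x" unfolding x using C30 by (simp add: divide_simps)
    then have e: "(cc\<^sup>2 / 36) ^ h = (3 * C3) ^ h * x ^ h" by (simp only: power_mult_distrib)
    have "t3 * tc * (m1 * g / d / (2 * e)) = (2 * t3 * m1) * (inverse 4 * inverse e) * (tc * g / d)"
      for t3 tc m1 d e :: complex by (cases "d = 0"; cases "e = 0") (simp_all add: field_simps)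
    then have "3 ^ h * C3 ^ h * ((- 1) ^ n * g / (v + 1) / (2 * (2 * of_nat n + 1)))
      = (2 * 3 ^ h * (- 1) ^ n) * (inverse 4 * inverse (2 * of_nat n + 1)) * (C3 ^ h * g / (v + 1))" by blast
    moreover have "t * (a - b / 8 * z) = t * a - t * b * (z / 8)" for t a b z :: complex
      by (simp add: algebra_simps)
    ultimately show ?thesis unfolding e by (simp only: power_mult_distrib)
  qed
  also have "\<dots> \<approx> (3 * (2 * of_nat n + 1)) * (inverse 4 * inverse (2 * of_nat n + 1)) * ((v * W\<^sup>2 + W) / (v + 1))
      - 1 * ((W + W\<^sup>2) / 8)"
    unfolding C3_def g_def
    by (intro econg_diff econg_mult econg_mult_right three_power_econg n_cases lower_div_econg econg_divide upper_sum_econg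
      power_div_36_econg cc_R R_rules v_R W_R di inverse_v_plus_1 R_inverse_numerals fermat_econg_rat[OF c cu, folded cc_def] econg_refl)
  also have "\<dots> = 3 / 4 * ((v * W\<^sup>2 + W) / (v + 1)) - (W + W\<^sup>2) / 8"
  proof -
    have "3 * d * (inverse 4 * inverse d) = 3 / 4" if "d \<noteq> 0" for d :: complex
      using that by (simp add: field_simps)
    from this[OF d0] show ?thesis by (simp only: mult_1)
  qed
  finally show ?thesis unfolding x_def .
qed

lemma B_econg:
  "of_int (rat_Legendre (c\<^sup>2 + 3) p) * (\<Sum>k = 0..p - 1. (2 * of_nat k + 1) * of_rat (S k) * of_rat (1 / (36 * (c\<^sup>2 + 3))) ^ k)
    \<approx> 1 / 2 * ((v * W\<^sup>2 + W) / (v + 1)) - (W\<^sup>2 - W) / 12 * ((v - 1) / (v + 1))"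
proof -
  define C3 x y where "C3 = (of_rat (c\<^sup>2 + 3) :: complex)" and "x = (of_rat (1 / (36 * (c\<^sup>2 + 3))) :: complex)"
    and "y = - 432 * x"
  define g where "g = v ^ Suc n + v' ^ n"
  have C30: "C3 \<noteq> 0" unfolding C3_def c3_complex using cs_nonzero by simp
  have x: "x = 1 / (36 * C3)" unfolding x_def C3_def cc_def by (simp only: of_rat_divide of_rat_mult of_rat_1 of_rat_numeral_eq)
  have C3i: "inverse C3 \<in> R" unfolding C3_def c3_complex by (rule inverse_c3)
  have C3R: "C3 \<in> R" unfolding C3_def by (rule R_of_rat[OF c3_D])
  have xR: "x \<in> R" unfolding x by (intro R_rules C3i R_inverse_numerals)
  \<comment> \<open>Here y = -12 / (c^2 + 3) = 4 s^2 / (c^2 + 3), the square of 2 s over the product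
    of c + s and c - s; hence u = v.\<close>
  have y: "y = v + v' - 2"
  proof -
    have "y = 4 * (s * s) / C3" unfolding y_def x s_square using C30 by (simp add: divide_simps)
    also have "\<dots> = v + v' - 2"
      unfolding C3_def c3_complex v_def v'_def using cs_nonzero by (simp add: divide_simps) (simp add: algebra_simps)
    finally show ?thesis .
  qed
  have gR: "g \<in> R" unfolding g_def by (intro R_rules v_R)
  define N where "N = (of_nat (Suc M) :: complex)"
  define e where "e = v ^ Suc M - v' ^ Suc M"
  have eR: "e \<in> R" unfolding e_def by (intro R_rules v_R)
  have NR: "N \<in> R" unfolding N_def by (intro R_rules)
  have S: "(\<Sum>k = 0..p - 1. (2 * of_nat k + 1) * of_rat (S k) * x ^ k)
      \<approx> g / (v + 1) / 2 - x ^ h / 4 * (N * ((v - 1) * e / (v + 1)))"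
    using sum_S_econg(2)[OF n_cases M_cases xR y_def]
    unfolding cheb_values(1)[OF vv' y v_not_plus_minus_1(2,3)] cheb_values(4)[OF vv' y v_not_plus_minus_1(2,3)] g_def N_def e_def .
  have L: "of_int (rat_Legendre (c\<^sup>2 + 3) p) \<approx> C3 ^ h"
    unfolding C3_def by (rule rat_Legendre_econg[OF c3_D])
  have "of_int (rat_Legendre (c\<^sup>2 + 3) p) * (\<Sum>k = 0..p - 1. (2 * of_nat k + 1) * of_rat (S k) * x ^ k)
     \<approx> C3 ^ h * (g / (v + 1) / 2 - x ^ h / 4 * (N * ((v - 1) * e / (v + 1))))"
    by (intro econg_mult L S R_rules C3R gR xR v_R inverse_v_plus_1 R_inverse_2 R_inverse_numerals eR NR)
  \<comment> \<open>Writing 1/4 = 3/12 produces the factor 3 N of \<open>upper_diff_econg\<close>;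
    the numerator 1^2 is kept to match \<open>power_div_36_econg\<close> at x = 1.\<close>
  also have "\<dots> = 1 / 2 * (C3 ^ h * g / (v + 1)) - (1\<^sup>2 / 36) ^ h * (inverse 12 * (3 * N * e) * ((v - 1) / (v + 1)))"
  proof -
    have "1\<^sup>2 / 36 = C3 * x" unfolding x using C30 by (simp add: divide_simps)
    then have ee: "(1\<^sup>2 / 36) ^ h = C3 ^ h * x ^ h" by (simp only: power_mult_distrib)
    have "t * (g / d / 2 - b / 4 * (N * (w * e / d))) = 1 / 2 * (t * g / d) - t * b * (inverse 12 * (3 * N * e) * (w / d))"
      for t b d w :: complex by (cases "d = 0") (simp_all add: field_simps)
    then show ?thesis unfolding ee by blast
  qed
  also have "\<dots> \<approx> 1 / 2 * ((v * W\<^sup>2 + W) / (v + 1)) - 1 * (inverse 12 * (W\<^sup>2 - W) * ((v - 1) / (v + 1)))"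
    unfolding C3_def g_def N_def e_def
    by (intro econg_diff econg_mult econg_mult_left econg_mult_right lower_div_econg upper_diff_econg
      power_div_36_econg R_rules v_R W_R inverse_v_plus_1 R_inverse_numerals R_inverse_2 econg_refl) simp_all
  also have "\<dots> = 1 / 2 * ((v * W\<^sup>2 + W) / (v + 1)) - (W\<^sup>2 - W) / 12 * ((v - 1) / (v + 1))" by simp
  finally show ?thesis unfolding x_def .
qed


lemma lower_quotient_eq: "(v * W\<^sup>2 + W) / (v + 1) = ((cc + s) * W\<^sup>2 + (cc - s) * W) / (2 * cc)"
proof -
  have "v * W\<^sup>2 + W = ((cc + s) * W\<^sup>2 + (cc - s) * W) / (cc - s)"
  proof -
    have "v * W\<^sup>2 + W = (cc + s) * W\<^sup>2 / (cc - s) + (cc - s) * W / (cc - s)"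
      unfolding v_def using cs_nonzero by simp
    then show ?thesis by (simp only: add_divide_distrib)
  qed
  then show ?thesis unfolding v_plus_1 using cs_nonzero by simp
qed

lemma upper_quotient_eq: "(v - 1) / (v + 1) = s / cc"
  unfolding v_plus_1 v_minus_1 using cs_nonzero by simp

lemma W_values:
  "j = 0 \<Longrightarrow> W = 1" "j = 1 \<Longrightarrow> W = complex_omega \<and> W\<^sup>2 = - 1 - complex_omega"
  "j = 2 \<Longrightarrow> W = - 1 - complex_omega \<and> W\<^sup>2 = complex_omega"
proof -
  have w: "complex_omega\<^sup>2 = - 1 - complex_omega" using complex_omega_square by (simp add: power2_eq_square)
  show "j = 0 \<Longrightarrow> W = 1" "j = 1 \<Longrightarrow> W = complex_omega \<and> W\<^sup>2 = - 1 - complex_omega"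
    unfolding W_def by (simp_all add: w)
  have "(- 1 - complex_omega)\<^sup>2 = 1 + 2 * complex_omega + complex_omega\<^sup>2"
    by (simp add: power2_eq_square algebra_simps)
  then show "j = 2 \<Longrightarrow> W = - 1 - complex_omega \<and> W\<^sup>2 = complex_omega"
    unfolding w W_def by (simp add: w)
qed

text \<open>Apart from j = 0, W + W^2 = -1 and W - W^2 is s for j = 1 and -s for j = 2, so s enters
  only through s^2 = -3 and the value is rational in c.\<close>

lemma lower_numerator_values:
  "j = 0 \<Longrightarrow> (cc + s) * W\<^sup>2 + (cc - s) * W = 2 * cc"
  "j = 1 \<Longrightarrow> (cc + s) * W\<^sup>2 + (cc - s) * W = 3 - cc"
  "j = 2 \<Longrightarrow> (cc + s) * W\<^sup>2 + (cc - s) * W = - 3 - cc"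
proof -
  show "j = 0 \<Longrightarrow> (cc + s) * W\<^sup>2 + (cc - s) * W = 2 * cc" using W_values(1) by simp
  have "(cc + s) * (- 1 - complex_omega) + (cc - s) * complex_omega = - cc - s * (1 + 2 * complex_omega)"
    "(cc + s) * complex_omega + (cc - s) * (- 1 - complex_omega) = - cc + s * (1 + 2 * complex_omega)"
    by (simp_all add: algebra_simps)
  then have "(cc + s) * (- 1 - complex_omega) + (cc - s) * complex_omega = - cc - s * s"
    "(cc + s) * complex_omega + (cc - s) * (- 1 - complex_omega) = - cc + s * s"
    unfolding s_def[symmetric] by simp_all
  then have e: "(cc + s) * (- 1 - complex_omega) + (cc - s) * complex_omega = 3 - cc"
    "(cc + s) * complex_omega + (cc - s) * (- 1 - complex_omega) = - 3 - cc"
    unfolding s_square by simp_all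
  show "(cc + s) * W\<^sup>2 + (cc - s) * W = 3 - cc" if j: "j = 1"
    unfolding conjunct2[OF W_values(2)[OF j]] unfolding conjunct1[OF W_values(2)[OF j]] by (rule e)
  show "(cc + s) * W\<^sup>2 + (cc - s) * W = - 3 - cc" if j: "j = 2"
    unfolding conjunct2[OF W_values(3)[OF j]] unfolding conjunct1[OF W_values(3)[OF j]] by (rule e)
qed

lemma A_rat_cong:
  defines "A \<equiv> of_int (rat_Legendre (3 * (c\<^sup>2 + 3)) p) * (\<Sum>k = 0..p - 1. S k * (c\<^sup>2 / (108 * (c\<^sup>2 + 3))) ^ k)"
  shows "j = 0 \<Longrightarrow> rat_cong p A (1 / 2)" "j = 1 \<Longrightarrow> rat_cong p A ((9 - 2 * c) / (8 * c))"
    "j = 2 \<Longrightarrow> rat_cong p A (- ((9 + 2 * c) / (8 * c)))"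
proof -
  have A: "of_rat A \<approx> 3 / 4 * (((cc + s) * W\<^sup>2 + (cc - s) * W) / (2 * cc)) - (W + W\<^sup>2) / 8"
    using A_econg unfolding lower_quotient_eq A_def by (simp only: of_rat_mult of_rat_of_int_eq of_rat_sum of_rat_power)
  have c0: "cc \<noteq> 0" by (rule cc_nonzero)
  show "rat_cong p A (1 / 2)" if j: "j = 0"
    using A unfolding lower_numerator_values(1)[OF j] W_values(1)[OF j] econg_of_rat_iff[symmetric] using c0 by (simp add: of_rat_divide)
  show "rat_cong p A ((9 - 2 * c) / (8 * c))" if j: "j = 1"
  proof -
    have "W + W\<^sup>2 = - 1"
      unfolding conjunct2[OF W_values(2)[OF j]] unfolding conjunct1[OF W_values(2)[OF j]] by simp
    moreover have "3 / 4 * ((3 - cc) / (2 * cc)) - (- 1) / 8 = (9 - 2 * cc) / (8 * cc)"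
      using c0 by (simp add: field_simps)
    moreover have "of_rat ((9 - 2 * c) / (8 * c)) = (9 - 2 * cc) / (8 * cc)"
      by (simp add: cc_def of_rat_divide of_rat_diff of_rat_mult)
    ultimately show ?thesis using A unfolding lower_numerator_values(2)[OF j] econg_of_rat_iff[symmetric] by (simp only:)
  qed
  show "rat_cong p A (- ((9 + 2 * c) / (8 * c)))" if j: "j = 2"
  proof -
    have "W + W\<^sup>2 = - 1"
      unfolding conjunct2[OF W_values(3)[OF j]] unfolding conjunct1[OF W_values(3)[OF j]] by simp
    moreover have "3 / 4 * ((- 3 - cc) / (2 * cc)) - (- 1) / 8 = - ((9 + 2 * cc) / (8 * cc))"
      using c0 by (simp add: field_simps)
    moreover have "of_rat (- ((9 + 2 * c) / (8 * c))) = - ((9 + 2 * cc) / (8 * cc))"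
      by (simp add: cc_def of_rat_divide of_rat_add of_rat_mult of_rat_minus)
    ultimately show ?thesis using A unfolding lower_numerator_values(3)[OF j] econg_of_rat_iff[symmetric] by (simp only:)
  qed
qed

lemma B_rat_cong:
  defines "B \<equiv> of_int (rat_Legendre (c\<^sup>2 + 3) p) *
    (\<Sum>k = 0..p - 1. of_nat (2 * k + 1) * S k / (36 ^ k * (3 + c\<^sup>2) ^ k))"
  shows "j = 0 \<Longrightarrow> rat_cong p B (1 / 2)" "j = 1 \<Longrightarrow> rat_cong p B ((2 - c) / (4 * c))"
    "j = 2 \<Longrightarrow> rat_cong p B (- ((2 + c) / (4 * c)))"
proof -
  have t: "of_nat (2 * k + 1) * S k / (36 ^ k * (3 + c\<^sup>2) ^ k) = (2 * of_nat k + 1) * S k * (1 / (36 * (c\<^sup>2 + 3))) ^ k" for k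
  proof -
    have "(1 / (36 * (c\<^sup>2 + 3))) ^ k = 1 / (36 ^ k * (3 + c\<^sup>2) ^ k)"
      by (simp only: power_divide power_mult_distrib power_one add.commute[of "c\<^sup>2"])
    moreover have "(of_nat (2 * k + 1) :: rat) = 2 * of_nat k + 1" by simp
    ultimately show ?thesis by (simp only: times_divide_eq_right mult_1_right)
  qed
  have o: "of_rat (2 * of_nat k + 1) = (2 * of_nat k + 1 :: complex)" for k
    by (simp add: of_rat_add of_rat_mult)
  have B: "of_rat B \<approx> 1 / 2 * (((cc + s) * W\<^sup>2 + (cc - s) * W) / (2 * cc)) - (W\<^sup>2 - W) / 12 * (s / cc)"
    using B_econg unfolding lower_quotient_eq upper_quotient_eq B_def t by (simp only: of_rat_mult[of _ "_ ^ _"] of_rat_mult[of "_ + _"] of_rat_mult[of "of_int _"] of_rat_of_int_eq of_rat_sum of_rat_power o)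
  have c0: "cc \<noteq> 0" by (rule cc_nonzero)
  show "rat_cong p B (1 / 2)" if j: "j = 0"
    using B unfolding lower_numerator_values(1)[OF j] W_values(1)[OF j] econg_of_rat_iff[symmetric] using c0 by (simp add: of_rat_divide)
  show "rat_cong p B ((2 - c) / (4 * c))" if j: "j = 1"
  proof -
    have "W\<^sup>2 - W = - s"
      unfolding conjunct2[OF W_values(2)[OF j]] unfolding conjunct1[OF W_values(2)[OF j]] by (simp add: s_def)
    moreover have "1 / 2 * ((3 - cc) / (2 * cc)) - (- s) / 12 * (s / cc) = (2 - cc) / (4 * cc)"
    proof -
      have "(- s) / 12 * (s / cc) = - (s * s) / (12 * cc)" by simp
      also have "\<dots> = 1 / (4 * cc)" unfolding s_square by simp
      finally have e: "(- s) / 12 * (s / cc) = 1 / (4 * cc)" .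
      show ?thesis unfolding e using c0 by (simp add: field_simps)
    qed
    moreover have "of_rat ((2 - c) / (4 * c)) = (2 - cc) / (4 * cc)"
      by (simp add: cc_def of_rat_divide of_rat_diff of_rat_mult)
    ultimately show ?thesis using B unfolding lower_numerator_values(2)[OF j] econg_of_rat_iff[symmetric] by (simp only:)
  qed
  show "rat_cong p B (- ((2 + c) / (4 * c)))" if j: "j = 2"
  proof -
    have "W\<^sup>2 - W = s"
      unfolding conjunct2[OF W_values(3)[OF j]] unfolding conjunct1[OF W_values(3)[OF j]] by (simp add: s_def)
    moreover have "1 / 2 * ((- 3 - cc) / (2 * cc)) - s / 12 * (s / cc) = - ((2 + cc) / (4 * cc))"
    proof -
      have "s / 12 * (s / cc) = (s * s) / (12 * cc)" by simp
      also have "\<dots> = - 1 / (4 * cc)" unfolding s_square by simp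
      finally have e: "s / 12 * (s / cc) = - 1 / (4 * cc)" .
      show ?thesis unfolding e using c0 by (simp add: field_simps)
    qed
    moreover have "of_rat (- ((2 + c) / (4 * c))) = - ((2 + cc) / (4 * cc))"
      by (simp add: cc_def of_rat_divide of_rat_add of_rat_mult of_rat_minus)
    ultimately show ?thesis using B unfolding lower_numerator_values(3)[OF j] econg_of_rat_iff[symmetric] by (simp only:)
  qed
qed

end

end

section \<open>The degenerate case c = 0 modulo p\<close>

context
  assumes c0: "rat_cong p c 0"
begin

lemma cc_econg_0: "cc \<approx> 0"
  using c0 unfolding econg_of_rat_iff[symmetric] cc_def by simp

text \<open>Here v = v' = -1 mod p, and the exponent (p - 1) / 3 or (p + 1) / 3 is even. It follows
  that c lies in neither \<open>C 1 p\<close> nor \<open>C 2 p\<close>, so the clauses with c in a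
  denominator are vacuous.\<close>

lemma W_econg_1: "W \<approx> 1"
proof -
  have *: "2 * cc * inverse d \<approx> 0" if "inverse d \<in> R" for d
  proof -
    have "2 * inverse d * cc \<approx> 2 * inverse d * 0" by (intro econg_mult_left cc_econg_0 R_rules that)
    then show ?thesis by (simp add: mult_ac)
  qed
  have "v = 2 * cc * inverse (cc - s) + - 1"
    unfolding v_def using cs_nonzero by (simp add: field_simps)
  then have v: "v \<approx> - 1" using econg_add[OF *[OF inverse_cs(2)] econg_refl[of "- 1"]] by simp
  have "v' = 2 * cc * inverse (cc + s) + - 1"
    unfolding v'_def using cs_nonzero by (simp add: field_simps)
  then have v': "v' \<approx> - 1" using econg_add[OF *[OF inverse_cs(1)] econg_refl[of "- 1"]] by simp
  obtain n M where "6 * n + 1 = p \<and> Suc M = 2 * n \<or> 6 * n + 5 = p \<and> Suc M = 2 * n + 2"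
    by (rule index_exists)
  then show ?thesis
  proof
    assume p: "6 * n + 1 = p \<and> Suc M = 2 * n"
    then have "p mod 3 = 1" "(p - 1) div 3 = 2 * n" by presburger+
    then have "W \<approx> v ^ (2 * n)" using symbol_split econg_sym by metis
    also have "v ^ (2 * n) \<approx> (- 1) ^ (2 * n)" by (rule econg_power[OF v R_minus_1])
    finally show ?thesis by simp
  next
    assume p: "6 * n + 5 = p \<and> Suc M = 2 * n + 2"
    then have "p mod 3 = 2" "(p + 1) div 3 = 2 * (n + 1)" by presburger+
    then have "W \<approx> v' ^ (2 * (n + 1))" using symbol_inert econg_sym by metis
    also have "v' ^ (2 * (n + 1)) \<approx> (- 1) ^ (2 * (n + 1))" by (rule econg_power[OF v' R_minus_1])
    finally show ?thesis by simp
  qed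
qed

lemma degenerate_index: "j \<noteq> 1" "j \<noteq> 2"
  using W_econg_1 omega_power_not_econg_one[of j] unfolding W_def by auto

text \<open>The argument of the sum vanishes modulo p, so only \<open>S 0\<close> = 1/2 survives,
  and 3 (c^2 + 3) = 9 mod p is a square.\<close>

lemma A_rat_cong_degenerate:
  "rat_cong p (of_int (rat_Legendre (3 * (c\<^sup>2 + 3)) p) * (\<Sum>k = 0..p - 1. S k * (c\<^sup>2 / (108 * (c\<^sup>2 + 3))) ^ k)) (1 / 2)"
proof -
  define C3 x where "C3 = (of_rat (c\<^sup>2 + 3) :: complex)" and "x = (of_rat (c\<^sup>2 / (108 * (c\<^sup>2 + 3))) :: complex)"
  have i108: "inverse 108 \<in> R"
    using R_inverse_mult[OF R_inverse_power[OF R_inverse_2, of 2] R_inverse_power[OF R_inverse_3, of 3]] by simp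
  have C3i: "inverse C3 \<in> R" unfolding C3_def c3_complex by (rule inverse_c3)
  have C3R: "C3 \<in> R" unfolding C3_def by (rule R_of_rat[OF c3_D])
  have x: "x = (cc * inverse (108 * C3)) * cc"
  proof -
    have "x = cc\<^sup>2 / (108 * C3)"
      unfolding x_def C3_def cc_def by (simp only: of_rat_divide of_rat_mult of_rat_power of_rat_numeral_eq)
    then show ?thesis by (simp only: divide_inverse power2_eq_square mult_ac)
  qed
  have "(cc * inverse (108 * C3)) * cc \<approx> (cc * inverse (108 * C3)) * 0"
    by (intro econg_mult_left cc_econg_0 R_rules cc_R C3i i108)
  then have x0: "x \<approx> 0" unfolding x by simp
  have "(\<Sum>k = 0..p - 1. of_rat (S k) * x ^ k) \<approx> (\<Sum>k = 0..p - 1. of_rat (S k) * 0 ^ k)"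
    by (intro econg_sum econg_mult_left econg_power x0 R_0 S_in_R) simp
  also have "(\<Sum>k = 0..p - 1. of_rat (S k) * 0 ^ k) = (of_rat (S 0) :: complex)"
  proof -
    have "(\<Sum>k = 0..p - 1. of_rat (S k) * (0 :: complex) ^ k) = (\<Sum>k \<in> {0}. of_rat (S k) * 0 ^ k)"
      by (intro sum.mono_neutral_right) auto
    then show ?thesis by simp
  qed
  also have "of_rat (S 0) = (1 / 2 :: complex)" by (simp add: S_def of_rat_divide)
  finally have S: "(\<Sum>k = 0..p - 1. of_rat (S k) * x ^ k) \<approx> 1 / 2" .
  have L: "of_int (rat_Legendre (3 * (c\<^sup>2 + 3)) p) \<approx> 1"
  proof -
    have "3 * (c\<^sup>2 + 3) \<in> D p" using D_mult[OF prime_p of_int_in_D[OF prime_p, of 3] c3_D] by simp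
    from rat_Legendre_econg[OF this] have "of_int (rat_Legendre (3 * (c\<^sup>2 + 3)) p) \<approx> (3 * C3) ^ h"
      unfolding C3_def by (simp only: of_rat_mult of_rat_numeral_eq)
    also have "(3 * C3) ^ h \<approx> (3 * 3) ^ h"
    proof (intro econg_power econg_mult_left R_rules)
      have "cc * cc + 3 \<approx> cc * 0 + 3" by (intro econg_add econg_mult_left cc_econg_0 cc_R econg_refl)
      moreover have "C3 = cc * cc + 3" unfolding C3_def cc_def by (simp add: of_rat_add of_rat_mult power2_eq_square)
      ultimately show "C3 \<approx> 3" by simp
    qed
    also have "(3 * 3) ^ h = (of_int 3 ^ (2 * h) :: complex)" by (simp add: power_mult)
    also have "of_int 3 ^ (2 * h) \<approx> 1"
      using p_gt_3 by (intro fermat_econg_int) (auto dest: zdvd_imp_le)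
    finally show ?thesis .
  qed
  have "of_int (rat_Legendre (3 * (c\<^sup>2 + 3)) p) * (\<Sum>k = 0..p - 1. of_rat (S k) * x ^ k) \<approx> 1 * (1 / 2)"
    by (intro econg_mult L S R_rules R_inverse_2)
  then have "of_rat (of_int (rat_Legendre (3 * (c\<^sup>2 + 3)) p) * (\<Sum>k = 0..p - 1. S k * (c\<^sup>2 / (108 * (c\<^sup>2 + 3))) ^ k)) \<approx> of_rat (1 / 2)"
    unfolding x_def by (simp only: of_rat_mult of_rat_of_int_eq of_rat_sum of_rat_power of_rat_divide of_rat_1 of_rat_numeral_eq mult_1)
  then show ?thesis by (simp only: econg_of_rat_iff)
qed

end

end

end

text \<open>The clause for \<open>B\<close> on \<open>C 0 p\<close> excludes c = 0 mod p because the
  value is different there: the limit u = -1 of the closed forms gives 2/9. For p = 7 and c = 0 the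
  left side is 1, whereas 1/2 is 4 modulo 7.\<close>

theorem theorem37:
  fixes p :: nat and c :: rat
  assumes "prime p" and "p > 3" and "c \<in> D p" and "\<not> rat_cong p (c\<^sup>2) (- 3)"
  defines "A \<equiv> of_int (rat_Legendre (3 * (c\<^sup>2 + 3)) p) *
                 (\<Sum>k = 0..p - 1. S k * (c\<^sup>2 / (108 * (c\<^sup>2 + 3))) ^ k)"
    and "B \<equiv> of_int (rat_Legendre (c\<^sup>2 + 3) p) *
                 (\<Sum>k = 0..p - 1. of_nat (2 * k + 1) * S k / (36 ^ k * (3 + c\<^sup>2) ^ k))"
  shows "((c \<in> C 0 p \<longrightarrow> rat_cong p A (1 / 2)) \<and>
          (c \<in> C 1 p \<longrightarrow> rat_cong p A ((9 - 2 * c) / (8 * c))) \<and>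
          (c \<in> C 2 p \<longrightarrow> rat_cong p A (- ((9 + 2 * c) / (8 * c))))) \<and>
         ((c \<in> C 0 p \<and> \<not> rat_cong p c 0 \<longrightarrow> rat_cong p B (1 / 2)) \<and>
          (c \<in> C 1 p \<longrightarrow> rat_cong p B ((2 - c) / (4 * c))) \<and>
          (c \<in> C 2 p \<longrightarrow> rat_cong p B (- ((2 + c) / (4 * c)))))"
proof -
  interpret eis_localization p using assms(1,2) by unfold_locales
  obtain n M where nM: "6 * n + 1 = p \<and> Suc M = 2 * n \<or> 6 * n + 5 = p \<and> Suc M = 2 * n + 2"
    by (rule index_exists)
  have C: "\<exists>m. rat_cong p c (of_int m) \<and> cubic_symbol (of_int m + 1 + 2 * omega) p = omega ^ j" if "c \<in> C j p" for j
    using that unfolding C_def by blast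
  show ?thesis
  proof (cases "rat_cong p c 0")
    case True
    have "c \<notin> C 1 p" "c \<notin> C 2 p"
      using C[of 1] C[of 2] degenerate_index[OF assms(3,4) _ _ True] by blast+
    moreover have "c \<in> C 0 p \<Longrightarrow> rat_cong p A (1 / 2)"
      using C[of 0] A_rat_cong_degenerate[OF assms(3,4) _ _ True] unfolding A_def by blast
    ultimately show ?thesis using True by blast
  next
    case False
    note A = A_rat_cong[OF assms(3,4) _ _ nM False, folded A_def]
      and B = B_rat_cong[OF assms(3,4) _ _ nM False, folded B_def]
    show ?thesis using C[of 0] C[of 1] C[of 2] A B by blast
  qed
qed

end
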